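(* Let $(N,\mathcal I,\mathcal J,\mathcal K,g)$ be an HKT nilmanifold. Then $g$ is quaternionic balanced.
   Context: A hypercomplex manifold is a manifold $M$ with three integrable complex structures $\mathcal I,\mathcal J,\mathcal K$ satisfying $\mathcal I\mathcal J=-\mathcal J\mathcal I=\mathcal K$; it carries the family of complex structures $a\mathcal I+b\mathcal J+c\mathcal K$, $a^2+b^2+c^2=1$. A nilmanifold is a quotient $N=\Gamma\backslash G$ of a connected, simply connected nilpotent Lie group $G$ by a co-compact discrete subgroup $\Gamma$. A hypercomplex nilmanifold is a nilmanifold $N=\Gamma\backslash G$ with the hypercomplex structure induced by a left-invariant hypercomplex structure on $G$. A quaternionic Hermitian metric on a hypercomplex manifold $M$ is a Riemannian metric $g$ which is Hermitian with respect to $\mathcal I$, $\mathcal J$ and $\mathcal K$. Set $\Omega:=g(\cdot,\mathcal J\cdot)+\sqrt{-1}\,g(\cdot,\mathcal K\cdot)$, a $(2,0)$-form on $(M,\mathcal I)$. The metric $g$ is an HKT-metric if $\partial\Omega=0$, where $\partial$ is the Dolbeault differential on $(M,\mathcal I)$. An HKT nilmanifold is a hypercomplex nilmanifold $N=\Gamma\backslash G$ with a metric $g$ induced by a left-invariant HKT-metric on $G$. For a Hermitian manifold $(M,\mathcal L,g)$ with complex structure $\mathcal L$, let $\omega=g(\cdot,\mathcal L\cdot)$ and let $\theta=d^*\omega\circ\mathcal L$ be the Lee form, where $d^*$ is the adjoint of $d$. The metric $g$ is balanced (with respect to $\mathcal L$) if $\theta=0$. A quaternionic Hermitian metric on a hypercomplex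 manifold is quaternionic balanced if it is balanced with respect to all complex structures $a\mathcal I+b\mathcal J+c\mathcal K$, $a^2+b^2+c^2=1$. *)

theory Defs
  imports "HOL-Analysis.Analysis" "HOL-Algebra.Generated_Groups"
begin

section \<open>Smooth manifolds\<close>

text \<open>\<open>Ck_on k S f\<close> is only used for open \<open>S\<close>.\<close>

primrec Ck_on :: "nat \<Rightarrow> 'e::euclidean_space set \<Rightarrow> ('e \<Rightarrow> 'f::real_normed_vector) \<Rightarrow> bool" where
  "Ck_on 0 S f \<longleftrightarrow> continuous_on S f"
| "Ck_on (Suc k) S f \<longleftrightarrow> (\<forall>x\<in>S. f differentiable at x) \<and>
     (\<forall>v. Ck_on k S (\<lambda>x. frechet_derivative f (at x) v))"

definition smooth_on :: "'e::euclidean_space set \<Rightarrow> ('e \<Rightarrow> 'f::real_normed_vector) \<Rightarrow> bool" where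
  "smooth_on S f \<longleftrightarrow> (\<forall>k. Ck_on k S f)"

text \<open>A chart is a pair of its domain and its coordinate map; the values of the coordinate map
  off the domain are irrelevant.\<close>

type_synonym ('a, 'n) chart = "'a set \<times> ('a \<Rightarrow> real^'n)"

record ('a, 'n) manifold =
  mtop :: "'a topology"
  atlas :: "('a, 'n) chart set"

definition cimg :: "('a, 'n) chart \<Rightarrow> (real^'n) set" where
  "cimg c = snd c ` fst c"

definition cinv :: "('a, 'n) chart \<Rightarrow> real^'n \<Rightarrow> 'a" where
  "cinv c = inv_into (fst c) (snd c)"

definition loc_rep :: "('a \<Rightarrow> 'b) \<Rightarrow> ('a, 'n) chart \<Rightarrow> ('b, 'm) chart \<Rightarrow> real^'n \<Rightarrow> real^'m" where
  "loc_rep F c c' = snd c' \<circ> F \<circ> cinv c"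

definition smooth_manifold :: "('a, 'n::finite) manifold \<Rightarrow> bool" where
  "smooth_manifold M \<longleftrightarrow>
     Hausdorff_space (mtop M) \<and> second_countable (mtop M) \<and>
     (\<Union>c\<in>atlas M. fst c) = topspace (mtop M) \<and>
     (\<forall>c\<in>atlas M. openin (mtop M) (fst c) \<and> open (cimg c) \<and>
        homeomorphic_map (subtopology (mtop M) (fst c)) (top_of_set (cimg c)) (snd c)) \<and>
     (\<forall>c\<in>atlas M. \<forall>c'\<in>atlas M. smooth_on (snd c ` (fst c \<inter> fst c')) (loc_rep id c c'))"

definition smooth_map ::
    "('a, 'n::finite) manifold \<Rightarrow> ('b, 'm::finite) manifold \<Rightarrow> ('a \<Rightarrow> 'b) \<Rightarrow> bool" where
  "smooth_map M M' F \<longleftrightarrow> continuous_map (mtop M) (mtop M') F \<and>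
     (\<forall>c\<in>atlas M. \<forall>c'\<in>atlas M'.
        smooth_on (snd c ` {p \<in> fst c. F p \<in> fst c'}) (loc_rep F c c'))"

text \<open>The differential of \<open>F\<close> at \<open>p\<close>, expressed in the charts \<open>c\<close> around \<open>p\<close> and \<open>c'\<close> around \<open>F p\<close>.\<close>

definition tangent_map ::
    "('a \<Rightarrow> 'b) \<Rightarrow> ('a, 'n::finite) chart \<Rightarrow> ('b, 'm::finite) chart \<Rightarrow> 'a \<Rightarrow> real^'n \<Rightarrow> real^'m" where
  "tangent_map F c c' p = frechet_derivative (loc_rep F c c') (at (snd c p))"

definition local_diffeo ::
    "('a, 'n::finite) manifold \<Rightarrow> ('b, 'n) manifold \<Rightarrow> ('a \<Rightarrow> 'b) \<Rightarrow> bool" where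
  "local_diffeo M M' F \<longleftrightarrow> smooth_map M M' F \<and>
     (\<forall>c\<in>atlas M. \<forall>c'\<in>atlas M'. \<forall>p\<in>fst c. F p \<in> fst c' \<longrightarrow> bij (tangent_map F c c' p))"


section \<open>Tensor fields\<close>

text \<open>A tensor field is given by its components in all charts: \<open>T c x\<close> is the value, in the
  coordinates of the chart \<open>c\<close>, at the point with coordinates \<open>x\<close> (meaningful for \<open>x \<in> cimg c\<close>).
  The predicates \<open>related_\<dots> M M' F T T'\<close> say that \<open>T\<close> and \<open>T'\<close> correspond under \<open>F : M \<rightarrow> M'\<close>:
  for covariant tensors \<open>T = F\<^sup>* T'\<close>, for endomorphism fields \<open>dF \<circ> T = T' \<circ> dF\<close>. With \<open>F = id\<close>
  this is the transformation law under changes of charts, with \<open>F\<close> a translation it is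
  invariance.\<close>

type_synonym ('a, 'n) cov1 = "('a, 'n) chart \<Rightarrow> real^'n \<Rightarrow> real^'n \<Rightarrow> real"
type_synonym ('a, 'n) cov2 = "('a, 'n) chart \<Rightarrow> real^'n \<Rightarrow> real^'n \<Rightarrow> real^'n \<Rightarrow> real"
type_synonym ('a, 'n) endo = "('a, 'n) chart \<Rightarrow> real^'n \<Rightarrow> real^'n \<Rightarrow> real^'n"

definition related_cov1 :: "('a, 'n::finite) manifold \<Rightarrow> ('b, 'm::finite) manifold \<Rightarrow> ('a \<Rightarrow> 'b) \<Rightarrow>
    ('a, 'n) cov1 \<Rightarrow> ('b, 'm) cov1 \<Rightarrow> bool" where
  "related_cov1 M M' F T T' \<longleftrightarrow>
     (\<forall>c\<in>atlas M. \<forall>c'\<in>atlas M'. \<forall>p\<in>fst c. F p \<in> fst c' \<longrightarrow>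
        (\<forall>v. T c (snd c p) v = T' c' (snd c' (F p)) (tangent_map F c c' p v)))"

definition related_cov2 :: "('a, 'n::finite) manifold \<Rightarrow> ('b, 'm::finite) manifold \<Rightarrow> ('a \<Rightarrow> 'b) \<Rightarrow>
    ('a, 'n) cov2 \<Rightarrow> ('b, 'm) cov2 \<Rightarrow> bool" where
  "related_cov2 M M' F T T' \<longleftrightarrow>
     (\<forall>c\<in>atlas M. \<forall>c'\<in>atlas M'. \<forall>p\<in>fst c. F p \<in> fst c' \<longrightarrow>
        (\<forall>u v. T c (snd c p) u v =
           T' c' (snd c' (F p)) (tangent_map F c c' p u) (tangent_map F c c' p v)))"

definition related_endo :: "('a, 'n::finite) manifold \<Rightarrow> ('b, 'm::finite) manifold \<Rightarrow> ('a \<Rightarrow> 'b) \<Rightarrow>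
    ('a, 'n) endo \<Rightarrow> ('b, 'm) endo \<Rightarrow> bool" where
  "related_endo M M' F T T' \<longleftrightarrow>
     (\<forall>c\<in>atlas M. \<forall>c'\<in>atlas M'. \<forall>p\<in>fst c. F p \<in> fst c' \<longrightarrow>
        (\<forall>v. tangent_map F c c' p (T c (snd c p) v) =
           T' c' (snd c' (F p)) (tangent_map F c c' p v)))"

definition one_form :: "('a, 'n::finite) manifold \<Rightarrow> ('a, 'n) cov1 \<Rightarrow> bool" where
  "one_form M \<alpha> \<longleftrightarrow> related_cov1 M M id \<alpha> \<alpha> \<and>
     (\<forall>c\<in>atlas M. (\<forall>x\<in>cimg c. linear (\<alpha> c x)) \<and> (\<forall>v. smooth_on (cimg c) (\<lambda>x. \<alpha> c x v)))"

definition endo_field :: "('a, 'n::finite) manifold \<Rightarrow> ('a, 'n) endo \<Rightarrow> bool" where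
  "endo_field M L \<longleftrightarrow> related_endo M M id L L \<and>
     (\<forall>c\<in>atlas M. (\<forall>x\<in>cimg c. linear (L c x)) \<and> (\<forall>v. smooth_on (cimg c) (\<lambda>x. L c x v)))"

definition riemannian_metric :: "('a, 'n::finite) manifold \<Rightarrow> ('a, 'n) cov2 \<Rightarrow> bool" where
  "riemannian_metric M g \<longleftrightarrow> related_cov2 M M id g g \<and>
     (\<forall>c\<in>atlas M.
        (\<forall>x\<in>cimg c. bilinear (g c x) \<and> (\<forall>u v. g c x u v = g c x v u) \<and>
           (\<forall>v. v \<noteq> 0 \<longrightarrow> 0 < g c x v v)) \<and>
        (\<forall>u v. smooth_on (cimg c) (\<lambda>x. g c x u v)))"


section \<open>Differential forms in a chart\<close>

text \<open>The exterior derivatives of the 1-form \<open>\<alpha>\<close> and of the (possibly complex valued) 2-form \<open>\<beta>\<close>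
  given by their components in one chart, i.e. on an open subset of \<open>real^'n\<close>.\<close>

definition ext_d1 :: "(real^'n::finite \<Rightarrow> real^'n \<Rightarrow> real) \<Rightarrow>
    real^'n \<Rightarrow> real^'n \<Rightarrow> real^'n \<Rightarrow> real" where
  "ext_d1 \<alpha> x u v = frechet_derivative (\<lambda>y. \<alpha> y v) (at x) u - frechet_derivative (\<lambda>y. \<alpha> y u) (at x) v"

definition ext_d2 :: "(real^'n::finite \<Rightarrow> real^'n \<Rightarrow> real^'n \<Rightarrow> 'f::real_normed_vector) \<Rightarrow>
    real^'n \<Rightarrow> real^'n \<Rightarrow> real^'n \<Rightarrow> real^'n \<Rightarrow> 'f" where
  "ext_d2 \<beta> x u v w =
     frechet_derivative (\<lambda>y. \<beta> y v w) (at x) u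
     - frechet_derivative (\<lambda>y. \<beta> y u w) (at x) v
     + frechet_derivative (\<lambda>y. \<beta> y u v) (at x) w"

text \<open>The \<open>(1,0)\<close>-part, with respect to the complex structure \<open>L\<close>, of a real linear map \<open>f\<close> from the
  tangent space to the complex numbers, and the \<open>(3,0)\<close>-part of a 3-form (the \<open>(1,0)\<close>-part in each
  argument).\<close>

definition part10 :: "('v \<Rightarrow> 'v) \<Rightarrow> ('v \<Rightarrow> complex) \<Rightarrow> 'v \<Rightarrow> complex" where
  "part10 L f v = (f v - \<i> * f (L v)) / 2"

definition part30 :: "('v \<Rightarrow> 'v) \<Rightarrow> ('v \<Rightarrow> 'v \<Rightarrow> 'v \<Rightarrow> complex) \<Rightarrow> 'v \<Rightarrow> 'v \<Rightarrow> 'v \<Rightarrow> complex" where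
  "part30 L \<beta> u v w =
     part10 L (\<lambda>u'. part10 L (\<lambda>v'. part10 L (\<lambda>w'. \<beta> u' v' w') w) v) u"

text \<open>The Dolbeault operator \<open>\<partial>\<close> of \<open>L\<close> on \<open>(2,0)\<close>-forms.\<close>

definition dolbeault20 :: "(real^'n::finite \<Rightarrow> real^'n \<Rightarrow> real^'n) \<Rightarrow>
    (real^'n \<Rightarrow> real^'n \<Rightarrow> real^'n \<Rightarrow> complex) \<Rightarrow>
    real^'n \<Rightarrow> real^'n \<Rightarrow> real^'n \<Rightarrow> real^'n \<Rightarrow> complex" where
  "dolbeault20 L \<beta> x = part30 (L x) (ext_d2 \<beta> x)"


section \<open>Hypercomplex structures and HKT metrics\<close>

definition lie_bracket :: "(real^'n::finite \<Rightarrow> real^'n) \<Rightarrow> (real^'n \<Rightarrow> real^'n) \<Rightarrow> real^'n \<Rightarrow> real^'n" where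
  "lie_bracket X Y x =
     frechet_derivative Y (at x) (X x) - frechet_derivative X (at x) (Y x)"

text \<open>Integrability is the vanishing of the Nijenhuis tensor.\<close>

definition complex_structure :: "('a, 'n::finite) manifold \<Rightarrow> ('a, 'n) endo \<Rightarrow> bool" where
  "complex_structure M L \<longleftrightarrow> endo_field M L \<and>
     (\<forall>c\<in>atlas M. \<forall>x\<in>cimg c. \<forall>v. L c x (L c x v) = - v) \<and>
     (\<forall>c\<in>atlas M. \<forall>X Y. smooth_on (cimg c) X \<and> smooth_on (cimg c) Y \<longrightarrow>
        (\<forall>x\<in>cimg c.
           lie_bracket (\<lambda>y. L c y (X y)) (\<lambda>y. L c y (Y y)) x
           - L c x (lie_bracket (\<lambda>y. L c y (X y)) Y x)
           - L c x (lie_bracket X (\<lambda>y. L c y (Y y)) x)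
           - lie_bracket X Y x = 0))"

definition hypercomplex ::
    "('a, 'n::finite) manifold \<Rightarrow> ('a, 'n) endo \<Rightarrow> ('a, 'n) endo \<Rightarrow> ('a, 'n) endo \<Rightarrow> bool" where
  "hypercomplex M I J K \<longleftrightarrow>
     complex_structure M I \<and> complex_structure M J \<and> complex_structure M K \<and>
     (\<forall>c\<in>atlas M. \<forall>x\<in>cimg c. \<forall>v. I c x (J c x v) = K c x v \<and> - J c x (I c x v) = K c x v)"

definition hermitian :: "('a, 'n::finite) manifold \<Rightarrow> ('a, 'n) endo \<Rightarrow> ('a, 'n) cov2 \<Rightarrow> bool" where
  "hermitian M L g \<longleftrightarrow>
     riemannian_metric M g \<and>
     (\<forall>c\<in>atlas M. \<forall>x\<in>cimg c. \<forall>u v. g c x (L c x u) (L c x v) = g c x u v)"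

definition quaternionic_hermitian :: "('a, 'n::finite) manifold \<Rightarrow>
    ('a, 'n) endo \<Rightarrow> ('a, 'n) endo \<Rightarrow> ('a, 'n) endo \<Rightarrow> ('a, 'n) cov2 \<Rightarrow> bool" where
  "quaternionic_hermitian M I J K g \<longleftrightarrow> hermitian M I g \<and> hermitian M J g \<and> hermitian M K g"

definition fundamental_form :: "('a, 'n) cov2 \<Rightarrow> ('a, 'n) endo \<Rightarrow> ('a, 'n) cov2" where
  "fundamental_form g L c x u v = g c x u (L c x v)"

definition Omega :: "('a, 'n) cov2 \<Rightarrow> ('a, 'n) endo \<Rightarrow> ('a, 'n) endo \<Rightarrow>
    ('a, 'n) chart \<Rightarrow> real^'n \<Rightarrow> real^'n \<Rightarrow> real^'n \<Rightarrow> complex" where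
  "Omega g J K c x u v =
     of_real (fundamental_form g J c x u v) + \<i> * of_real (fundamental_form g K c x u v)"

definition HKT_metric :: "('a, 'n::finite) manifold \<Rightarrow>
    ('a, 'n) endo \<Rightarrow> ('a, 'n) endo \<Rightarrow> ('a, 'n) endo \<Rightarrow> ('a, 'n) cov2 \<Rightarrow> bool" where
  "HKT_metric M I J K g \<longleftrightarrow> quaternionic_hermitian M I J K g \<and>
     (\<forall>c\<in>atlas M. \<forall>x\<in>cimg c. \<forall>u v w. dolbeault20 (I c) (Omega g J K c) x u v w = 0)"


section \<open>The Lee form and balanced metrics\<close>

definition gram :: "('a, 'n::finite) cov2 \<Rightarrow> ('a, 'n) chart \<Rightarrow> real^'n \<Rightarrow> real^'n^'n" where
  "gram g c x = (\<chi> i j. g c x (axis i 1) (axis j 1))"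

definition vol_density :: "('a, 'n::finite) cov2 \<Rightarrow> ('a, 'n) chart \<Rightarrow> real^'n \<Rightarrow> real" where
  "vol_density g c x = sqrt (det (gram g c x))"

text \<open>The pointwise inner products induced by the metric on 1-forms and on 2-forms. The latter is
  normalised such that it is \<open>\<Sum>i<j. \<beta> e\<^sub>i e\<^sub>j * \<gamma> e\<^sub>i e\<^sub>j\<close> for an orthonormal basis \<open>e\<close>.\<close>

definition inner1 :: "real^'n::finite^'n \<Rightarrow> (real^'n \<Rightarrow> real) \<Rightarrow> (real^'n \<Rightarrow> real) \<Rightarrow> real" where
  "inner1 A \<alpha> \<beta> = (\<Sum>i\<in>UNIV. \<Sum>j\<in>UNIV.
     matrix_inv A $ i $ j * \<alpha> (axis i 1) * \<beta> (axis j 1))"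

definition inner2 :: "real^'n::finite^'n \<Rightarrow>
    (real^'n \<Rightarrow> real^'n \<Rightarrow> real) \<Rightarrow> (real^'n \<Rightarrow> real^'n \<Rightarrow> real) \<Rightarrow> real" where
  "inner2 A \<beta> \<gamma> = (\<Sum>i\<in>UNIV. \<Sum>j\<in>UNIV. \<Sum>k\<in>UNIV. \<Sum>l\<in>UNIV.
     matrix_inv A $ i $ k * matrix_inv A $ j $ l
       * \<beta> (axis i 1) (axis j 1) * \<gamma> (axis k 1) (axis l 1)) / 2"

definition supported_in :: "('a, 'n::finite) manifold \<Rightarrow> ('a, 'n) cov1 \<Rightarrow> 'a set \<Rightarrow> bool" where
  "supported_in M \<alpha> S \<longleftrightarrow>
     (\<exists>C. compactin (mtop M) C \<and> C \<subseteq> S \<and>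
        (\<forall>c\<in>atlas M. \<forall>p\<in>fst c - C. \<forall>v. \<alpha> c (snd c p) v = 0))"

text \<open>\<open>is_codiff M g \<omega> \<eta>\<close> says \<open>\<eta> = d\<^sup>*\<omega>\<close>, where \<open>d\<^sup>*\<close> is the adjoint of \<open>d\<close> for the \<open>L\<^sup>2\<close> products
  of \<open>g\<close>: the 1-form \<open>\<eta>\<close> satisfies \<open>\<integral> \<langle>d\<alpha>, \<omega>\<rangle> dvol = \<integral> \<langle>\<alpha>, \<eta>\<rangle> dvol\<close> for all smooth 1-forms \<open>\<alpha>\<close> with
  compact support in a chart domain. By a partition of unity these test forms span the compactly
  supported 1-forms. They also determine \<open>\<eta>\<close>, so that \<open>is_codiff\<close> is a partial function of \<open>\<omega>\<close>.\<close>

definition is_codiff :: "('a, 'n::finite) manifold \<Rightarrow> ('a, 'n) cov2 \<Rightarrow>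
    ('a, 'n) cov2 \<Rightarrow> ('a, 'n) cov1 \<Rightarrow> bool" where
  "is_codiff M g \<omega> \<eta> \<longleftrightarrow> one_form M \<eta> \<and>
     (\<forall>c\<in>atlas M. \<forall>\<alpha>. one_form M \<alpha> \<and> supported_in M \<alpha> (fst c) \<longrightarrow>
        (LINT x:cimg c|lborel. inner2 (gram g c x) (ext_d1 (\<alpha> c) x) (\<omega> c x) * vol_density g c x) =
        (LINT x:cimg c|lborel. inner1 (gram g c x) (\<alpha> c x) (\<eta> c x) * vol_density g c x))"

text \<open>\<open>is_lee_form M g L \<theta>\<close> says \<open>\<theta> = d\<^sup>*\<omega> \<circ> L\<close> for \<open>\<omega> = g(\<cdot>, L\<cdot>)\<close>.\<close>

definition is_lee_form :: "('a, 'n::finite) manifold \<Rightarrow> ('a, 'n) cov2 \<Rightarrow> ('a, 'n) endo \<Rightarrow>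
    ('a, 'n) cov1 \<Rightarrow> bool" where
  "is_lee_form M g L \<theta> \<longleftrightarrow>
     (\<exists>\<eta>. is_codiff M g (fundamental_form g L) \<eta> \<and>
        (\<forall>c\<in>atlas M. \<forall>x\<in>cimg c. \<forall>v. \<theta> c x v = \<eta> c x (L c x v)))"

definition balanced :: "('a, 'n::finite) manifold \<Rightarrow> ('a, 'n) endo \<Rightarrow> ('a, 'n) cov2 \<Rightarrow> bool" where
  "balanced M L g \<longleftrightarrow> is_lee_form M g L (\<lambda>c x v. 0)"

definition quaternionic_balanced :: "('a, 'n::finite) manifold \<Rightarrow>
    ('a, 'n) endo \<Rightarrow> ('a, 'n) endo \<Rightarrow> ('a, 'n) endo \<Rightarrow> ('a, 'n) cov2 \<Rightarrow> bool" where
  "quaternionic_balanced M I J K g \<longleftrightarrow>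
     (\<forall>a b c'. a\<^sup>2 + b\<^sup>2 + c'\<^sup>2 = 1 \<longrightarrow>
        balanced M (\<lambda>c x v. a *\<^sub>R I c x v + b *\<^sub>R J c x v + c' *\<^sub>R K c x v) g)"


section \<open>Nilmanifolds\<close>

definition lie_group :: "('a, 'z) monoid_scheme \<Rightarrow> ('a, 'n::finite) manifold \<Rightarrow> bool" where
  "lie_group G M \<longleftrightarrow> group G \<and> smooth_manifold M \<and> topspace (mtop M) = carrier G \<and>
     continuous_map (prod_topology (mtop M) (mtop M)) (mtop M) (\<lambda>(p, q). p \<otimes>\<^bsub>G\<^esub> q) \<and>
     (\<forall>c\<in>atlas M. \<forall>c'\<in>atlas M. \<forall>c''\<in>atlas M.
        smooth_on (map_prod (snd c) (snd c') ` {(p, q). p \<in> fst c \<and> q \<in> fst c' \<and> p \<otimes>\<^bsub>G\<^esub> q \<in> fst c''})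
          (\<lambda>(x, y). snd c'' (cinv c x \<otimes>\<^bsub>G\<^esub> cinv c' y))) \<and>
     smooth_map M M (\<lambda>p. inv\<^bsub>G\<^esub> p)"

primrec lower_central :: "('a, 'z) monoid_scheme \<Rightarrow> nat \<Rightarrow> 'a set" where
  "lower_central G 0 = carrier G"
| "lower_central G (Suc k) = generate G
     {x \<otimes>\<^bsub>G\<^esub> y \<otimes>\<^bsub>G\<^esub> inv\<^bsub>G\<^esub> x \<otimes>\<^bsub>G\<^esub> inv\<^bsub>G\<^esub> y | x y. x \<in> carrier G \<and> y \<in> lower_central G k}"

definition nilpotent_group :: "('a, 'z) monoid_scheme \<Rightarrow> bool" where
  "nilpotent_group G \<longleftrightarrow> group G \<and> (\<exists>k. lower_central G k = {\<one>\<^bsub>G\<^esub>})"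

definition simply_connected_top :: "'a topology \<Rightarrow> bool" where
  "simply_connected_top X \<longleftrightarrow> path_connected_space X \<and>
     (\<forall>\<gamma>. pathin X \<gamma> \<and> \<gamma> 0 = \<gamma> 1 \<longrightarrow>
        homotopic_with (\<lambda>h. h 0 = \<gamma> 0 \<and> h 1 = \<gamma> 0) (top_of_set {0..1}) X \<gamma> (\<lambda>t. \<gamma> 0))"

text \<open>\<open>N\<close> is the quotient \<open>\<Gamma>\<setminus>G\<close>, whose points are the cosets \<open>\<Gamma> x\<close>, with the quotient topology and
  the smooth structure that makes the projection a local diffeomorphism (which is unique).\<close>

definition nilmanifold :: "('a, 'z) monoid_scheme \<Rightarrow> ('a, 'n::finite) manifold \<Rightarrow> 'a set \<Rightarrow>
    ('a set, 'n) manifold \<Rightarrow> bool" where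
  "nilmanifold G M \<Gamma> N \<longleftrightarrow>
     lie_group G M \<and> nilpotent_group G \<and>
     connected_space (mtop M) \<and> simply_connected_top (mtop M) \<and>
     subgroup \<Gamma> G \<and> subtopology (mtop M) \<Gamma> = discrete_topology \<Gamma> \<and>
     smooth_manifold N \<and> topspace (mtop N) = rcosets\<^bsub>G\<^esub> \<Gamma> \<and>
     quotient_map (mtop M) (mtop N) (\<lambda>x. \<Gamma> #>\<^bsub>G\<^esub> x) \<and>
     local_diffeo M N (\<lambda>x. \<Gamma> #>\<^bsub>G\<^esub> x) \<and>
     compact_space (mtop N)"

definition left_invariant_endo ::
    "('a, 'z) monoid_scheme \<Rightarrow> ('a, 'n::finite) manifold \<Rightarrow> ('a, 'n) endo \<Rightarrow> bool" where
  "left_invariant_endo G M L \<longleftrightarrow> (\<forall>a\<in>carrier G. related_endo M M (\<lambda>x. a \<otimes>\<^bsub>G\<^esub> x) L L)"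

definition left_invariant_metric ::
    "('a, 'z) monoid_scheme \<Rightarrow> ('a, 'n::finite) manifold \<Rightarrow> ('a, 'n) cov2 \<Rightarrow> bool" where
  "left_invariant_metric G M g \<longleftrightarrow> (\<forall>a\<in>carrier G. related_cov2 M M (\<lambda>x. a \<otimes>\<^bsub>G\<^esub> x) g g)"

text \<open>The hypercomplex structure \<open>I, J, K\<close> and the metric \<open>g\<close> on \<open>N = \<Gamma>\<setminus>G\<close> are induced by a
  left-invariant hypercomplex structure and a left-invariant HKT metric on \<open>G\<close>.\<close>

definition HKT_nilmanifold :: "('a, 'z) monoid_scheme \<Rightarrow> ('a, 'n::finite) manifold \<Rightarrow> 'a set \<Rightarrow>
    ('a set, 'n) manifold \<Rightarrow> ('a set, 'n) endo \<Rightarrow> ('a set, 'n) endo \<Rightarrow> ('a set, 'n) endo \<Rightarrow>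
    ('a set, 'n) cov2 \<Rightarrow> bool" where
  "HKT_nilmanifold G M \<Gamma> N I J K g \<longleftrightarrow>
     nilmanifold G M \<Gamma> N \<and>
     endo_field N I \<and> endo_field N J \<and> endo_field N K \<and> riemannian_metric N g \<and>
     (\<exists>I\<^sub>G J\<^sub>G K\<^sub>G g\<^sub>G.
        hypercomplex M I\<^sub>G J\<^sub>G K\<^sub>G \<and> HKT_metric M I\<^sub>G J\<^sub>G K\<^sub>G g\<^sub>G \<and>
        left_invariant_endo G M I\<^sub>G \<and> left_invariant_endo G M J\<^sub>G \<and> left_invariant_endo G M K\<^sub>G \<and>
        left_invariant_metric G M g\<^sub>G \<and>
        related_endo M N (\<lambda>x. \<Gamma> #>\<^bsub>G\<^esub> x) I\<^sub>G I \<and>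
        related_endo M N (\<lambda>x. \<Gamma> #>\<^bsub>G\<^esub> x) J\<^sub>G J \<and>
        related_endo M N (\<lambda>x. \<Gamma> #>\<^bsub>G\<^esub> x) K\<^sub>G K \<and>
        related_cov2 M N (\<lambda>x. \<Gamma> #>\<^bsub>G\<^esub> x) g\<^sub>G g)"

end

theory Submission
  imports Defs
begin

text \<open>
  Fix an identity chart of \<open>G\<close>, let \<open>[\<cdot>, \<cdot>]\<close> be the bracket of left-invariant fields and put
  \<open>Z\<^sub>L = \<Sum>\<^sub>i [e\<^sub>i, L e\<^sub>i]\<close> for an orthonormal basis \<open>e\<close>. As left-invariant fields on the unimodular
  group are divergence free, \<open>d\<^sup>*\<omega>\<^sub>L = 0\<close> amounts to \<open>Z\<^sub>L = 0\<close>, which is linear in \<open>L\<close>; so only \<open>I, J, K\<close>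
  matter.

  Nilpotency enters through traces. By integrability the operator \<open>D\<^sub>x y = [x, y] + I [I x, y]\<close>
  commutes with \<open>I\<close>, hence maps \<open>g\<^sup>i + I g\<^sup>i\<close> to \<open>g\<^sup>i\<^sup>+\<^sup>1 + I g\<^sup>i\<^sup>+\<^sup>1\<close> and is nilpotent; together with
  \<open>tr ad\<^sub>x = 0\<close> this gives \<open>tr (I ad\<^sub>x) = 0\<close> (that is, the left-invariant section of the canonical bundle
  is closed). Contracting \<open>\<partial>\<Omega> = 0\<close> on \<open>(x, e\<^sub>i, J e\<^sub>i)\<close> and using these traces gives \<open>J Z\<^sub>J = - K Z\<^sub>K\<close>,
  while integrability of \<open>I\<close> evaluated on \<open>(e\<^sub>i, J e\<^sub>i)\<close> gives \<open>J Z\<^sub>J = K Z\<^sub>K\<close>. So \<open>Z\<^sub>J = Z\<^sub>K = 0\<close>, and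
  integrability of \<open>J\<close> yields \<open>Z\<^sub>I = 0\<close>.

  On \<open>N\<close> the left-invariant fields descend to a global frame, in which \<open>\<langle>d\<alpha>, \<omega>\<^sub>L\<rangle> dvol\<close> becomes a sum of
  divergences plus the term \<open>\<alpha>(Z\<^sub>L)\<close>; the integral of a divergence with compact support in a chart
  vanishes by translation invariance of the Lebesgue measure.
\<close>

section \<open>Calculus of smooth functions\<close>

text \<open>Nilpotency is assumed of the group, via its lower central series, whereas the trace
  arguments need it for the bracket at the identity. The passage differentiates maps y -> [x1,
  [x2, ... y]] of group commutators, which are constant for long chains: each commutator contributes
  \<open>Ad x - 1\<close>, and letting the xi tend to the identity turns this into
  \<open>ad\<close>. The operator \<open>D\<close> is needed because \<open>I\<close> need not
  preserve the series g^i, so the composite of \<open>I\<close> with \<open>ad x\<close> has no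
  visible reason to be nilpotent; an operator that commutes with \<open>I\<close> can use the
  enlarged flag instead. Sums over an orthonormal basis are written as contractions with the inverse
  Gram matrix. Invariance under an orthogonal complex structure becomes a matrix identity, and the
  same change-of-frame rule later gives the pairing with the fundamental form constant coefficients.
  On the quotient the frame is the infinitesimal right action of the group, so no choice of coset
  representatives enters. It is only shown to be C^1, since it is transported through a local
  inverse; brackets and divergences require no more.\<close>

lemma has_frechet_derivative:
  "f differentiable at x \<Longrightarrow> (f has_derivative frechet_derivative f (at x)) (at x)"
  by (simp add: frechet_derivative_works)

lemma frechet_derivative_eqI: "(f has_derivative D) (at x) \<Longrightarrow> frechet_derivative f (at x) = D"
  by (metis frechet_derivative_at)

lemma Ck_on_cong:
  assumes "open S" "Ck_on k S f" "\<And>x. x \<in> S \<Longrightarrow> f x = g x"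
  shows "Ck_on k S g"
  using assms(2,3)
proof (induction k arbitrary: f g)
  case 0
  then show ?case
    by (metis Ck_on.simps(1) continuous_on_cong)
next
  case (Suc k)
  have df: "f differentiable at x" if "x \<in> S" for x
    using Suc.prems that by simp
  have "g differentiable at x" if "x \<in> S" for x
    using has_derivative_transform_within_open[OF has_frechet_derivative[OF df[OF that]] \<open>open S\<close> that]
      Suc.prems(2) by (auto simp: differentiable_def)
  moreover have "frechet_derivative f (at x) = frechet_derivative g (at x)" if "x \<in> S" for x
    using frechet_derivative_transform_within_open[OF df[OF that] \<open>open S\<close> that Suc.prems(2)] .
  ultimately show ?case
    using Suc.IH Suc.prems by (metis (mono_tags, lifting) Ck_on.simps(2))
qed

lemma Ck_on_SucD: "open S \<Longrightarrow> Ck_on (Suc k) S f \<Longrightarrow> Ck_on k S f"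
proof (induction k arbitrary: f)
  case 0
  then show ?case
    by (auto intro!: continuous_at_imp_continuous_on differentiable_imp_continuous_within)
next
  case (Suc k)
  then show ?case by (metis Ck_on.simps(2))
qed

lemma Ck_on_le: "open S \<Longrightarrow> Ck_on l S f \<Longrightarrow> k \<le> l \<Longrightarrow> Ck_on k S f"
  by (induction l) (auto simp del: Ck_on.simps simp: le_Suc_eq dest: Ck_on_SucD)

lemma Ck_on_subset: "Ck_on k S f \<Longrightarrow> T \<subseteq> S \<Longrightarrow> Ck_on k T f"
  by (induction k arbitrary: f) (auto intro: continuous_on_subset)

lemma Ck_on_local:
  assumes "\<And>x. x \<in> S \<Longrightarrow> \<exists>U. open U \<and> x \<in> U \<and> Ck_on k U f"
  shows "Ck_on k S f"
  using assms
proof (induction k arbitrary: f)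
  case 0
  then show ?case
    by (metis Ck_on.simps(1) continuous_at_imp_continuous_on continuous_on_eq_continuous_at)
next
  case (Suc k)
  then show ?case by (simp) metis
qed

lemma Ck_on_const: "Ck_on k S (\<lambda>x. c)"
  by (induction k arbitrary: c) auto

lemma Ck_on_bounded_linear:
  assumes "bounded_linear h"
  shows "Ck_on k S h"
proof (cases k)
  case 0
  then show ?thesis
    using assms by (simp add: linear_continuous_on)
next
  case (Suc j)
  have "(h has_derivative h) (at x)" for x
    using assms by (rule bounded_linear_imp_has_derivative)
  then show ?thesis
    unfolding Suc using Ck_on_const
    by (auto simp: frechet_derivative_eqI[of h h] differentiable_def)
qed

lemma Ck_on_add:
  assumes "open S" "Ck_on k S f" "Ck_on k S g"
  shows "Ck_on k S (\<lambda>x. f x + g x)"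
  using assms(2,3)
proof (induction k arbitrary: f g)
  case 0
  then show ?case by (simp add: continuous_on_add)
next
  case (Suc k)
  have d: "((\<lambda>x. f x + g x) has_derivative
      (\<lambda>v. frechet_derivative f (at x) v + frechet_derivative g (at x) v)) (at x)" if "x \<in> S" for x
    using Suc.prems that by (auto intro!: has_derivative_add has_frechet_derivative)
  have "Ck_on k S (\<lambda>x. frechet_derivative (\<lambda>x. f x + g x) (at x) v)" for v
    by (rule Ck_on_cong[OF \<open>open S\<close> Suc.IH[of "\<lambda>x. frechet_derivative f (at x) v"
            "\<lambda>x. frechet_derivative g (at x) v"]])
      (use Suc.prems frechet_derivative_eqI[OF d] in auto)
  with d show ?case unfolding Ck_on.simps differentiable_def by blast
qed

lemma Ck_on_sum:
  assumes "open S" "\<And>i. i \<in> A \<Longrightarrow> Ck_on k S (f i)"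
  shows "Ck_on k S (\<lambda>x. \<Sum>i\<in>A. f i x)"
  using assms(2)
  by (induction A rule: infinite_finite_induct) (auto intro: Ck_on_const Ck_on_add assms(1))

lemma (in bounded_bilinear) Ck_on:
  assumes "open S" "Ck_on k S f" "Ck_on k S g"
  shows "Ck_on k S (\<lambda>x. prod (f x) (g x))"
  using assms(2,3)
proof (induction k arbitrary: f g)
  case 0
  then show ?case by (simp add: continuous_on)
next
  case (Suc k)
  have d: "((\<lambda>x. prod (f x) (g x)) has_derivative
      (\<lambda>v. prod (f x) (frechet_derivative g (at x) v) + prod (frechet_derivative f (at x) v) (g x)))
      (at x)" if "x \<in> S" for x
    using Suc.prems that by (auto intro!: FDERIV has_frechet_derivative)
  have "Ck_on k S (\<lambda>x. prod (f x) (frechet_derivative g (at x) v)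
      + prod (frechet_derivative f (at x) v) (g x))" for v
    using Suc.prems Ck_on_SucD[OF \<open>open S\<close> Suc.prems(1)] Ck_on_SucD[OF \<open>open S\<close> Suc.prems(2)]
    by (intro Ck_on_add Suc.IH \<open>open S\<close>) simp_all
  then have "Ck_on k S (\<lambda>x. frechet_derivative (\<lambda>x. prod (f x) (g x)) (at x) v)" for v
    by (rule Ck_on_cong[OF \<open>open S\<close>]) (simp add: frechet_derivative_eqI[OF d])
  with d show ?case unfolding Ck_on.simps differentiable_def by blast
qed

lemmas Ck_on_scaleR = bounded_bilinear.Ck_on[OF bounded_bilinear_scaleR]
lemmas Ck_on_mult = bounded_bilinear.Ck_on[OF bounded_bilinear_mult]

lemma Ck_on_prod:
  fixes f :: "'i \<Rightarrow> 'e::euclidean_space \<Rightarrow> real"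
  assumes "open S" "\<And>i. i \<in> A \<Longrightarrow> Ck_on k S (f i)"
  shows "Ck_on k S (\<lambda>x. \<Prod>i\<in>A. f i x)"
  using assms(2)
  by (induction A rule: infinite_finite_induct) (auto intro: Ck_on_const Ck_on_mult assms(1))

lemma Ck_on_compose:
  fixes f :: "'e::euclidean_space \<Rightarrow> 'h::euclidean_space"
  assumes "open S" "open T" "Ck_on k S f" "Ck_on k T g" "f ` S \<subseteq> T"
  shows "Ck_on k S (\<lambda>x. g (f x))"
  using assms(3,4,5)
proof (induction k arbitrary: g)
  case 0
  then show ?case by (auto intro: continuous_on_compose2)
next
  case (Suc k)
  have d: "((\<lambda>x. g (f x)) has_derivative
      (\<lambda>v. frechet_derivative g (at (f x)) (frechet_derivative f (at x) v))) (at x)" if "x \<in> S" for x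
    using Suc.prems that
    by (intro has_derivative_compose[OF has_frechet_derivative has_frechet_derivative]) auto
  have "Ck_on k S (\<lambda>x. frechet_derivative (\<lambda>x. g (f x)) (at x) v)" for v
  proof (rule Ck_on_cong[OF \<open>open S\<close>])
    \<comment> \<open>\<open>Ck_on\<close> controls the derivative of \<open>g\<close> only in fixed
      directions, so the moving direction is expanded in the standard basis.\<close>
    show "Ck_on k S (\<lambda>x. \<Sum>b\<in>Basis. (frechet_derivative f (at x) v \<bullet> b) *\<^sub>R
        frechet_derivative g (at (f x)) b)"
    proof (intro Ck_on_sum Ck_on_scaleR \<open>open S\<close>)
      fix b :: 'h
      show "Ck_on k S (\<lambda>x. frechet_derivative f (at x) v \<bullet> b)"
        by (rule bounded_bilinear.Ck_on[OF bounded_bilinear_inner \<open>open S\<close>])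
          (use Suc.prems in \<open>simp_all add: Ck_on_const\<close>)
      show "Ck_on k S (\<lambda>x. frechet_derivative g (at (f x)) b)"
        by (rule Suc.IH[OF Ck_on_SucD[OF \<open>open S\<close> Suc.prems(1)] _ Suc.prems(3)])
          (use Suc.prems in simp)
    qed
    fix x assume x: "x \<in> S"
    have lin: "linear (frechet_derivative g (at (f x)))"
      using Suc.prems x by (intro linear_frechet_derivative) auto
    have "frechet_derivative g (at (f x)) (frechet_derivative f (at x) v) =
        frechet_derivative g (at (f x)) (\<Sum>b\<in>Basis. (frechet_derivative f (at x) v \<bullet> b) *\<^sub>R b)"
      by (simp add: euclidean_representation)
    also have "\<dots> = (\<Sum>b\<in>Basis. (frechet_derivative f (at x) v \<bullet> b) *\<^sub>R
        frechet_derivative g (at (f x)) b)"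
      by (simp add: linear_sum[OF lin] linear_scale[OF lin])
    finally show "(\<Sum>b\<in>Basis. (frechet_derivative f (at x) v \<bullet> b) *\<^sub>R
        frechet_derivative g (at (f x)) b) = frechet_derivative (\<lambda>x. g (f x)) (at x) v"
      using d[OF x] by (simp add: frechet_derivative_eqI)
  qed
  with d show ?case unfolding Ck_on.simps differentiable_def by blast
qed

lemma Ck_on_bounded_linear_compose:
  fixes f :: "'e::euclidean_space \<Rightarrow> 'h::euclidean_space"
  assumes "open S" "bounded_linear h" "Ck_on k S f"
  shows "Ck_on k S (\<lambda>x. h (f x))"
  by (rule Ck_on_compose[OF assms(1) open_UNIV assms(3) Ck_on_bounded_linear]) (use assms in auto)

lemma Ck_on_vec_lambda:
  fixes f :: "'i::finite \<Rightarrow> 'e::euclidean_space \<Rightarrow> real"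
  assumes "open S" "\<And>i. Ck_on k S (f i)"
  shows "Ck_on k S (\<lambda>x. \<chi> i. f i x)"
proof -
  have "(\<chi> i. f i x) = (\<Sum>i\<in>UNIV. f i x *\<^sub>R axis i 1)" for x
    by (simp add: vec_eq_iff axis_def if_distrib sum.If_cases cong: if_cong)
  then show ?thesis
    using assms by (auto intro!: Ck_on_sum Ck_on_scaleR Ck_on_const)
qed

lemma Ck_on_inverse:
  fixes f :: "'e::euclidean_space \<Rightarrow> real"
  assumes "open S" "Ck_on k S f" "\<And>x. x \<in> S \<Longrightarrow> f x \<noteq> 0"
  shows "Ck_on k S (\<lambda>x. inverse (f x))"
  using assms(2)
proof (induction k)
  case 0
  then show ?case using assms(3) by (simp add: continuous_on_inverse)
next
  case (Suc k)
  have d: "((\<lambda>x. inverse (f x)) has_derivative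
      (\<lambda>v. - (inverse (f x) * frechet_derivative f (at x) v * inverse (f x)))) (at x)" if "x \<in> S" for x
    using Suc.prems that assms(3) by (intro Deriv.has_derivative_inverse has_frechet_derivative) auto
  have "Ck_on k S (\<lambda>x. (-1) * (inverse (f x) * frechet_derivative f (at x) v * inverse (f x)))" for v
    using Suc Ck_on_SucD[OF \<open>open S\<close> Suc.prems]
    by (intro Ck_on_mult Ck_on_const \<open>open S\<close>) simp_all
  then have "Ck_on k S (\<lambda>x. frechet_derivative (\<lambda>x. inverse (f x)) (at x) v)" for v
    by (rule Ck_on_cong[OF \<open>open S\<close>, where f = "\<lambda>x. (-1) * (inverse (f x) *
          frechet_derivative f (at x) v * inverse (f x))"]) (simp add: frechet_derivative_eqI[OF d])
  with d show ?case unfolding Ck_on.simps differentiable_def by blast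
qed

lemma smooth_on_differentiable: "smooth_on S f \<Longrightarrow> x \<in> S \<Longrightarrow> f differentiable at x"
  unfolding smooth_on_def by (metis Ck_on.simps(2))

lemma smooth_on_derivative: "smooth_on S f \<Longrightarrow> smooth_on S (\<lambda>x. frechet_derivative f (at x) v)"
  unfolding smooth_on_def by (metis Ck_on.simps(2))

lemma smooth_on_has_derivative:
  "smooth_on S f \<Longrightarrow> x \<in> S \<Longrightarrow> (f has_derivative frechet_derivative f (at x)) (at x)"
  by (simp add: has_frechet_derivative smooth_on_differentiable)

lemma smooth_on_linear_derivative:
  "smooth_on S f \<Longrightarrow> x \<in> S \<Longrightarrow> linear (frechet_derivative f (at x))"
  by (simp add: linear_frechet_derivative smooth_on_differentiable)

lemma smooth_on_cong:
  "open S \<Longrightarrow> smooth_on S f \<Longrightarrow> (\<And>x. x \<in> S \<Longrightarrow> f x = g x) \<Longrightarrow> smooth_on S g"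
  unfolding smooth_on_def using Ck_on_cong by blast

lemma smooth_on_subset: "smooth_on S f \<Longrightarrow> T \<subseteq> S \<Longrightarrow> smooth_on T f"
  unfolding smooth_on_def using Ck_on_subset by blast

lemma smooth_on_compose:
  fixes f :: "'e::euclidean_space \<Rightarrow> 'h::euclidean_space"
  assumes "open S" "open T" "smooth_on S f" "smooth_on T g" "f ` S \<subseteq> T"
  shows "smooth_on S (\<lambda>x. g (f x))"
  using assms unfolding smooth_on_def by (blast intro: Ck_on_compose)

lemma smooth_on_Pair:
  fixes f :: "'e::euclidean_space \<Rightarrow> 'h::euclidean_space" and g :: "'e \<Rightarrow> 'k::euclidean_space"
  assumes "open S" "smooth_on S f" "smooth_on S g"
  shows "smooth_on S (\<lambda>x. (f x, g x))"
proof -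
  have "Ck_on k S (\<lambda>x. (f x, 0) + (0, g x))" for k
    using assms unfolding smooth_on_def
    by (intro Ck_on_add Ck_on_bounded_linear_compose[of S "\<lambda>x. (x, 0)" k f]
        Ck_on_bounded_linear_compose[of S "\<lambda>x. (0, x)" k g])
      (auto intro!: bounded_linear_Pair)
  then show ?thesis unfolding smooth_on_def by simp
qed

lemma smooth_on_const: "smooth_on S (\<lambda>x. c)"
  by (simp add: smooth_on_def Ck_on_const)

lemma smooth_on_ident: "smooth_on S (\<lambda>x. x)"
  by (simp add: smooth_on_def Ck_on_bounded_linear)


section \<open>Symmetry of second derivatives, related vector fields\<close>

lemma symmetric_second_derivative:
  fixes f :: "'e::euclidean_space \<Rightarrow> real"
  assumes "open S" "x \<in> S" "Ck_on 2 S f"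
  shows "frechet_derivative (\<lambda>y. frechet_derivative f (at y) u) (at x) v =
    frechet_derivative (\<lambda>y. frechet_derivative f (at y) v) (at x) u"
proof -
  define D where "D w y = frechet_derivative f (at y) w" for w y
  define H where "H a b y = frechet_derivative (D a) (at y) b" for a b y
  have C2: "Ck_on (Suc (Suc 0)) S f" using assms(3) by (simp add: numeral_2_eq_2)
  have df: "(f has_derivative (\<lambda>w. D w y)) (at y)" if "y \<in> S" for y
    using C2 that unfolding D_def by (intro has_frechet_derivative) auto
  have dD: "(D w has_derivative (\<lambda>b. H w b y)) (at y)" if "y \<in> S" for y w
    using C2 that unfolding H_def by (intro has_frechet_derivative) (auto simp: D_def[abs_def])
  have cH: "continuous_on S (H a b)" for a b
    using C2 by (simp add: H_def D_def[abs_def])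
  have H_lin: "linear (\<lambda>b. H a b y)" if "y \<in> S" for a y
    using dD[OF that] by (rule has_derivative_linear)
  have D_lin: "linear (\<lambda>w. D w y)" if "y \<in> S" for y
    using df[OF that] by (rule has_derivative_linear)
  obtain r where r: "r > 0" "ball x r \<subseteq> S"
    using assms by (meson open_contains_ball)
  \<comment> \<open>A step with \<open>h * M < d\<close> keeps the parallelogram on
    \<open>h *\<^sub>R u\<close> and \<open>h *\<^sub>R v\<close> inside the ball of radius
    \<open>d\<close>. The summand 1 makes \<open>M\<close> positive, so that the later choice
    \<open>h = d / (2 * M)\<close> makes sense.\<close>
  define M where "M = norm u + norm v + 1"
  have M: "M > 0" by (simp add: M_def add_nonneg_pos)
  have seg: "x + s *\<^sub>R a + t *\<^sub>R b \<in> ball x d"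
    if "0 \<le> s" "s \<le> h" "0 \<le> t" "t \<le> h" "h * M < d" "(a = u \<and> b = v) \<or> (a = v \<and> b = u)" for s t h a b d
  proof -
    have "norm (s *\<^sub>R a + t *\<^sub>R b) \<le> s * norm a + t * norm b"
      using norm_triangle_ineq[of "s *\<^sub>R a" "t *\<^sub>R b"] that by simp
    also have "\<dots> \<le> h * norm a + h * norm b"
      using that by (intro add_mono mult_right_mono) auto
    also have "\<dots> \<le> h * M"
      using that by (auto simp: M_def algebra_simps)
    finally have "norm (s *\<^sub>R a + t *\<^sub>R b) < d" using that by simp
    then show ?thesis by (metis add.assoc add_diff_cancel_left' dist_norm dist_commute mem_ball)
  qed
  \<comment> \<open>Two applications of the mean value theorem, first along \<open>a\<close>, then
    along \<open>b\<close>. The second difference on the left is symmetric in \<open>a\<close> and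
    \<open>b\<close>, so the two orders of differentiation agree at points arbitrarily close to
    \<open>x\<close>.\<close>
  have quotient: "\<exists>z\<in>ball x d. f (x + h *\<^sub>R a + h *\<^sub>R b) - f (x + h *\<^sub>R a) - f (x + h *\<^sub>R b) + f x = h * h * H a b z"
    if h: "0 < h" "h * M < d" "d \<le> r" and ab: "(a = u \<and> b = v) \<or> (a = v \<and> b = u)" for h d a b
  proof -
    have inS: "x + s *\<^sub>R a + t *\<^sub>R b \<in> S" if "0 \<le> s" "s \<le> h" "0 \<le> t" "t \<le> h" for s t
      using seg[OF that h(2) ab] r h(3) by auto
    define p where "p s = f (x + s *\<^sub>R a + h *\<^sub>R b) - f (x + s *\<^sub>R a + 0 *\<^sub>R b)" for s
    have "(p has_real_derivative D a (x + s *\<^sub>R a + h *\<^sub>R b) - D a (x + s *\<^sub>R a + 0 *\<^sub>R b)) (at s)"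
      if "0 \<le> s" "s \<le> h" for s
    proof -
      have aff: "((\<lambda>s. x + s *\<^sub>R a + t *\<^sub>R b) has_derivative (\<lambda>k. k *\<^sub>R a)) (at s)" for t
        by (auto intro!: derivative_eq_intros)
      have "((\<lambda>s. f (x + s *\<^sub>R a + t *\<^sub>R b)) has_derivative (\<lambda>k. D (k *\<^sub>R a) (x + s *\<^sub>R a + t *\<^sub>R b))) (at s)"
        if "0 \<le> t" "t \<le> h" for t
        using has_derivative_compose[OF aff df] inS[OF \<open>0 \<le> s\<close> \<open>s \<le> h\<close> that] by blast
      moreover have "D (k *\<^sub>R a) (x + s *\<^sub>R a + t *\<^sub>R b) = k * D a (x + s *\<^sub>R a + t *\<^sub>R b)"
        if "0 \<le> t" "t \<le> h" for t k
        using linear_scale[OF D_lin[OF inS[OF \<open>0 \<le> s\<close> \<open>s \<le> h\<close> that]]] by simp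
      ultimately have "((\<lambda>s. f (x + s *\<^sub>R a + t *\<^sub>R b)) has_real_derivative D a (x + s *\<^sub>R a + t *\<^sub>R b)) (at s)"
        if "0 \<le> t" "t \<le> h" for t
        using that by (simp add: has_field_derivative_def mult_commute_abs)
      from DERIV_diff[OF this[of h] this[of 0]] show ?thesis
        unfolding p_def using h(1) by simp
    qed
    from MVT2[OF h(1) this] obtain s where s: "0 < s" "s < h"
      "p h - p 0 = (h - 0) * (D a (x + s *\<^sub>R a + h *\<^sub>R b) - D a (x + s *\<^sub>R a + 0 *\<^sub>R b))"
      by auto
    define q where "q t = D a (x + s *\<^sub>R a + t *\<^sub>R b)" for t
    have "(q has_real_derivative H a b (x + s *\<^sub>R a + t *\<^sub>R b)) (at t)" if "0 \<le> t" "t \<le> h" for t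
    proof -
      have aff: "((\<lambda>t. x + s *\<^sub>R a + t *\<^sub>R b) has_derivative (\<lambda>k. k *\<^sub>R b)) (at t)"
        by (auto intro!: derivative_eq_intros)
      have S': "x + s *\<^sub>R a + t *\<^sub>R b \<in> S" using inS s that by auto
      have "(q has_derivative (\<lambda>k. H a (k *\<^sub>R b) (x + s *\<^sub>R a + t *\<^sub>R b))) (at t)"
        unfolding q_def using has_derivative_compose[OF aff dD[OF S']] .
      then show ?thesis
        using linear_scale[OF H_lin[OF S']] by (simp add: has_field_derivative_def mult_commute_abs)
    qed
    from MVT2[OF h(1) this] obtain t where t: "0 < t" "t < h"
      "q h - q 0 = (h - 0) * H a b (x + s *\<^sub>R a + t *\<^sub>R b)"
      by auto
    have "f (x + h *\<^sub>R a + h *\<^sub>R b) - f (x + h *\<^sub>R a) - f (x + h *\<^sub>R b) + f x = p h - p 0"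
      by (simp add: p_def)
    also have "\<dots> = h * h * H a b (x + s *\<^sub>R a + t *\<^sub>R b)"
      using s(3) t(3) by (simp add: q_def)
    finally show ?thesis using seg[OF _ _ _ _ h(2) ab] s t by (meson less_imp_le)
  qed
  have "\<bar>H u v x - H v u x\<bar> \<le> e" if "e > 0" for e
  proof -
    have ev: "\<exists>d>0. \<forall>z\<in>ball x d. \<bar>H a b z - H a b x\<bar> < e / 2" for a b
    proof -
      have "isCont (H a b) x"
        using cH assms(1,2) continuous_on_eq_continuous_at by blast
      then show ?thesis
        using \<open>e > 0\<close> unfolding continuous_at_eps_delta
        by (metis dist_commute dist_real_def half_gt_zero mem_ball)
    qed
    obtain d1 where d1: "d1 > 0" "\<forall>z\<in>ball x d1. \<bar>H u v z - H u v x\<bar> < e / 2" using ev by blast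
    obtain d2 where d2: "d2 > 0" "\<forall>z\<in>ball x d2. \<bar>H v u z - H v u x\<bar> < e / 2" using ev by blast
    define d where "d = min r (min d1 d2)"
    have d: "d > 0" "d \<le> r" using d1 d2 r by (auto simp: d_def)
    define h where "h = d / (2 * M)"
    have h: "h > 0" "h * M < d" using d M by (auto simp: h_def)
    obtain z1 where z1: "z1 \<in> ball x d"
      "f (x + h *\<^sub>R u + h *\<^sub>R v) - f (x + h *\<^sub>R u) - f (x + h *\<^sub>R v) + f x = h * h * H u v z1"
      using quotient[OF h d(2), of u v] by auto
    obtain z2 where z2: "z2 \<in> ball x d"
      "f (x + h *\<^sub>R v + h *\<^sub>R u) - f (x + h *\<^sub>R v) - f (x + h *\<^sub>R u) + f x = h * h * H v u z2"
      using quotient[OF h d(2), of v u] by auto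
    have "h * h * H u v z1 = h * h * H v u z2"
      using z1(2) z2(2) by (simp add: algebra_simps)
    then have "H u v z1 = H v u z2" using h(1) by simp
    moreover have "\<bar>H u v z1 - H u v x\<bar> < e / 2" "\<bar>H v u z2 - H v u x\<bar> < e / 2"
      using z1 z2 d1 d2 by (auto simp: d_def)
    ultimately show ?thesis by linarith
  qed
  then have "H u v x - H v u x = 0"
    by (metis abs_le_zero_iff dense_ge)
  then show ?thesis by (simp add: H_def D_def[abs_def])
qed

lemma frechet_derivative_inner:
  assumes "f differentiable at x"
  shows "frechet_derivative (\<lambda>y. f y \<bullet> b) (at x) v = frechet_derivative f (at x) v \<bullet> b"
  by (subst frechet_derivative_eqI[OF has_derivative_inner_left[OF has_frechet_derivative[OF assms]]]) simp

lemma smooth_on_symmetric_derivative: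
  fixes f :: "'e::euclidean_space \<Rightarrow> 'f::euclidean_space"
  assumes "open S" "x \<in> S" "smooth_on S f"
  shows "frechet_derivative (\<lambda>y. frechet_derivative f (at y) u) (at x) v =
    frechet_derivative (\<lambda>y. frechet_derivative f (at y) v) (at x) u"
proof (rule euclidean_eqI)
  fix b :: 'f assume "b \<in> Basis"
  have comp: "frechet_derivative (\<lambda>y. frechet_derivative f (at y) u) (at x) v \<bullet> b =
      frechet_derivative (\<lambda>y. frechet_derivative (\<lambda>z. f z \<bullet> b) (at y) u) (at x) v" for u v
  proof -
    have "(\<lambda>y. frechet_derivative f (at y) u) differentiable at x"
      using assms smooth_on_derivative smooth_on_differentiable by blast
    then have d: "((\<lambda>y. frechet_derivative f (at y) u \<bullet> b) has_derivative
        (\<lambda>v. frechet_derivative (\<lambda>y. frechet_derivative f (at y) u) (at x) v \<bullet> b)) (at x)"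
      by (intro has_derivative_inner_left has_frechet_derivative)
    show ?thesis
      using has_derivative_transform_within_open[OF d assms(1,2),
          of "\<lambda>y. frechet_derivative (\<lambda>z. f z \<bullet> b) (at y) u"] assms
      by (simp add: frechet_derivative_inner smooth_on_differentiable frechet_derivative_eqI)
  qed
  have "Ck_on 2 S (\<lambda>z. f z \<bullet> b)"
    using assms by (intro Ck_on_bounded_linear_compose[of S "\<lambda>w. w \<bullet> b"])
      (auto simp: smooth_on_def bounded_linear_inner_left)
  from symmetric_second_derivative[OF assms(1,2) this]
  show "frechet_derivative (\<lambda>y. frechet_derivative f (at y) u) (at x) v \<bullet> b =
    frechet_derivative (\<lambda>y. frechet_derivative f (at y) v) (at x) u \<bullet> b"
    by (simp add: comp)
qed

text \<open>The product rule for an evaluation, when \<open>B\<close> is known to be differentiable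
  only for each fixed argument: expanding the argument in the standard basis leaves finitely many
  scalar products.\<close>

lemma has_derivative_linear_family:
  fixes B :: "'e::real_normed_vector \<Rightarrow> 'h::euclidean_space \<Rightarrow> 'f::real_normed_vector"
  assumes "open S" "x \<in> S" "\<And>z. z \<in> S \<Longrightarrow> linear (B z)"
    and B: "\<And>b. (\<lambda>z. B z b) differentiable at x" and f: "(f has_derivative f') (at x)"
  shows "((\<lambda>z. B z (f z)) has_derivative
    (\<lambda>h. frechet_derivative (\<lambda>z. B z (f x)) (at x) h + B x (f' h))) (at x)"
proof -
  have rep: "B z w = (\<Sum>b\<in>Basis. (w \<bullet> b) *\<^sub>R B z b)" if "z \<in> S" for z w
  proof -
    have "B z w = B z (\<Sum>b\<in>Basis. (w \<bullet> b) *\<^sub>R b)" by (simp add: euclidean_representation)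
    also have "\<dots> = (\<Sum>b\<in>Basis. (w \<bullet> b) *\<^sub>R B z b)"
      using assms(3)[OF that] by (simp add: linear_sum linear_scale)
    finally show ?thesis .
  qed
  have "((\<lambda>z. \<Sum>b\<in>Basis. (f z \<bullet> b) *\<^sub>R B z b) has_derivative
      (\<lambda>h. \<Sum>b\<in>Basis. (f x \<bullet> b) *\<^sub>R frechet_derivative (\<lambda>z. B z b) (at x) h + (f' h \<bullet> b) *\<^sub>R B x b)) (at x)"
    using B f by (intro has_derivative_sum has_derivative_scaleR has_derivative_inner_left has_frechet_derivative)
  moreover have "((\<lambda>z. \<Sum>b\<in>Basis. (f x \<bullet> b) *\<^sub>R B z b) has_derivative
      (\<lambda>h. \<Sum>b\<in>Basis. (f x \<bullet> b) *\<^sub>R frechet_derivative (\<lambda>z. B z b) (at x) h)) (at x)"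
    using B by (intro has_derivative_sum has_derivative_scaleR_right has_frechet_derivative)
  then have "((\<lambda>z. B z (f x)) has_derivative
      (\<lambda>h. \<Sum>b\<in>Basis. (f x \<bullet> b) *\<^sub>R frechet_derivative (\<lambda>z. B z b) (at x) h)) (at x)"
    by (rule has_derivative_transform_within_open[OF _ assms(1,2)]) (simp add: rep[symmetric])
  note frechet_derivative_eqI[OF this]
  ultimately have "((\<lambda>z. \<Sum>b\<in>Basis. (f z \<bullet> b) *\<^sub>R B z b) has_derivative
      (\<lambda>h. frechet_derivative (\<lambda>z. B z (f x)) (at x) h + B x (f' h))) (at x)"
    using assms(2) by (simp add: sum.distrib rep[symmetric])
  then show ?thesis
    by (rule has_derivative_transform_within_open[OF _ assms(1,2)]) (simp add: rep[symmetric])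
qed

lemma smooth_on_local:
  assumes "\<And>x. x \<in> S \<Longrightarrow> \<exists>U. open U \<and> x \<in> U \<and> smooth_on U f"
  shows "smooth_on S f"
  using assms unfolding smooth_on_def by (meson Ck_on_local)

lemma open_preimage_smooth:
  assumes "open S" "smooth_on S f" "open T"
  shows "open {x \<in> S. f x \<in> T}"
proof -
  have "continuous_on S f" using assms(2) unfolding smooth_on_def by (metis Ck_on.simps(1))
  then have "open (S \<inter> f -` T)" using assms by (simp add: continuous_on_open_vimage Int_commute)
  then show ?thesis by (simp add: vimage_def Int_def)
qed

lemma Ck_on_det:
  fixes A :: "'e::euclidean_space \<Rightarrow> real^'n^'n"
  assumes "open S" "\<And>i j. Ck_on k S (\<lambda>x. A x $ i $ j)"
  shows "Ck_on k S (\<lambda>x. det (A x))"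
  unfolding det_def using assms by (intro Ck_on_sum Ck_on_mult Ck_on_const Ck_on_prod)

lemma Ck_on_abs:
  fixes f :: "'e::euclidean_space \<Rightarrow> real"
  assumes "open S" "Ck_on k S f" "\<And>x. x \<in> S \<Longrightarrow> f x \<noteq> 0"
  shows "Ck_on k S (\<lambda>x. \<bar>f x\<bar>)"
proof (rule Ck_on_local)
  fix x assume x: "x \<in> S"
  define U where "U = {y \<in> S. sgn (f x) * f y > 0}"
  have "continuous_on S f" using Ck_on_le[OF assms(1,2), of 0] by simp
  then have "continuous_on S (\<lambda>y. sgn (f x) * f y)" by (intro continuous_intros)
  then have "open (S \<inter> (\<lambda>y. sgn (f x) * f y) -` {0<..})"
    using assms(1) by (simp add: continuous_on_open_vimage Int_commute)
  moreover have "S \<inter> (\<lambda>y. sgn (f x) * f y) -` {0<..} = U" by (auto simp: U_def)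
  ultimately have U: "open U" by simp
  moreover have "x \<in> U" using x assms(3)[OF x] by (auto simp: U_def sgn_real_def)
  moreover have "Ck_on k U (\<lambda>y. \<bar>f y\<bar>)"
    by (rule Ck_on_cong[OF U, of k "\<lambda>y. sgn (f x) * f y"], intro Ck_on_mult Ck_on_const U)
      (use Ck_on_subset[OF assms(2)] in \<open>auto simp: U_def sgn_real_def split: if_splits\<close>)
  ultimately show "\<exists>U. open U \<and> x \<in> U \<and> Ck_on k U (\<lambda>x. \<bar>f x\<bar>)" by blast
qed

text \<open>Naturality of the bracket. Differentiating the relation for \<open>X'\<close> and
  \<open>Y'\<close> produces a second derivative of \<open>\<phi>\<close> each, and these cancel in
  the difference because they are symmetric. Pointwise differentiability of the fields suffices,
  which fits the C^1 frame on the quotient.\<close>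

lemma lie_bracket_related:
  fixes \<phi> :: "real^'n::finite \<Rightarrow> real^'n"
  assumes U: "open U" "z \<in> U" and \<phi>: "smooth_on U \<phi>"
    and d: "X differentiable at z" "Y differentiable at z" "X' differentiable at (\<phi> z)" "Y' differentiable at (\<phi> z)"
    and X: "\<And>w. w \<in> U \<Longrightarrow> X' (\<phi> w) = frechet_derivative \<phi> (at w) (X w)"
    and Y: "\<And>w. w \<in> U \<Longrightarrow> Y' (\<phi> w) = frechet_derivative \<phi> (at w) (Y w)"
  shows "lie_bracket X' Y' (\<phi> z) = frechet_derivative \<phi> (at z) (lie_bracket X Y z)"
proof -
  let ?D = "\<lambda>w. frechet_derivative \<phi> (at w)"
  have lin: "linear (?D w)" if "w \<in> U" for w using smooth_on_linear_derivative[OF \<phi> that] .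
  have key: "frechet_derivative Y' (at (\<phi> z)) (?D z h) =
      frechet_derivative (\<lambda>w. ?D w (Y z)) (at z) h + ?D z (frechet_derivative Y (at z) h)"
    if dY: "Y differentiable at z" "Y' differentiable at (\<phi> z)"
      and Y: "\<And>w. w \<in> U \<Longrightarrow> Y' (\<phi> w) = ?D w (Y w)" for Y Y' :: "real^'n \<Rightarrow> real^'n" and h
  proof -
    have "((\<lambda>w. Y' (\<phi> w)) has_derivative (\<lambda>h. frechet_derivative Y' (at (\<phi> z)) (?D z h))) (at z)"
      using has_derivative_compose[OF smooth_on_has_derivative[OF \<phi> U(2)] has_frechet_derivative[OF dY(2)]] .
    moreover have "((\<lambda>w. ?D w (Y w)) has_derivative
        (\<lambda>h. frechet_derivative (\<lambda>w. ?D w (Y z)) (at z) h + ?D z (frechet_derivative Y (at z) h))) (at z)"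
      by (rule has_derivative_linear_family[OF U lin])
        (use smooth_on_differentiable[OF smooth_on_derivative[OF \<phi>] U(2)] has_frechet_derivative[OF dY(1)] in auto)
    then have "((\<lambda>w. Y' (\<phi> w)) has_derivative
        (\<lambda>h. frechet_derivative (\<lambda>w. ?D w (Y z)) (at z) h + ?D z (frechet_derivative Y (at z) h))) (at z)"
      by (rule has_derivative_transform_within_open[OF _ U]) (simp add: Y)
    ultimately show ?thesis by (auto dest: has_derivative_unique fun_cong)
  qed
  show ?thesis
    unfolding lie_bracket_def X[OF U(2)] Y[OF U(2)]
    using key[OF d(2,4) Y] key[OF d(1,3) X] smooth_on_symmetric_derivative[OF U \<phi>, of "Y z" "X z"]
    by (simp add: linear_diff[OF lin[OF U(2)]])
qed

text \<open>By translation invariance of Lebesgue measure every difference quotient of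
  \<open>F\<close> has integral zero; dominated convergence passes this on to the
  derivative.\<close>

lemma integral_directional_derivative_zero:
  fixes F :: "'e::euclidean_space \<Rightarrow> real"
  assumes "compact K" and zero: "\<And>x. x \<notin> K \<Longrightarrow> F x = 0"
    and D: "\<And>x. (F has_derivative D x) (at x)"
    and cont: "\<And>w. continuous_on UNIV (\<lambda>x. D x w)"
  shows "integrable lborel (\<lambda>x. D x v)" and "(\<integral>x. D x v \<partial>lborel) = 0"
proof -
  have D0: "D x w = 0" if "x \<notin> K" for x w
  proof -
    have "open (- K)" using \<open>compact K\<close> by (simp add: compact_imp_closed open_Compl)
    then have "((\<lambda>y. 0) has_derivative D x) (at x)"
      using has_derivative_transform_within_open[OF D[of x], of "- K" "\<lambda>_. 0"] zero that by auto
    then have "D x = (\<lambda>_. 0)"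
      using has_derivative_unique[OF has_derivative_const] by metis
    then show ?thesis by simp
  qed
  obtain B where B: "\<And>x. x \<in> K \<Longrightarrow> \<bar>D x v\<bar> \<le> B" "B > 0"
  proof -
    have "bounded ((\<lambda>x. D x v) ` K)"
      by (intro compact_imp_bounded compact_continuous_image \<open>compact K\<close>
          continuous_on_subset[OF cont]) simp
    then show ?thesis using that by (auto simp: bounded_pos)
  qed
  have DB: "\<bar>D x v\<bar> \<le> B" for x
    using B D0[of x v] by (cases "x \<in> K") auto
  obtain R where R: "K \<subseteq> cball 0 R"
    using compact_imp_bounded[OF \<open>compact K\<close>] by (auto simp: bounded_iff subset_iff)
  \<comment> \<open>The steps are at most 1, so a difference quotient at \<open>x\<close> involves
    only the segment from \<open>x\<close> to \<open>x + v\<close>; it vanishes when that segment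
    misses \<open>K\<close>, in particular for \<open>x\<close> outside the ball of radius
    \<open>R'\<close>.\<close>
  define R' where "R' = R + norm v"
  define h :: "nat \<Rightarrow> real" where "h n = inverse (real (Suc n))" for n
  have h: "0 < h n" "h n \<le> 1" for n by (auto simp: h_def field_simps)
  have h0: "h \<longlonglongrightarrow> 0" unfolding h_def by (rule LIMSEQ_inverse_real_of_nat)
  define q where "q n x = (F (x + h n *\<^sub>R v) - F x) / h n" for n x
  have Fc: "continuous_on UNIV F"
    using D by (meson continuous_at_imp_continuous_on has_derivative_continuous)
  have Fm: "F \<in> borel_measurable borel"
    using Fc by (rule borel_measurable_continuous_onI)
  have Dm: "(\<lambda>x. D x v) \<in> borel_measurable borel"
    using cont by (rule borel_measurable_continuous_onI)
  have ray: "((\<lambda>s. F (x + s *\<^sub>R v)) has_real_derivative D (x + s *\<^sub>R v) v) (at s)" for x s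
  proof -
    have "((\<lambda>s. x + s *\<^sub>R v) has_derivative (\<lambda>k. k *\<^sub>R v)) (at s)"
      by (auto intro!: derivative_eq_intros)
    from has_derivative_compose[OF this D]
    show ?thesis
      using linear_scale[OF has_derivative_linear[OF D]]
      by (simp add: has_field_derivative_def mult_commute_abs)
  qed
  have q_eq: "\<exists>s. 0 < s \<and> s < h n \<and> q n x = D (x + s *\<^sub>R v) v" for n x
    using MVT2[OF h(1)[of n] ray[of x]] h(1)[of n] by (force simp: q_def field_simps)
  have qB: "\<bar>q n x\<bar> \<le> B * indicator (cball 0 R') x" for n x
  proof -
    obtain s where s: "0 < s" "s < h n" "q n x = D (x + s *\<^sub>R v) v" using q_eq by blast
    show ?thesis
    proof (cases "x + s *\<^sub>R v \<in> K")
      case True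
      then have "norm (x + s *\<^sub>R v) \<le> R" using R by auto
      then have "norm x \<le> R + norm (s *\<^sub>R v)"
        using norm_triangle_ineq2[of x "- (s *\<^sub>R v)"] by simp
      also have "norm (s *\<^sub>R v) \<le> 1 * norm v"
        using s h(2)[of n] by (simp only: norm_scaleR) (intro mult_right_mono, auto)
      finally show ?thesis using DB s by (simp add: R'_def)
    next
      case False
      then show ?thesis using D0 s B(2) by (simp add: indicator_def)
    qed
  qed
  have lim: "(\<lambda>n. q n x) \<longlonglongrightarrow> D x v" for x
  proof -
    have "((\<lambda>s. (F (x + s *\<^sub>R v) - F x) / s) \<longlongrightarrow> D x v) (at 0)"
      using ray[of x 0] by (simp add: DERIV_def)
    moreover have "filterlim h (at 0) sequentially"
      using h0 h(1) by (auto simp: filterlim_at less_imp_neq[symmetric] eventually_sequentially)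
    ultimately show ?thesis
      unfolding q_def by (rule filterlim_compose)
  qed
  have ind: "integrable lborel (\<lambda>x. B * indicator (cball 0 R') x)"
    by (intro integrable_mult_right integrable_real_indicator)
      (use emeasure_lborel_cball_finite[of 0 R'] in \<open>auto simp: infinity_ennreal_def\<close>)
  have qm: "q n \<in> borel_measurable lborel" for n
    unfolding q_def using Fm by measurable
  note dc = integral_dominated_convergence[where f = "\<lambda>x. D x v" and s = q
      and w = "\<lambda>x. B * indicator (cball 0 R') x" and M = lborel]
    integrable_dominated_convergence[where f = "\<lambda>x. D x v" and s = q
      and w = "\<lambda>x. B * indicator (cball 0 R') x" and M = lborel]
  show "integrable lborel (\<lambda>x. D x v)"
    by (rule dc(2)) (use Dm qm ind lim qB in auto)
  have lim_int: "(\<lambda>n. \<integral>x. q n x \<partial>lborel) \<longlonglongrightarrow> (\<integral>x. D x v \<partial>lborel)"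
    by (rule dc(1)) (use Dm qm ind lim qB in auto)
  have Fint: "integrable lborel F"
  proof -
    have "integrable lborel (\<lambda>x. indicator K x *\<^sub>R F x)"
      by (intro borel_integrable_compact \<open>compact K\<close>) (meson Fc continuous_on_subset subset_UNIV)
    moreover have "(\<lambda>x. indicator K x *\<^sub>R F x) = F"
      by (rule ext, rename_tac x, case_tac "x \<in> K") (auto simp: zero)
    ultimately show ?thesis by simp
  qed
  have shift: "integrable lborel (\<lambda>x. F (x + c))" "(\<integral>x. F (x + c) \<partial>lborel) = (\<integral>x. F x \<partial>lborel)" for c
  proof -
    have "integrable (distr lborel borel ((+) c)) F" using Fint by (simp add: lborel_distr_plus)
    then show "integrable lborel (\<lambda>x. F (x + c))"
      by (subst (asm) integrable_distr_eq) (use Fm in \<open>auto simp: add.commute\<close>)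
    have "(\<integral>x. F x \<partial>distr lborel borel ((+) c)) = (\<integral>x. F (c + x) \<partial>lborel)"
      by (rule integral_distr) (use Fm in auto)
    then show "(\<integral>x. F (x + c) \<partial>lborel) = (\<integral>x. F x \<partial>lborel)"
      by (simp add: lborel_distr_plus add.commute)
  qed
  have "(\<integral>x. q n x \<partial>lborel) = 0" for n
    unfolding q_def using shift[of "h n *\<^sub>R v"] Fint by (simp add: Bochner_Integration.integral_diff)
  then show "(\<integral>x. D x v \<partial>lborel) = 0"
    using lim_int by (simp add: LIMSEQ_const_iff)
qed


lemma set_integral_directional_derivative_zero:
  fixes F :: "'e::euclidean_space \<Rightarrow> real"
  assumes "open S" "Ck_on 1 S F" "compact K" "K \<subseteq> S" and zero: "\<And>x. x \<in> S - K \<Longrightarrow> F x = 0"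
  shows "set_integrable lborel S (\<lambda>x. frechet_derivative F (at x) v)"
    and "(LINT x:S|lborel. frechet_derivative F (at x) v) = 0"
proof -
  \<comment> \<open>Extension by zero. The open sets \<open>S\<close> and \<open>- K\<close> cover
    the space, and the extension is C^1 on each of them.\<close>
  define G where "G x = (if x \<in> S then F x else 0)" for x
  define D where "D x w = (if x \<in> S then frechet_derivative F (at x) w else 0)" for x w
  have oK: "open (- K)" using \<open>compact K\<close> by (simp add: compact_imp_closed open_Compl)
  have GK: "G x = 0" if "x \<notin> K" for x using that zero by (auto simp: G_def)
  have Gd0: "(G has_derivative (\<lambda>_. 0)) (at x)" if "x \<notin> K" for x
    using has_derivative_transform_within_open[OF has_derivative_const oK, of x 0] that GK by auto
  have FG: "(G has_derivative frechet_derivative F (at x)) (at x)" if "x \<in> S" for x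
    using has_derivative_transform_within_open[OF _ \<open>open S\<close> that, of F "frechet_derivative F (at x)" UNIV G]
      assms(2) that by (auto simp: G_def has_frechet_derivative)
  have Gd: "(G has_derivative D x) (at x)" for x
    using FG Gd0 assms(4) by (cases "x \<in> S") (auto simp: D_def[abs_def])
  have D0: "D x w = 0" if "x \<notin> K" for x w
    using has_derivative_unique[OF Gd Gd0[OF that]] by metis
  have cont: "continuous_on UNIV (\<lambda>x. D x w)" for w
  proof -
    have "continuous_on S (\<lambda>x. D x w)"
      using assms(2) by (subst continuous_on_cong[OF refl, of _ _ "\<lambda>x. frechet_derivative F (at x) w"])
        (auto simp: D_def)
    moreover have "continuous_on (- K) (\<lambda>x. D x w)"
      by (subst continuous_on_cong[OF refl, of _ _ "\<lambda>x. 0"]) (auto simp: D0)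
    ultimately have "continuous_on (S \<union> - K) (\<lambda>x. D x w)"
      using \<open>open S\<close> oK by (intro continuous_on_open_Un)
    moreover have "S \<union> - K = UNIV" using assms(4) by auto
    ultimately show ?thesis by simp
  qed
  have eq: "(\<lambda>x. indicator S x *\<^sub>R frechet_derivative F (at x) v) = (\<lambda>x. D x v)"
    by (auto simp: D_def indicator_def)
  show "set_integrable lborel S (\<lambda>x. frechet_derivative F (at x) v)"
    and "(LINT x:S|lborel. frechet_derivative F (at x) v) = 0"
    using integral_directional_derivative_zero[OF \<open>compact K\<close> GK Gd cont, of v]
    unfolding set_integrable_def set_lebesgue_integral_def eq by blast+
qed

lemma linear_frechet_derivative_param:
  fixes B :: "'e::real_normed_vector \<Rightarrow> 'h::real_vector \<Rightarrow> 'f::real_normed_vector"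
  assumes S: "open S" "y \<in> S" and lin: "\<And>z. z \<in> S \<Longrightarrow> linear (B z)" and d: "\<And>b. (\<lambda>z. B z b) differentiable at y"
  shows "linear (\<lambda>v. frechet_derivative (\<lambda>z. B z v) (at y) u)"
proof (rule linearI)
  fix v w
  have "((\<lambda>z. B z (v + w)) has_derivative
      (\<lambda>u. frechet_derivative (\<lambda>z. B z v) (at y) u + frechet_derivative (\<lambda>z. B z w) (at y) u)) (at y)"
    by (rule has_derivative_transform_within_open[OF has_derivative_add[OF d[THEN has_frechet_derivative, of v]
            d[THEN has_frechet_derivative, of w]] S]) (simp add: linear_add[OF lin])
  then show "frechet_derivative (\<lambda>z. B z (v + w)) (at y) u =
      frechet_derivative (\<lambda>z. B z v) (at y) u + frechet_derivative (\<lambda>z. B z w) (at y) u"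
    by (simp add: frechet_derivative_eqI)
next
  fix r v
  have "((\<lambda>z. B z (r *\<^sub>R v)) has_derivative (\<lambda>u. r *\<^sub>R frechet_derivative (\<lambda>z. B z v) (at y) u)) (at y)"
    by (rule has_derivative_transform_within_open[OF has_derivative_scaleR_right[OF
            d[THEN has_frechet_derivative, of v]] S]) (simp add: linear_scale[OF lin])
  then show "frechet_derivative (\<lambda>z. B z (r *\<^sub>R v)) (at y) u = r *\<^sub>R frechet_derivative (\<lambda>z. B z v) (at y) u"
    by (simp add: frechet_derivative_eqI)
qed

text \<open>Integrability is part of the notion: the integral of a non-integrable function is 0 by
  convention, so a vanishing integral alone would not pass to sums and differences.\<close>

definition null_integral :: "'e::euclidean_space set \<Rightarrow> ('e \<Rightarrow> real) \<Rightarrow> bool" where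
  "null_integral S f \<longleftrightarrow> has_bochner_integral lborel (\<lambda>x. indicator S x *\<^sub>R f x) 0"

lemma null_integral_cong:
  assumes "null_integral S f" "\<And>x. x \<in> S \<Longrightarrow> f x = f' x"
  shows "null_integral S f'"
proof -
  have "(\<lambda>x. indicator S x *\<^sub>R f x) = (\<lambda>x. indicator S x *\<^sub>R f' x)"
    using assms(2) by (auto simp: indicator_def fun_eq_iff)
  then show ?thesis using assms(1) by (simp add: null_integral_def)
qed

lemma null_integral_mult: "null_integral S f \<Longrightarrow> null_integral S (\<lambda>x. r * f x)"
  unfolding null_integral_def using has_bochner_integral_mult_right[of r lborel _ 0] by (fastforce simp: ac_simps)

lemma null_integral_diff: "null_integral S f \<Longrightarrow> null_integral S f' \<Longrightarrow> null_integral S (\<lambda>x. f x - f' x)"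
  unfolding null_integral_def using has_bochner_integral_diff[of lborel _ 0 _ 0]
  by (fastforce simp: right_diff_distrib)

lemma null_integral_sum:
  "(\<And>i. i \<in> A \<Longrightarrow> null_integral S (f i)) \<Longrightarrow> null_integral S (\<lambda>x. \<Sum>i\<in>A. f i x)"
  unfolding null_integral_def using has_bochner_integral_sum[of A lborel "\<lambda>i x. indicator S x *\<^sub>R f i x" "\<lambda>_. 0"]
  by (simp add: sum_distrib_left)

lemma null_integral_derivative:
  fixes F :: "'e::euclidean_space \<Rightarrow> real"
  assumes "open S" "Ck_on 1 S F" "compact K" "K \<subseteq> S" "\<And>x. x \<in> S - K \<Longrightarrow> F x = 0"
  shows "null_integral S (\<lambda>x. frechet_derivative F (at x) v)"
  using set_integral_directional_derivative_zero[OF assms, of v]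
  by (simp add: null_integral_def has_bochner_integral_iff set_integrable_def set_lebesgue_integral_def)

text \<open>Jacobi's formula at the identity matrix, read off from the Leibniz expansion: only the
  identity permutation contributes.\<close>

lemma det_has_derivative_one:
  fixes Q :: "'e::real_normed_vector \<Rightarrow> real^'n^'n"
  assumes Q: "\<And>i j. ((\<lambda>y. Q y $ i $ j) has_derivative (\<lambda>h. DQ h $ i $ j)) (at x)" and one: "Q x = mat 1"
  shows "((\<lambda>y. det (Q y)) has_derivative (\<lambda>h. trace (DQ h))) (at x)"
proof -
  have "((\<lambda>y. det (Q y)) has_derivative (\<lambda>h. \<Sum>p | p permutes UNIV. of_int (sign p) *
      (\<Sum>i\<in>UNIV. DQ h $ i $ p i * (\<Prod>j\<in>UNIV - {i}. Q x $ j $ p j)))) (at x)"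
    unfolding det_def by (intro has_derivative_sum has_derivative_mult_right has_derivative_prod Q)
  moreover have "(\<Sum>p | p permutes (UNIV :: 'n set). of_int (sign p) *
      (\<Sum>i\<in>UNIV. DQ h $ i $ p i * (\<Prod>j\<in>UNIV - {i}. Q x $ j $ p j))) = trace (DQ h)" for h
  proof -
    \<comment> \<open>A permutation other than \<open>id\<close> moves at least two indices, so
      after the factor \<open>i\<close> has been differentiated some off-diagonal entry, which is
      zero, remains.\<close>
    have off: "(\<Prod>j\<in>UNIV - {i}. Q x $ j $ p j) = 0" if p: "p permutes (UNIV :: 'n set)" "p \<noteq> id" for p i
    proof -
      have "\<exists>j. j \<noteq> i \<and> p j \<noteq> j"
      proof (rule ccontr)
        assume "\<not> ?thesis"
        then have fix_j: "p j = j" if "j \<noteq> i" for j using that by auto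
        have "p i = i"
        proof (rule ccontr)
          assume "p i \<noteq> i"
          then have "p (p i) = p i" by (rule fix_j)
          then have "p i = i" using permutes_inj[OF p(1)] by (auto dest: injD)
          with \<open>p i \<noteq> i\<close> show False ..
        qed
        with fix_j have "p = id" by (auto simp: fun_eq_iff) (metis)
        with p(2) show False ..
      qed
      then obtain j where "j \<noteq> i" "p j \<noteq> j" by blast
      then show ?thesis by (intro prod_zero) (auto simp: one mat_def intro!: bexI[of _ j])
    qed
    have "(\<Sum>p | p permutes (UNIV :: 'n set). of_int (sign p) *
        (\<Sum>i\<in>UNIV. DQ h $ i $ p i * (\<Prod>j\<in>UNIV - {i}. Q x $ j $ p j))) =
      (\<Sum>p\<in>{id}. of_int (sign p) *
        (\<Sum>i\<in>UNIV. DQ h $ i $ p i * (\<Prod>j\<in>UNIV - {i}. Q x $ j $ p j)))"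
      by (rule sum.mono_neutral_right) (auto simp: finite_permutations permutes_id off)
    also have "\<dots> = trace (DQ h)"
      by (simp add: sign_id one mat_def trace_def)
    finally show ?thesis .
  qed
  ultimately show ?thesis by simp
qed

text \<open>Multiplying by the constant inverse \<open>R\<close> moves the base value to the
  identity matrix; multiplicativity of the determinant undoes the normalisation.\<close>

lemma det_has_derivative:
  fixes P :: "'e::real_normed_vector \<Rightarrow> real^'n^'n"
  assumes P: "\<And>i j. ((\<lambda>y. P y $ i $ j) has_derivative (\<lambda>h. DP h $ i $ j)) (at x)" and R: "P x ** R = mat 1"
  shows "((\<lambda>y. det (P y)) has_derivative (\<lambda>h. det (P x) * trace (DP h ** R))) (at x)"
proof -
  have "((\<lambda>y. (P y ** R) $ i $ j) has_derivative (\<lambda>h. (DP h ** R) $ i $ j)) (at x)" for i j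
    unfolding matrix_matrix_mult_def vec_lambda_beta
    by (intro has_derivative_sum has_derivative_mult_left P)
  from has_derivative_mult_right[OF det_has_derivative_one[OF this R], of "det (P x)"]
  have "((\<lambda>y. det (P x) * det (P y ** R)) has_derivative (\<lambda>h. det (P x) * trace (DP h ** R))) (at x)" .
  moreover have "det (P x) * det (P y ** R) = det (P y)" for y
    using arg_cong[OF R, of det] by (simp add: det_mul algebra_simps)
  ultimately show ?thesis by simp
qed

lemma Ck_on_linear_family:
  fixes B :: "'e::euclidean_space \<Rightarrow> 'h::euclidean_space \<Rightarrow> 'f::real_normed_vector"
  assumes "open S" "\<And>z. z \<in> S \<Longrightarrow> linear (B z)" "\<And>b. Ck_on k S (\<lambda>z. B z b)" "Ck_on k S f"
  shows "Ck_on k S (\<lambda>z. B z (f z))"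
proof (rule Ck_on_cong[OF assms(1)])
  show "Ck_on k S (\<lambda>z. \<Sum>b\<in>Basis. (f z \<bullet> b) *\<^sub>R B z b)"
    by (intro Ck_on_sum Ck_on_scaleR assms(1,3) Ck_on_bounded_linear_compose[OF assms(1) bounded_linear_inner_left assms(4)])
  fix z assume "z \<in> S"
  have "B z (f z) = B z (\<Sum>b\<in>Basis. (f z \<bullet> b) *\<^sub>R b)" by (simp add: euclidean_representation)
  then show "(\<Sum>b\<in>Basis. (f z \<bullet> b) *\<^sub>R B z b) = B z (f z)"
    using assms(2)[OF \<open>z \<in> S\<close>] by (simp add: linear_sum linear_scale)
qed

text \<open>The inverse function theorem yields the derivative of the local inverse pointwise;
  Cramer's rule then displays its entries as continuous functions.\<close>

lemma local_inverse_C1: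
  fixes \<phi> :: "real^'n::finite \<Rightarrow> real^'n"
  assumes U: "open U" "z \<in> U" and \<phi>: "smooth_on U \<phi>"
    and bij: "\<And>w. w \<in> U \<Longrightarrow> bij (frechet_derivative \<phi> (at w))"
  obtains V \<psi> where "open V" "\<phi> z \<in> V" "Ck_on 1 V \<psi>" "\<And>y. y \<in> V \<Longrightarrow> \<psi> y \<in> U" "\<And>y. y \<in> V \<Longrightarrow> \<phi> (\<psi> y) = y"
proof -
  let ?D = "\<lambda>w. frechet_derivative \<phi> (at w)"
  define f' where "f' w = Blinfun (?D w)" for w
  have bl: "bounded_linear (?D w)" if "w \<in> U" for w
    using smooth_on_linear_derivative[OF \<phi> that] by (simp add: linear_conv_bounded_linear)
  have f': "blinfun_apply (f' w) = ?D w" if "w \<in> U" for w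
    using bl[OF that] by (simp add: f'_def bounded_linear_Blinfun_apply)
  have cD: "continuous_on U (\<lambda>w. ?D w v)" for v
    using smooth_on_derivative[OF \<phi>, of v] unfolding smooth_on_def by (metis Ck_on.simps(1))
  have cont: "continuous_on U f'"
  proof (rule continuous_on_blinfun_componentwise)
    fix i :: "real^'n"
    show "continuous_on U (\<lambda>w. blinfun_apply (f' w) i)"
      using cD[of i] by (rule continuous_on_eq) (simp add: f')
  qed
  have der: "(\<phi> has_derivative blinfun_apply (f' w)) (at w)" if "w \<in> U" for w
    using smooth_on_has_derivative[OF \<phi> that] f'[OF that] by simp
  obtain h where h: "linear h" "h \<circ> ?D z = id"
    using linear_injective_left_inverse[OF smooth_on_linear_derivative[OF \<phi> U(2)] bij_is_inj[OF bij[OF U(2)]]]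
    by blast
  then have "Blinfun h o\<^sub>L f' z = id_blinfun"
    by (intro blinfun_eqI)
      (simp add: f'[OF U(2)] bounded_linear_Blinfun_apply linear_conv_bounded_linear fun_eq_iff)
  from inverse_function_theorem[OF U(1) der cont U(2) this]
  obtain U' V g g' where V: "open U'" "U' \<subseteq> U" "z \<in> U'" "open V" "\<phi> z \<in> V" "homeomorphism U' V \<phi> g"
    "\<And>y. y \<in> V \<Longrightarrow> (g has_derivative (g' y)) (at y)"
    "\<And>y. y \<in> V \<Longrightarrow> g' y = inv_into UNIV (blinfun_apply (f' (g y)))"
    by metis
  have gU: "g y \<in> U" if "y \<in> V" for y
    using V(2,6) that by (auto simp: homeomorphism_def)
  have cg: "continuous_on V g" using V(6) by (simp add: homeomorphism_def)
  define A where "A y = matrix (?D (g y))" for y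
  have A: "A y *v v = ?D (g y) v" if "y \<in> V" for y v
    using smooth_on_linear_derivative[OF \<phi> gU[OF that]] by (simp add: A_def)
  have det_A: "det (A y) \<noteq> 0" if "y \<in> V" for y
  proof -
    have "(*v) (A y) = ?D (g y)" using A[OF that] by blast
    then show ?thesis
      using bij[OF gU[OF that]] by (simp add: invertible_det_nz[symmetric] invertible_eq_bij)
  qed
  have A_entry: "Ck_on 0 V (\<lambda>y. A y $ i $ j)" for i j
    unfolding A_def matrix_def vec_lambda_beta Ck_on.simps
    by (intro continuous_on_component continuous_on_compose2[OF cD cg]) (use gU in auto)
  have g'_eq: "g' y v = (\<chi> k. det (\<chi> i j. if j = k then v $ i else A y $ i $ j) * inverse (det (A y)))"
    if "y \<in> V" for y v
  proof -
    have "A y *v g' y v = v"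
      using V(8)[OF that] A[OF that] f'[OF gU[OF that]] bij[OF gU[OF that]]
      by (simp add: surj_f_inv_f bij_is_surj)
    then show ?thesis using cramer[OF det_A[OF that]] by (simp add: divide_inverse)
  qed
  have "Ck_on 0 V (\<lambda>y. \<chi> k. det (\<chi> i j. if j = k then v $ i else A y $ i $ j) * inverse (det (A y)))" for v
  proof (intro Ck_on_vec_lambda Ck_on_mult Ck_on_det Ck_on_inverse V(4) A_entry det_A)
    fix i j k
    show "Ck_on 0 V (\<lambda>y. (\<chi> i j. if j = k then v $ i else A y $ i $ j) $ i $ j)"
      using A_entry by (cases "j = k") (simp_all add: Ck_on_const del: Ck_on.simps)
  qed
  then have "Ck_on 0 V (\<lambda>y. frechet_derivative g (at y) v)" for v
    by (rule Ck_on_cong[OF V(4)]) (simp add: frechet_derivative_eqI[OF V(7)] g'_eq)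
  moreover have "g differentiable at y" if "y \<in> V" for y
    using V(7)[OF that] by (auto simp: differentiable_def)
  ultimately have "Ck_on 1 V g" by simp
  moreover have "\<phi> (g y) = y" if "y \<in> V" for y
    using V(6) that by (auto simp: homeomorphism_def)
  ultimately show ?thesis using that[OF V(4,5)] gU by blast
qed

section \<open>Linear algebra and Lie algebras\<close>

text \<open>Expand each axis vector in \<open>B\<close> and exchange the two sums.\<close>

lemma trace_orthonormal_basis:
  fixes f :: "real^'n \<Rightarrow> real^'n"
  assumes "linear f" "pairwise orthogonal B" "\<And>b. b \<in> B \<Longrightarrow> norm b = 1" "span B = UNIV"
  shows "trace (matrix f) = (\<Sum>b\<in>B. b \<bullet> f b)"
proof -
  have fin: "finite B"
    using pairwise_orthogonal_imp_finite assms(2) by blast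
  have expand: "(\<Sum>b\<in>B. (x \<bullet> b) *\<^sub>R b) = x" for x
    using orthonormal_basis_expand[OF assms(2,3) _ fin] assms(4) by auto
  have "trace (matrix f) = (\<Sum>i\<in>UNIV. f (axis i 1) \<bullet> axis i 1)"
    by (simp add: trace_def matrix_def inner_axis)
  also have "\<dots> = (\<Sum>i\<in>UNIV. \<Sum>b\<in>B. (axis i 1 \<bullet> b) * (f b \<bullet> axis i 1))"
  proof (rule sum.cong[OF refl])
    fix i :: 'n
    have "f (axis i 1) = f (\<Sum>b\<in>B. (axis i 1 \<bullet> b) *\<^sub>R b)" by (simp only: expand)
    also have "\<dots> = (\<Sum>b\<in>B. (axis i 1 \<bullet> b) *\<^sub>R f b)"
      by (simp add: linear_sum[OF assms(1)] linear_scale[OF assms(1)])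
    finally show "f (axis i 1) \<bullet> axis i 1 = (\<Sum>b\<in>B. (axis i 1 \<bullet> b) * (f b \<bullet> axis i 1))"
      by (simp add: inner_sum_left)
  qed
  also have "\<dots> = (\<Sum>b\<in>B. \<Sum>i\<in>UNIV. (axis i 1 \<bullet> b) * (f b \<bullet> axis i 1))"
    by (rule sum.swap)
  also have "\<dots> = (\<Sum>b\<in>B. b \<bullet> f b)"
    by (simp add: inner_axis inner_axis' inner_vec_def[of "_ :: real^'n" "f _"])
  finally show ?thesis .
qed

text \<open>An orthonormal basis adapted to the flag of the ranges of the powers of \<open>f\<close> makes every
  diagonal entry vanish.\<close>

lemma trace_nilpotent:
  fixes f :: "real^'n \<Rightarrow> real^'n"
  assumes lin: "linear f" and nil: "\<And>x. (f ^^ k) x = 0"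
  shows "trace (matrix f) = 0"
proof -
  have lin_pow: "linear (f ^^ i)" for i
    by (induction i) (simp_all only: funpow.simps linear_id linear_compose lin)
  define R where "R i = range (f ^^ i)" for i
  have sub: "subspace (R i)" for i
    unfolding R_def by (simp add: linear_subspace_image[OF lin_pow] subspace_UNIV)
  have fR: "f x \<in> R (Suc i)" if "x \<in> R i" for x i
    using that by (auto simp: R_def)
  have dec: "R (Suc i) \<subseteq> R i" for i
    by (auto simp: R_def funpow_swap1)
  \<comment> \<open>The induction climbs the flag from \<open>R k = {0}\<close>, hence the index
    \<open>k - j\<close>; at \<open>j = k\<close> the span is \<open>R 0\<close>, the whole
    space.\<close>
  have "\<exists>B. pairwise orthogonal B \<and> (\<forall>b\<in>B. norm b = 1) \<and> span B = R (k - j) \<and> (\<forall>b\<in>B. b \<bullet> f b = 0)"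
    if "j \<le> k" for j
    using that
  proof (induction j)
    case 0
    have "R k = {0}" using nil by (auto simp: R_def)
    then show ?case by (intro exI[of _ "{}"]) auto
  next
    case (Suc j)
    define i where "i = k - Suc j"
    have i: "k - j = Suc i" using Suc.prems by (simp add: i_def)
    obtain B where B: "pairwise orthogonal B" "\<forall>b\<in>B. norm b = 1" "span B = R (Suc i)" "\<forall>b\<in>B. b \<bullet> f b = 0"
      using Suc by (auto simp: i)
    \<comment> \<open>The vectors added at this stage lie in \<open>R i\<close> and are orthogonal
      to \<open>R (Suc i)\<close>, where \<open>f\<close> sends them; this is what kills their
      diagonal entries.\<close>
    define U where "U = R i \<inter> {y. \<forall>x\<in>R (Suc i). orthogonal x y}"
    have "subspace U"
      unfolding U_def by (intro subspace_inter sub subspace_orthogonal_to_vectors)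
    then obtain B' where B': "B' \<subseteq> U" "pairwise orthogonal B'" "\<And>x. x \<in> B' \<Longrightarrow> norm x = 1" "span B' = U"
      using orthonormal_basis_subspace by metis
    have BR: "B \<subseteq> R (Suc i)" using B(3) span_superset by auto
    have "pairwise orthogonal (B \<union> B')"
    proof -
      have "orthogonal b b'" "orthogonal b' b" if "b \<in> B" "b' \<in> B'" for b b'
        using that BR B'(1) by (auto simp: U_def orthogonal_commute)
      then show ?thesis using B(1) B'(2) unfolding pairwise_def by blast
    qed
    moreover have "span (B \<union> B') = R i"
    proof
      show "span (B \<union> B') \<subseteq> R i"
        using BR dec B'(1) by (intro span_minimal sub) (auto simp: U_def)
      show "R i \<subseteq> span (B \<union> B')"
      proof
        fix x assume x: "x \<in> R i"
        obtain y z where yz: "y \<in> span (R (Suc i))" "\<And>w. w \<in> span (R (Suc i)) \<Longrightarrow> orthogonal z w" "x = y + z"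
          using orthogonal_subspace_decomp_exists[of "R (Suc i)" x] by metis
        have y: "y \<in> R (Suc i)" using yz(1) sub by (simp add: span_eq_iff[THEN iffD2])
        have "z = x - y" using yz by simp
        then have "z \<in> R i" using x y dec subspace_diff[OF sub] by blast
        then have "z \<in> U" using yz(2) by (auto simp: U_def orthogonal_commute span_base)
        then show "x \<in> span (B \<union> B')"
          using y span_mono[of B "B \<union> B'"] span_mono[of B' "B \<union> B'"] B(3) B'(4)
          unfolding yz(3) by (intro span_add) auto
      qed
    qed
    moreover have "\<forall>b\<in>B \<union> B'. b \<bullet> f b = 0"
    proof
      fix b assume "b \<in> B \<union> B'"
      then show "b \<bullet> f b = 0"
      proof
        assume "b \<in> B'"
        then show ?thesis using B'(1) fR[of b i] by (auto simp: U_def orthogonal_def inner_commute)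
      qed (use B in auto)
    qed
    ultimately show ?case using B(2) B'(3) by (intro exI[of _ "B \<union> B'"]) (auto simp: i_def[symmetric])
  qed
  from this[of k] obtain B where B: "pairwise orthogonal B" "\<And>b. b \<in> B \<Longrightarrow> norm b = 1"
    "span B = (UNIV :: (real^'n) set)" "\<And>b. b \<in> B \<Longrightarrow> b \<bullet> f b = 0"
    by (auto simp: R_def)
  show ?thesis
    by (subst trace_orthonormal_basis[OF lin B(1-3)]) (auto simp: B(4))
qed

text \<open>The full contraction of \<open>b\<close> with a contravariant 2-tensor \<open>C\<close>.
  When \<open>C\<close> is the inverse Gram matrix of an inner product, this is the sum of
  \<open>b e e\<close> over an orthonormal basis, without a choice of such a basis.\<close>

definition contract :: "real^'n^'n \<Rightarrow> (real^'n \<Rightarrow> real^'n \<Rightarrow> 'f) \<Rightarrow> 'f::real_vector" where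
  "contract C b = (\<Sum>i\<in>UNIV. \<Sum>j\<in>UNIV. C $ i $ j *\<^sub>R b (axis i 1) (axis j 1))"

lemma contract_add: "contract C (\<lambda>u v. b u v + c u v) = contract C b + contract C c"
  by (simp add: contract_def scaleR_add_right sum.distrib)

lemma contract_uminus: "contract C (\<lambda>u v. - b u v) = - contract C b"
  by (simp add: contract_def sum_negf)

lemma contract_diff: "contract C (\<lambda>u v. b u v - c u v) = contract C b - contract C c"
  by (simp add: contract_def scaleR_diff_right sum_subtractf)

lemma contract_0: "contract C (\<lambda>u v. 0) = 0"
  by (simp add: contract_def)

lemma linear_contract: "linear f \<Longrightarrow> f (contract C b) = contract C (\<lambda>u v. f (b u v))"
  by (simp add: contract_def linear_sum linear_scale)

lemma contract_swap:
  assumes "transpose C = C"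
  shows "contract C (\<lambda>u v. b v u) = contract C b"
proof -
  have "C $ i $ j = C $ j $ i" for i j
    using arg_cong[OF assms, of "\<lambda>X. X $ j $ i"] by (simp add: transpose_def)
  then show ?thesis
    unfolding contract_def by (subst sum.swap) (rule sum.cong[OF refl sum.cong[OF refl]], simp)
qed

lemma matrix_vector_axis: "M *v axis i 1 = (\<Sum>k\<in>UNIV. M $ k $ i *\<^sub>R axis k (1::real))"
  unfolding matrix_vector_mult_basis
  by (simp add: column_def vec_eq_iff axis_def if_distrib sum.If_cases cong: if_cong)

lemma bilinear_sum_sum:
  assumes "bilinear b"
  shows "b (\<Sum>i\<in>A. x i *\<^sub>R p i) (\<Sum>j\<in>B. y j *\<^sub>R q j) = (\<Sum>i\<in>A. \<Sum>j\<in>B. (x i * y j) *\<^sub>R b (p i) (q j))"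
proof -
  have l: "linear (\<lambda>u. b u v)" and r: "linear (b u)" for u v
    using assms by (auto simp: bilinear_def)
  show ?thesis
    by (simp add: linear_sum[OF l] linear_sum[OF r] linear_scale[OF l] linear_scale[OF r] scaleR_sum_right
        mult.commute sum.swap[of _ B A])
qed

lemma bilinear_eq_inner:
  fixes b :: "real^'n \<Rightarrow> real^'n \<Rightarrow> real"
  assumes "bilinear b"
  shows "b u v = u \<bullet> ((\<chi> i j. b (axis i 1) (axis j 1)) *v v)"
proof -
  have e: "x = (\<Sum>i\<in>UNIV. x $ i *\<^sub>R axis i 1)" for x :: "real^'n"
    by (simp add: vec_eq_iff axis_def if_distrib sum.If_cases cong: if_cong)
  have "b u v = b (\<Sum>i\<in>UNIV. u $ i *\<^sub>R axis i 1) (\<Sum>j\<in>UNIV. v $ j *\<^sub>R axis j 1)"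
    by (simp only: e[symmetric])
  also have "\<dots> = u \<bullet> ((\<chi> i j. b (axis i 1) (axis j 1)) *v v)"
    by (simp add: bilinear_sum_sum[OF assms] inner_vec_def matrix_vector_mult_def sum_distrib_left
        ac_simps)
  finally show ?thesis .
qed

text \<open>\<open>C\<close> is contravariant, so linear maps in the arguments of \<open>b\<close>
  push its two indices forward. The rule serves both for invariance under complex structures and for
  the change to the invariant frame on the quotient.\<close>

lemma contract_linear_image:
  fixes b :: "real^'n \<Rightarrow> real^'n \<Rightarrow> 'f::real_vector"
  assumes "bilinear b"
  shows "contract C (\<lambda>u v. b (M *v u) (N *v v)) = contract (M ** C ** transpose N) b"
proof -
  have "contract C (\<lambda>u v. b (M *v u) (N *v v)) =
    (\<Sum>i\<in>UNIV. \<Sum>j\<in>UNIV. \<Sum>k\<in>UNIV. \<Sum>l\<in>UNIV.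
      (C $ i $ j * M $ k $ i * N $ l $ j) *\<^sub>R b (axis k 1) (axis l 1))"
    unfolding contract_def matrix_vector_axis bilinear_sum_sum[OF assms]
    by (simp add: scaleR_sum_right mult.assoc)
  also have "\<dots> = (\<Sum>i\<in>UNIV. \<Sum>k\<in>UNIV. \<Sum>j\<in>UNIV. \<Sum>l\<in>UNIV.
      (C $ i $ j * M $ k $ i * N $ l $ j) *\<^sub>R b (axis k 1) (axis l 1))"
    by (intro sum.cong refl sum.swap)
  also have "\<dots> = (\<Sum>k\<in>UNIV. \<Sum>i\<in>UNIV. \<Sum>l\<in>UNIV. \<Sum>j\<in>UNIV.
      (C $ i $ j * M $ k $ i * N $ l $ j) *\<^sub>R b (axis k 1) (axis l 1))"
    by (subst sum.swap) (intro sum.cong refl sum.swap)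
  also have "\<dots> = (\<Sum>k\<in>UNIV. \<Sum>l\<in>UNIV. \<Sum>j\<in>UNIV. \<Sum>i\<in>UNIV.
      (C $ i $ j * M $ k $ i * N $ l $ j) *\<^sub>R b (axis k 1) (axis l 1))"
    by (rule sum.cong[OF refl], rule trans[OF sum.swap]) (rule sum.cong[OF refl sum.swap])
  also have "\<dots> = contract (M ** C ** transpose N) b"
    by (simp add: contract_def matrix_matrix_mult_def transpose_def sum_distrib_right sum_distrib_left
        scaleR_sum_left mult.commute mult.left_commute)
  finally show ?thesis .
qed

lemma bilinear_compose_linear:
  assumes "bilinear b" "linear f" "linear h"
  shows "bilinear (\<lambda>u v. b (f u) (h v))"
  using assms linear_compose[of f] linear_compose[of h] unfolding bilinear_def o_def by blast

section \<open>Inner products and contraction with the inverse Gram matrix\<close>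

locale inner_form =
  fixes g :: "real^'n \<Rightarrow> real^'n \<Rightarrow> real"
  assumes bilinear: "bilinear g" and sym: "g u v = g v u" and pos: "v \<noteq> 0 \<Longrightarrow> 0 < g v v"
begin

definition G :: "real^'n^'n" where "G = (\<chi> i j. g (axis i 1) (axis j 1))"

lemma linear_left: "linear (\<lambda>u. g u v)"
  using bilinear by (simp add: bilinear_def)

lemmas g_diff_left = bilinear_lsub[OF bilinear]
  and g_minus_left = bilinear_lneg[OF bilinear] and g_minus_right = bilinear_rneg[OF bilinear]

lemma g_eq_inner: "g u v = u \<bullet> (G *v v)"
  unfolding G_def by (rule bilinear_eq_inner[OF bilinear])

lemma g_eq_0: "(\<And>v. g u v = 0) \<Longrightarrow> u = 0"
  using pos by fastforce

lemma invertible_G: "invertible G"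
proof -
  have "x = 0" if "G *v x = 0" for x
    using g_eq_inner[of x x] pos[of x] that by auto
  then show ?thesis
    by (simp add: invertible_left_inverse matrix_left_invertible_ker)
qed

lemma transpose_G: "transpose G = G"
  by (simp add: G_def transpose_def vec_eq_iff sym)

definition C :: "real^'n^'n" where "C = matrix_inv G"

lemma CG: "C ** G = mat 1" and GC: "G ** C = mat 1"
  using someI_ex[OF invertible_G[unfolded invertible_def]] by (auto simp: C_def matrix_inv_def)

lemma C_unique: "X ** G = mat 1 \<Longrightarrow> X = C"
  by (metis GC matrix_mul_assoc matrix_mul_lid matrix_mul_rid)

lemma transpose_C: "transpose C = C"
  by (rule C_unique) (metis GC matrix_transpose_mul transpose_G transpose_mat)

lemma contract_trace:
  assumes "linear f"
  shows "contract C (\<lambda>u v. g (f u) v) = trace (matrix f)"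
proof -
  have f: "f u = matrix f *v u" for u using assms by simp
  have "contract C (\<lambda>u v. g (f u) v) = contract C (\<lambda>u v. g (matrix f *v u) (mat 1 *v v))"
    using assms by simp
  also have "\<dots> = contract (matrix f ** C) g"
    by (simp only: contract_linear_image[OF bilinear] transpose_mat matrix_mul_rid)
  also have "\<dots> = trace (matrix f ** C ** transpose G)"
    by (simp add: contract_def trace_def matrix_matrix_mult_def transpose_def G_def)
  also have "\<dots> = trace (matrix f)"
    by (simp add: transpose_G matrix_mul_assoc[symmetric] CG)
  finally show ?thesis .
qed

text \<open>An orthogonal \<open>L\<close> carries orthonormal bases to orthonormal bases, that is,
  \<open>C\<close> is fixed under pushing both indices by \<open>L\<close>; as the inverse of
  \<open>L\<close> is \<open>- L\<close>, a factor \<open>L\<close> moves to the other slot with a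
  sign.\<close>

lemma contract_orthogonal_complex:
  fixes b :: "real^'n \<Rightarrow> real^'n \<Rightarrow> 'f::real_vector"
  assumes "bilinear b" and L: "linear L" "\<And>v. L (L v) = - v" "\<And>u v. g (L u) (L v) = g u v"
  shows "contract C (\<lambda>u v. b (L u) v) = contract C (\<lambda>u v. b u (- L v))"
proof -
  let ?M = "matrix L"
  have LM_eq: "?M *v v = L v" for v using L(1) by simp
  have inv: "transpose ?M *v (G *v (?M *v v)) = G *v v" for v
  proof (rule vector_eq_ldot[THEN iffD1], rule allI)
    fix u
    have "u \<bullet> (transpose ?M *v (G *v (?M *v v))) = (?M *v u) \<bullet> (G *v (?M *v v))"
      by (metis dot_lmul_matrix inner_commute transpose_matrix_vector)
    also have "\<dots> = u \<bullet> (G *v v)"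
      using L(3)[of u v] by (simp only: g_eq_inner LM_eq)
    finally show "u \<bullet> (transpose ?M *v (G *v (?M *v v))) = u \<bullet> (G *v v)" .
  qed
  let ?X = "?M ** C ** transpose ?M"
  have "?X *v (G *v (?M *v v)) = ?M *v v" for v
  proof -
    have "?X *v (G *v (?M *v v)) = ?M *v ((C ** G) *v v)"
      by (simp only: matrix_vector_mul_assoc[symmetric] inv)
    then show ?thesis by (simp only: CG matrix_vector_mul_lid)
  qed
  from this[of "- L v" for v] have "(?X ** G) *v v = mat 1 *v v" for v
    by (simp only: LM_eq linear_neg[OF L(1)] L(2) minus_minus matrix_vector_mul_assoc[symmetric] matrix_vector_mul_lid)
  then have MCM: "?X = C"
    by (intro C_unique matrix_eq[THEN iffD2]) blast
  have "contract C (\<lambda>u v. b (L u) v) = contract C (\<lambda>u v. b (?M *v u) (- L (?M *v v)))"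
    by (simp add: LM_eq L(2))
  also have "\<dots> = contract C (\<lambda>u v. b u (- L v))"
    using contract_linear_image[OF bilinear_compose_linear[OF \<open>bilinear b\<close> linear_id[unfolded id_def]
          linear_compose_neg[OF L(1)]], of C ?M ?M]
    by (simp add: MCM)
  finally show ?thesis .
qed

end


text \<open>The data at the identity, free of charts. Nilpotency is phrased for right-nested
  brackets [u1, [u2, ... [uk, v]]], the form that differentiated group commutators deliver.\<close>

locale lie_hkt = inner_form g
  for g :: "real^'n \<Rightarrow> real^'n \<Rightarrow> real" +
  fixes br :: "real^'n \<Rightarrow> real^'n \<Rightarrow> real^'n" and I J K :: "real^'n \<Rightarrow> real^'n" and k :: nat
  assumes br: "bilinear br" and skew: "br u v = - br v u"
    and nilpotent: "length us = k \<Longrightarrow> foldr br us v = 0"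
    and lin: "linear I" "linear J" "linear K"
    and II: "I (I v) = - v" and JJ: "J (J v) = - v" and KK: "K (K v) = - v"
    and IJ: "I (J v) = K v" and JI: "J (I v) = - K v"
    and gI: "g (I u) (I v) = g u v" and gJ: "g (J u) (J v) = g u v" and gK: "g (K u) (K v) = g u v"
    and NI: "br (I u) (I v) = br u v + I (br (I u) v) + I (br u (I v))"
    and NJ: "br (J u) (J v) = br u v + J (br (J u) v) + J (br u (J v))"
begin

lemma JK: "J (K v) = I v" and KJ: "K (J v) = - I v" and IK: "I (K v) = - J v" and KI: "K (I v) = J v"
proof -
  show "I (K v) = - J v" using II IJ by metis
  show KI: "K (I v) = J v" for v using IJ[of "I v"] JI[of v] IJ[of "J v"] II linear_neg[OF lin(1)]
    by (metis IJ JI add.inverse_inverse)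
  show "J (K v) = I v" using JI[of "J v"] JI JJ IJ linear_neg[OF lin(2)] by (metis add.inverse_inverse)
  show "K (J v) = - I v" using JI[of "J v"] IJ JJ linear_neg[OF lin(1)] by (metis add.inverse_inverse)
qed

lemmas minus = linear_neg[OF lin(1)] linear_neg[OF lin(2)] linear_neg[OF lin(3)]
lemmas add = linear_add[OF lin(1)] linear_add[OF lin(2)] linear_add[OF lin(3)]
lemmas quat = II JJ KK IJ JI JK KJ IK KI

lemma linear_br_right: "linear (br x)"
  using br by (simp add: bilinear_def)

lemma trace_ad: "trace (matrix (br x)) = 0"
proof (rule trace_nilpotent[OF linear_br_right])
  show "(br x ^^ k) v = 0" for v
    using nilpotent[of "replicate k x" v] by simp
qed

text \<open>The Dolbeault operator on holomorphic vectors: by integrability, the (1,0)-part of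
  [x + i I x, y - i I y] is w - i I w with w = \<open>D x y\<close>.\<close>

definition D :: "real^'n \<Rightarrow> real^'n \<Rightarrow> real^'n" where "D x y = br x y + I (br (I x) y)"

lemma linear_D: "linear (D x)"
  unfolding D_def
  using linear_compose[OF linear_br_right lin(1), of "I x"] linear_br_right
  by (auto simp: o_def intro: linear_compose_add)

lemma D_I: "D x (I y) = I (D x y)"
  using NI[of x y] by (simp add: D_def add minus II)

text \<open>Unlike the span of the \<open>i\<close>-fold brackets alone, this space is stable under
  \<open>I\<close>; an operator commuting with \<open>I\<close> therefore has to be tested only on
  the brackets.\<close>

definition H :: "nat \<Rightarrow> (real^'n) set" where
  "H i = span ({foldr br us v | us v. length us = i} \<union> I ` {foldr br us v | us v. length us = i})"

lemma D_H:
  assumes "y \<in> H i"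
  shows "D x y \<in> H (Suc i)"
proof -
  have gen: "D x (foldr br us v) \<in> H (Suc i)" "D x (I (foldr br us v)) \<in> H (Suc i)" if "length us = i" for us v
  proof -
    let ?w = "foldr br us v"
    have "br z ?w \<in> {foldr br us v | us v. length us = Suc i}" for z
      using that by (intro CollectI exI[of _ "z # us"] exI[of _ v]) simp
    then have base: "br z ?w \<in> H (Suc i)" "I (br z ?w) \<in> H (Suc i)" for z
      unfolding H_def by (blast intro: span_base)+
    have sub: "subspace (H (Suc i))" by (simp add: H_def subspace_span)
    show "D x ?w \<in> H (Suc i)" unfolding D_def by (intro subspace_add[OF sub] base)
    have "D x (I ?w) = I (br x ?w) + - br (I x) ?w"
      unfolding D_I by (simp add: D_def add II)
    then show "D x (I ?w) \<in> H (Suc i)" by (metis base subspace_add[OF sub] subspace_neg[OF sub])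
  qed
  have "D x ` H i \<subseteq> H (Suc i)"
    unfolding H_def[of i] linear_span_image[OF linear_D, symmetric]
    by (rule span_minimal) (use gen in \<open>auto simp: H_def\<close>)
  then show ?thesis using assms by blast
qed

lemma trace_D: "trace (matrix (D x)) = 0"
proof (rule trace_nilpotent[OF linear_D])
  fix v
  have "(D x ^^ i) v \<in> H i" for i
  proof (induction i)
    case 0
    have "v \<in> {foldr br us w | us w. length us = 0}" by simp
    then show ?case unfolding H_def by (auto intro: span_base)
  qed (use D_H in simp)
  moreover have "H k = {0}"
  proof -
    have "{foldr br us v | us v. length us = k} \<union> I ` {foldr br us v | us v. length us = k} \<subseteq> {0}"
      using nilpotent linear_0[OF lin(1)] by auto
    from span_mono[OF this] show ?thesis
      using span_0 unfolding H_def by auto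
  qed
  ultimately show "(D x ^^ k) v = 0" by auto
qed

text \<open>The traces of \<open>D x\<close> and of \<open>ad x\<close> vanish, so their difference,
  the trace of \<open>I\<close> after \<open>ad (I x)\<close>, vanishes too; then substitute
  \<open>- I x\<close> for \<open>x\<close>.\<close>

lemma trace_I_ad: "trace (matrix (\<lambda>y. I (br x y))) = 0"
proof -
  have "matrix (D x) = matrix (br x) + matrix (\<lambda>y. I (br (I x) y))" for x
    by (simp add: matrix_def D_def vec_eq_iff)
  then have "trace (matrix (\<lambda>y. I (br (I x) y))) = 0" for x
    using trace_D[of x] trace_ad[of x] by (simp add: trace_add)
  from this[of "- I x"] show ?thesis by (simp add: minus II)
qed

text \<open>\<open>Z L\<close> is \<open>\<Sum>\<^sub>i [e\<^sub>i, L e\<^sub>i]\<close> for a \<open>g\<close>-orthonormal basis \<open>e\<close>.\<close>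

definition Z :: "(real^'n \<Rightarrow> real^'n) \<Rightarrow> real^'n" where "Z L = contract C (\<lambda>u v. br u (L v))"

lemmas gL = gI gJ gK

lemma contract_I:
  "bilinear b \<Longrightarrow> contract C (\<lambda>u v. b (I u) v) = contract C (\<lambda>u v. b u (- I v))"
  and contract_J:
  "bilinear b \<Longrightarrow> contract C (\<lambda>u v. b (J u) v) = contract C (\<lambda>u v. b u (- J v))"
  by (rule contract_orthogonal_complex; simp add: lin quat gL)+

text \<open>Sum the integrability of \<open>I\<close> over the pairs (e, J e). After moving
  \<open>I\<close> to the second slot, the left side becomes \<open>- Z J\<close>, and the two
  correction terms become \<open>I (Z K)\<close> each.\<close>

lemma Z_J_eq: "Z J = - I (Z K)"
proof -
  have 1: "contract C (\<lambda>u v. br (I u) (K v)) = - Z J"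
    using contract_I[OF bilinear_compose_linear[OF br linear_id lin(3)]]
    by (simp add: minus quat Z_def bilinear_rneg[OF br] contract_uminus)
  have 2: "contract C (\<lambda>u v. br (I u) (J v)) = Z K"
    using contract_I[OF bilinear_compose_linear[OF br linear_id lin(2)]]
    by (simp add: minus quat Z_def)
  have "contract C (\<lambda>u v. br (I u) (I (J v))) =
      contract C (\<lambda>u v. br u (J v) + I (br (I u) (J v)) + I (br u (I (J v))))"
    by (simp only: NI)
  also have "\<dots> = Z J + I (contract C (\<lambda>u v. br (I u) (J v))) + I (Z K)"
    by (simp only: contract_add linear_contract[OF lin(1)] Z_def IJ)
  finally have "contract C (\<lambda>u v. br (I u) (I (J v))) =
      Z J + I (contract C (\<lambda>u v. br (I u) (J v))) + I (Z K)" .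
  then have "- Z J = Z J + I (Z K) + I (Z K)"
    unfolding IJ 1 2 .
  then have "- Z J $ i = Z J $ i + I (Z K) $ i + I (Z K) $ i" for i
    by (metis vector_add_component vector_uminus_component)
  then have "Z J $ i = - I (Z K) $ i" for i
    by (smt (verit))
  then show ?thesis by (simp add: vec_eq_iff)
qed

text \<open>The same computation after the cyclic exchange of \<open>I\<close>, \<open>J\<close>,
  \<open>K\<close> by \<open>J\<close>, \<open>K\<close>, \<open>I\<close>, now from integrability
  of \<open>J\<close>.\<close>

lemma Z_K_eq: "Z K = - J (Z I)"
proof -
  have 1: "contract C (\<lambda>u v. br (J u) (I v)) = - Z K"
    using contract_J[OF bilinear_compose_linear[OF br linear_id lin(1)]]
    by (simp add: minus quat Z_def bilinear_rneg[OF br] contract_uminus)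
  have 2: "contract C (\<lambda>u v. br (J u) (K v)) = Z I"
    using contract_J[OF bilinear_compose_linear[OF br linear_id lin(3)]]
    by (simp add: minus quat Z_def)
  have "contract C (\<lambda>u v. br (J u) (J (K v))) =
      contract C (\<lambda>u v. br u (K v) + J (br (J u) (K v)) + J (br u (J (K v))))"
    by (simp only: NJ)
  also have "\<dots> = Z K + J (contract C (\<lambda>u v. br (J u) (K v))) + J (Z I)"
    by (simp only: contract_add linear_contract[OF lin(2)] Z_def JK)
  finally have "contract C (\<lambda>u v. br (J u) (J (K v))) =
      Z K + J (contract C (\<lambda>u v. br (J u) (K v))) + J (Z I)" .
  then have "- Z K = Z K + J (Z I) + J (Z I)"
    unfolding JK 1 2 .
  then have "- Z K $ i = Z K $ i + J (Z I) $ i + J (Z I) $ i" for i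
    by (metis vector_add_component vector_uminus_component)
  then have "Z K $ i = - J (Z I) $ i" for i
    by (smt (verit))
  then show ?thesis by (simp add: vec_eq_iff)
qed

text \<open>The exterior derivative of the left-invariant 2-form \<open>g(\<cdot>, L \<cdot>)\<close>.\<close>

definition dform :: "(real^'n \<Rightarrow> real^'n) \<Rightarrow> real^'n \<Rightarrow> real^'n \<Rightarrow> real^'n \<Rightarrow> real" where
  "dform L u v w = - g (br u v) (L w) + g (br u w) (L v) - g (br v w) (L u)"

lemma bilinear_dform:
  assumes "linear L"
  shows "bilinear (dform L x)"
proof -
  have "linear (\<lambda>v. - g (br x v) (L w) + g (br x w) (L v) - g (br v w) (L x))"
    and "linear (\<lambda>w. - g (br x v) (L w) + g (br x w) (L v) - g (br v w) (L x))" for v w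
    by (auto intro!: linearI simp: linear_add[OF assms] linear_scale[OF assms]
        bilinear_ladd[OF br] bilinear_radd[OF br] bilinear_lmul[OF br] bilinear_rmul[OF br]
        bilinear_ladd[OF bilinear] bilinear_radd[OF bilinear] bilinear_lmul[OF bilinear]
        bilinear_rmul[OF bilinear] algebra_simps)
  then show ?thesis unfolding bilinear_def dform_def by auto
qed

text \<open>A trace of the 3-form: its value on (x, e, M e), summed over an orthonormal
  basis.\<close>

definition S where "S L M x = contract C (\<lambda>u v. dform L x u (M v))"

lemma g_skew:
  assumes "\<And>u v. g (L u) (L v) = g u v" "\<And>v. L (L v) = - v"
  shows "g u (L v) = - g (L u) v"
  using assms(1)[of u "L v"] by (simp add: assms(2) g_minus_right)

text \<open>Two of the three terms of \<open>dform\<close> contract to traces of \<open>ad x\<close>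
  composed with \<open>M \<circ> L\<close>, by skewness and cyclicity of the trace. The last
  assumption makes this composite minus the identity or plus or minus \<open>I\<close>, the cases in
  which the trace is known to vanish; it holds whenever \<open>L\<close> and \<open>M\<close> are
  taken from \<open>J\<close> and \<open>K\<close>. The third term is the pairing with
  \<open>Z M\<close>.\<close>

lemma S_eq:
  assumes L: "linear L" "\<And>u v. g (L u) (L v) = g u v" "\<And>v. L (L v) = - v"
    and M: "linear M" "\<And>u v. g (M u) (M v) = g u v" "\<And>v. M (M v) = - v"
    and LM_eq: "(\<forall>v. M (L v) = - v) \<or> (\<forall>v. M (L v) = I v) \<or> (\<forall>v. M (L v) = - I v)"
  shows "S L M x = - g (Z M) (L x)"
proof -
  have lML: "linear (\<lambda>y. M (L (br x y)))"
    using linear_compose[OF linear_compose[OF linear_br_right L(1)] M(1)] by (simp add: o_def)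
  have lLM: "linear (\<lambda>y. L (br x (M y)))"
    using linear_compose[OF linear_compose[OF M(1) linear_br_right] L(1)] by (simp add: o_def)
  have tr: "trace (matrix (\<lambda>y. M (L (br x y)))) = 0"
  proof -
    have "trace (matrix (\<lambda>y. - f y)) = - trace (matrix f)" for f :: "real^'n \<Rightarrow> real^'n"
      by (simp add: trace_def matrix_def sum_negf)
    with LM_eq show ?thesis using trace_ad[of x] trace_I_ad[of x] by auto
  qed
  have tr': "trace (matrix (\<lambda>y. L (br x (M y)))) = 0"
  proof -
    have "trace (matrix (\<lambda>y. L (br x (M y)))) = trace (matrix (\<lambda>y. L (br x y)) ** matrix M)"
      using matrix_compose[OF M(1) linear_compose[OF linear_br_right L(1)], of x] by (simp add: o_def)
    also have "\<dots> = trace (matrix M ** matrix (\<lambda>y. L (br x y)))" by (rule trace_mul_sym)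
    also have "\<dots> = trace (matrix (\<lambda>y. M (L (br x y))))"
      using matrix_compose[OF linear_compose[OF linear_br_right L(1)] M(1), of x] by (simp add: o_def)
    finally show ?thesis using tr by simp
  qed
  have 1: "contract C (\<lambda>u v. g (br x u) (L (M v))) = 0"
  proof -
    have "g (br x u) (L (M v)) = g (M (L (br x u))) v" for u v
      using g_skew[OF L(2,3), of "br x u" "M v"] g_skew[OF M(2,3), of "L (br x u)" v] by simp
    then show ?thesis using contract_trace[OF lML] tr by simp
  qed
  have 2: "contract C (\<lambda>u v. g (br x (M v)) (L u)) = 0"
  proof -
    have "g (br x (M v)) (L u) = - g (L (br x (M v))) u" for u v
      using g_skew[OF L(2,3)] .
    then have "contract C (\<lambda>u v. g (br x (M v)) (L u)) = - contract C (\<lambda>u v. g (L (br x (M v))) u)"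
      by (simp add: contract_uminus)
    also have "contract C (\<lambda>u v. g (L (br x (M v))) u) = contract C (\<lambda>v u. g (L (br x (M v))) u)"
      by (rule contract_swap[OF transpose_C])
    finally show ?thesis using contract_trace[OF lLM] tr' by simp
  qed
  have 3: "contract C (\<lambda>u v. g (br u (M v)) (L x)) = g (Z M) (L x)"
    unfolding Z_def using linear_contract[OF linear_left] by metis
  show ?thesis
    unfolding S_def dform_def contract_diff contract_add contract_uminus 1 2 3 by simp
qed

definition dOmega :: "real^'n \<Rightarrow> real^'n \<Rightarrow> real^'n \<Rightarrow> complex" where
  "dOmega u v w = of_real (dform J u v w) + \<i> * of_real (dform K u v w)"

text \<open>The real part of eight times the (3,0)-part. Every argument hit by \<open>I\<close>
  carries a factor -i, so one or three of them pick out the imaginary part \<open>dform K\<close>,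
  none or two the real part \<open>dform J\<close>.\<close>

lemma part30_real:
  assumes "part30 I dOmega x u v = 0"
  shows "dform J x u v - (dform J (I x) (I u) v + dform J (I x) u (I v) + dform J x (I u) (I v))
    + (dform K (I x) u v + dform K x (I u) v + dform K x u (I v)) - dform K (I x) (I u) (I v) = 0"
  using assms unfolding part30_def part10_def dOmega_def complex_eq_iff
  by (simp add: field_simps)

theorem Z_zero:
  assumes HKT: "\<And>x u v. part30 I dOmega x u v = 0"
  shows "Z I = 0" "Z J = 0" "Z K = 0"
proof -
  have S: "S J J x = - g (Z J) (J x)" "S J K x = - g (Z K) (J x)" "S K J x = - g (Z J) (K x)"
    "S K K x = - g (Z K) (K x)" for x
    by (rule S_eq; simp add: lin quat gL)+
  have flip: "contract C (\<lambda>u v. dform L x (I u) (M v)) = contract C (\<lambda>u v. dform L x u (M (- I v)))"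
    if "linear L" "linear M" for L M x
    using contract_I[OF bilinear_compose_linear[OF bilinear_dform[OF that(1)] linear_id that(2)]] by simp
  have neg: "dform L x u (- v) = - dform L x u v" if "linear L" for L x u v
    by (rule bilinear_rneg[OF bilinear_dform[OF that]])
  have c: "contract C (\<lambda>u v. dform J (I x) (I u) (J v)) = S J K (I x)"
    "contract C (\<lambda>u v. dform J x (I u) (K v)) = - S J J x"
    "contract C (\<lambda>u v. dform K x (I u) (J v)) = S K K x"
    "contract C (\<lambda>u v. dform K (I x) (I u) (K v)) = - S K J (I x)" for x
    by (simp_all add: flip lin minus quat neg S_def contract_uminus)
  have "contract C (\<lambda>u v. dform J x u (J v) - (dform J (I x) (I u) (J v) + dform J (I x) u (I (J v))
      + dform J x (I u) (I (J v))) + (dform K (I x) u (J v) + dform K x (I u) (J v)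
      + dform K x u (I (J v))) - dform K (I x) (I u) (I (J v))) = 0" for x
    unfolding part30_real[OF HKT] by (rule contract_0)
  then have "S J J x - (S J K (I x) + S J K (I x) - S J J x) + (S K J (I x) + S K K x + S K K x)
      + S K J (I x) = 0" for x
    unfolding IJ contract_add contract_diff c S_def[symmetric] by simp
  \<comment> \<open>By \<open>S\<close>, \<open>S K J (I x) = S J J x\<close> and
    \<open>S J K (I x) = - S K K x\<close>, so the sum is four times
    \<open>S J J x + S K K x\<close>.\<close>
  then have "- g (Z J) (J x) = g (Z K) (K x)" for x
    by (simp add: S quat g_minus_right)
  then have a: "g (Z J) (J x) + g (Z K) (K x) = 0" for x
    by (metis add.right_inverse)
  have "g (Z J) (J x) = g (Z K) (K x)" for x
    using gI[of "Z K" "K x"] by (simp add: Z_J_eq quat g_minus_left g_minus_right)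
  with a have "g (Z K) (K x) = 0" for x by (metis add_cancel_right_left double_zero)
  then have "g (Z K) v = 0" for v
    by (metis KK g_minus_right neg_equal_0_iff_equal)
  then show ZK: "Z K = 0" by (rule g_eq_0)
  show "Z J = 0" by (simp add: Z_J_eq ZK linear_0[OF lin(1)])
  have "J (Z I) = 0" using Z_K_eq by (simp add: ZK)
  then show "Z I = 0" using JJ[of "Z I"] linear_0[OF lin(2)] by simp
qed

text \<open>The matrix is the 2-form \<open>g u (L v)\<close> with both indices raised, which
  simplifies to \<open>matrix L ** C\<close>; pairing it with the bracket sums [L e, e].\<close>

lemma contract_bivector:
  assumes "linear L"
  shows "contract (C ** (\<chi> i j. g (axis i 1) (L (axis j 1))) ** C) br = - Z L"
proof -
  have "(\<chi> i j. g (axis i 1) (L (axis j 1))) = G ** matrix L"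
    by (simp add: vec_eq_iff matrix_matrix_mult_def matrix_vector_mult_def inner_axis' matrix_def g_eq_inner)
  then have "C ** (\<chi> i j. g (axis i 1) (L (axis j 1))) ** C = matrix L ** C ** transpose (mat 1)"
    by (simp only: matrix_mul_assoc CG transpose_mat matrix_mul_lid matrix_mul_rid)
  then have "contract (C ** (\<chi> i j. g (axis i 1) (L (axis j 1))) ** C) br = contract C (\<lambda>u v. br (L u) v)"
    using contract_linear_image[OF br, of C "matrix L" "mat 1"] assms by simp
  also have "\<dots> = contract C (\<lambda>u v. - br v (L u))" by (metis skew)
  also have "\<dots> = - Z L"
    using contract_swap[OF transpose_C, of "\<lambda>u v. br u (L v)"] by (simp only: contract_uminus Z_def)
  finally show ?thesis .
qed

end

section \<open>Matrix form of the pairing of 2-forms\<close>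

lemma inner_transpose:
  fixes P :: "real^'m^'n"
  shows "u \<bullet> (transpose P *v w) = (P *v u) \<bullet> w"
proof -
  have "u \<bullet> (transpose P *v w) = (w v* P) \<bullet> u"
    by (subst transpose_matrix_vector) (rule inner_commute)
  also have "\<dots> = w \<bullet> (P *v u)" by (rule dot_lmul_matrix)
  finally show ?thesis by (subst (2) inner_commute)
qed

lemma matrix_eq_inner:
  fixes A B :: "real^'n^'n"
  assumes "\<And>u v. u \<bullet> (A *v v) = u \<bullet> (B *v v)"
  shows "A = B"
proof -
  have "A *v v = B *v v" for v
    using assms vector_eq_ldot by blast
  then show ?thesis using matrix_eq by blast
qed

text \<open>Raising both indices of \<open>\<gamma>\<close> turns the pairing into a contraction of
  \<open>\<beta>\<close>, to which the change-of-frame rule applies. The 1/2 is the normalisation in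
  \<open>inner2\<close>.\<close>

lemma inner2_eq_contract:
  "inner2 A \<beta> \<gamma> = contract (matrix_inv A ** (\<chi> i j. \<gamma> (axis i 1) (axis j 1)) ** transpose (matrix_inv A)) \<beta> / 2"
proof -
  let ?C = "matrix_inv A" and ?g = "\<lambda>k l. \<gamma> (axis k 1) (axis l 1)"
  have "(\<Sum>k\<in>UNIV. \<Sum>l\<in>UNIV. ?C $ i $ k * ?C $ j $ l * \<beta> (axis i 1) (axis j 1) * ?g k l) =
      (?C ** (\<chi> i j. ?g i j) ** transpose ?C) $ i $ j * \<beta> (axis i 1) (axis j 1)" for i j
    by (subst sum.swap)
      (simp add: matrix_matrix_mult_def transpose_def sum_distrib_left sum_distrib_right
        mult.commute mult.left_commute)
  then show ?thesis by (simp add: inner2_def contract_def)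
qed

section \<open>Charts and smooth maps\<close>

locale manifold_chart =
  fixes M :: "('a, 'n::finite) manifold" and c :: "('a, 'n) chart"
  assumes man: "smooth_manifold M" and c: "c \<in> atlas M"
begin

lemma open_dom: "openin (mtop M) (fst c)" and open_cimg: "open (cimg c)"
  and homeo: "homeomorphic_map (subtopology (mtop M) (fst c)) (top_of_set (cimg c)) (snd c)"
  using man c by (auto simp: smooth_manifold_def)

lemma dom_subset: "fst c \<subseteq> topspace (mtop M)"
  using open_dom by (rule openin_subset)

lemma inj: "inj_on (snd c) (fst c)"
  using homeomorphic_imp_injective_map[OF homeo] dom_subset by (simp add: Int_absorb1)

lemma cinv_snd: "p \<in> fst c \<Longrightarrow> cinv c (snd c p) = p"
  using inj by (simp add: cinv_def)

lemma snd_in: "p \<in> fst c \<Longrightarrow> snd c p \<in> cimg c"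
  by (simp add: cimg_def)

lemma snd_cinv: "x \<in> cimg c \<Longrightarrow> snd c (cinv c x) = x"
  by (simp add: cinv_def cimg_def f_inv_into_f)

lemma cinv_in: "x \<in> cimg c \<Longrightarrow> cinv c x \<in> fst c"
  by (simp add: cinv_def cimg_def inv_into_into)

lemma cinv_top: "x \<in> cimg c \<Longrightarrow> cinv c x \<in> topspace (mtop M)"
  using cinv_in dom_subset by blast

lemma continuous_cinv: "continuous_map (top_of_set (cimg c)) (mtop M) (cinv c)"
proof -
  obtain h where h: "homeomorphic_maps (subtopology (mtop M) (fst c)) (top_of_set (cimg c)) (snd c) h"
    using homeo by (auto simp: homeomorphic_map_maps)
  then have h: "continuous_map (top_of_set (cimg c)) (subtopology (mtop M) (fst c)) h"
    "\<And>y. y \<in> cimg c \<Longrightarrow> snd c (h y) = y" by (auto simp: homeomorphic_maps_def)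
  have "h y = cinv c y" if "y \<in> cimg c" for y
  proof -
    have "h y \<in> fst c" using continuous_map_image_subset_topspace[OF h(1)] that by auto
    then show ?thesis using h(2)[OF that] cinv_snd by metis
  qed
  then show ?thesis
    using continuous_map_eq[OF h(1)] continuous_map_in_subtopology by fastforce
qed

lemma continuous_snd: "continuous_map (subtopology (mtop M) (fst c)) euclidean (snd c)"
  using homeomorphic_imp_continuous_map[OF homeo] continuous_map_in_subtopology by blast

lemma open_preimage:
  assumes "continuous_map (mtop M) X F" "openin X U"
  shows "open {x \<in> cimg c. F (cinv c x) \<in> U}"
proof -
  have "openin (top_of_set (cimg c)) {x \<in> topspace (top_of_set (cimg c)). (F \<circ> cinv c) x \<in> U}"
    by (rule openin_continuous_map_preimage[OF continuous_map_compose[OF continuous_cinv assms(1)] assms(2)])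
  then show ?thesis
    using open_cimg by (simp add: openin_open_eq)
qed

lemma dom_image: "snd c ` {p \<in> fst c. P p} = {x \<in> cimg c. P (cinv c x)}"
  using cinv_snd snd_cinv cinv_in by (force simp: cimg_def)

end

lemma manifold_chart_obtain:
  assumes "smooth_manifold M" "p \<in> topspace (mtop M)"
  obtains c where "c \<in> atlas M" "p \<in> fst c"
  using assms unfolding smooth_manifold_def by blast

lemma smooth_map_loc_rep:
  assumes "smooth_manifold M" "smooth_manifold M'" "smooth_map M M' F" "c \<in> atlas M" "c' \<in> atlas M'"
  shows "smooth_on {x \<in> cimg c. F (cinv c x) \<in> fst c'} (loc_rep F c c')"
    and "open {x \<in> cimg c. F (cinv c x) \<in> fst c'}"
proof -
  interpret c: manifold_chart M c using assms by unfold_locales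
  interpret c': manifold_chart M' c' using assms by unfold_locales
  have "smooth_on (snd c ` {p \<in> fst c. F p \<in> fst c'}) (loc_rep F c c')"
    using assms(3,4,5) unfolding smooth_map_def by blast
  then show "smooth_on {x \<in> cimg c. F (cinv c x) \<in> fst c'} (loc_rep F c c')"
    by (simp only: c.dom_image)
  show "open {x \<in> cimg c. F (cinv c x) \<in> fst c'}"
    using assms(3) by (intro c.open_preimage[of "mtop M'"] c'.open_dom) (simp add: smooth_map_def)
qed

lemma smooth_map_topspace:
  "smooth_map M M' F \<Longrightarrow> p \<in> topspace (mtop M) \<Longrightarrow> F p \<in> topspace (mtop M')"
  unfolding smooth_map_def using continuous_map_image_subset_topspace by fastforce

lemma tangent_map_has_derivative:
  assumes "smooth_manifold M" "smooth_manifold M'" "smooth_map M M' F" "c \<in> atlas M" "c' \<in> atlas M'"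
    "p \<in> fst c" "F p \<in> fst c'"
  shows "(loc_rep F c c' has_derivative tangent_map F c c' p) (at (snd c p))"
proof -
  interpret c: manifold_chart M c using assms by unfold_locales
  show ?thesis
    unfolding tangent_map_def using assms
    by (intro smooth_on_has_derivative[OF smooth_map_loc_rep(1)[OF assms(1-5)]])
      (simp add: c.cinv_snd c.snd_in)
qed

text \<open>\<open>cinv c\<close> maps the open set \<open>cimg c\<close> into the space, so the two
  local representatives agree near the point, whatever the maps do elsewhere.\<close>

lemma tangent_map_cong:
  assumes "smooth_manifold M" "smooth_manifold M'" "smooth_map M M' F" "c \<in> atlas M" "c' \<in> atlas M'"
    "p \<in> fst c" "F p \<in> fst c'" "\<And>q. q \<in> topspace (mtop M) \<Longrightarrow> F q = H q"
  shows "tangent_map H c c' p = tangent_map F c c' p"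
proof -
  interpret c: manifold_chart M c using assms by unfold_locales
  have "(loc_rep H c c' has_derivative tangent_map F c c' p) (at (snd c p))"
    by (rule has_derivative_transform_within_open[OF tangent_map_has_derivative[OF assms(1-7)] c.open_cimg])
      (use assms in \<open>auto simp: c.snd_in loc_rep_def c.cinv_top\<close>)
  then show ?thesis unfolding tangent_map_def[of H] by (rule frechet_derivative_eqI)
qed

lemma smooth_map_compose:
  assumes M: "smooth_manifold M" "smooth_manifold M'" "smooth_manifold M''"
    and F: "smooth_map M M' F" and H: "smooth_map M' M'' H"
  shows "smooth_map M M'' (H \<circ> F)"
  unfolding smooth_map_def
proof (intro conjI ballI)
  show "continuous_map (mtop M) (mtop M'') (H \<circ> F)"
    using F H by (auto simp: smooth_map_def intro: continuous_map_compose)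
  fix c c'' assume c: "c \<in> atlas M" "c'' \<in> atlas M''"
  interpret c: manifold_chart M c using M c by unfold_locales
  show "smooth_on (snd c ` {p \<in> fst c. (H \<circ> F) p \<in> fst c''}) (loc_rep (H \<circ> F) c c'')"
    unfolding c.dom_image
  proof (rule smooth_on_local)
    fix x assume x: "x \<in> {x \<in> cimg c. (H \<circ> F) (cinv c x) \<in> fst c''}"
    then obtain c' where c': "c' \<in> atlas M'" "F (cinv c x) \<in> fst c'"
      using manifold_chart_obtain[OF M(2)] smooth_map_topspace[OF F] c.cinv_top by blast
    interpret c': manifold_chart M' c' using M c' by unfold_locales
    \<comment> \<open>Smoothness is local, so it is enough to pass through one chart
      \<open>c'\<close> around the intermediate point and to shrink to where both representatives
      compose.\<close>
    define U where "U = {x \<in> cimg c. F (cinv c x) \<in> fst c'}"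
    define V where "V = {x \<in> cimg c'. H (cinv c' x) \<in> fst c''}"
    note FU = smooth_map_loc_rep[OF M(1,2) F c(1) c'(1), folded U_def]
    note HV = smooth_map_loc_rep[OF M(2,3) H c'(1) c(2), folded V_def]
    define W where "W = {x \<in> U. loc_rep F c c' x \<in> V}"
    have W: "open W" unfolding W_def by (rule open_preimage_smooth[OF FU(2,1) HV(2)])
    have "x \<in> W" using x c' by (simp add: W_def U_def V_def loc_rep_def c'.cinv_snd c'.snd_in)
    moreover have "smooth_on W (\<lambda>x. loc_rep H c' c'' (loc_rep F c c' x))"
      by (rule smooth_on_compose[OF W HV(2) smooth_on_subset[OF FU(1)] HV(1)]) (auto simp: W_def)
    then have "smooth_on W (loc_rep (H \<circ> F) c c'')"
      by (rule smooth_on_cong[OF W]) (auto simp: W_def U_def loc_rep_def c'.cinv_snd)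
    ultimately show "\<exists>U. open U \<and> x \<in> U \<and> smooth_on U (loc_rep (H \<circ> F) c c'')" using W by blast
  qed
qed

lemma tangent_map_compose:
  assumes M: "smooth_manifold M" "smooth_manifold M'" "smooth_manifold M''"
    and F: "smooth_map M M' F" and H: "smooth_map M' M'' H"
    and c: "c \<in> atlas M" "c' \<in> atlas M'" "c'' \<in> atlas M''"
    and p: "p \<in> fst c" "F p \<in> fst c'" "H (F p) \<in> fst c''"
  shows "tangent_map (H \<circ> F) c c'' p v = tangent_map H c' c'' (F p) (tangent_map F c c' p v)"
proof -
  interpret c: manifold_chart M c using M c by unfold_locales
  interpret c': manifold_chart M' c' using M c by unfold_locales
  define U where "U = {x \<in> cimg c. F (cinv c x) \<in> fst c'}"
  note FU = smooth_map_loc_rep[OF M(1,2) F c(1,2), folded U_def]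
  have Fp: "loc_rep F c c' (snd c p) = snd c' (F p)" by (simp add: loc_rep_def c.cinv_snd p)
  have "((\<lambda>x. loc_rep H c' c'' (loc_rep F c c' x)) has_derivative
      (\<lambda>v. tangent_map H c' c'' (F p) (tangent_map F c c' p v))) (at (snd c p))"
    by (rule has_derivative_compose[OF tangent_map_has_derivative[OF M(1,2) F c(1,2) p(1,2)]])
      (simp add: Fp tangent_map_has_derivative[OF M(2,3) H c(2,3) p(2,3)])
  then have "(loc_rep (H \<circ> F) c c'' has_derivative
      (\<lambda>v. tangent_map H c' c'' (F p) (tangent_map F c c' p v))) (at (snd c p))"
    by (rule has_derivative_transform_within_open[OF _ FU(2)])
      (use p in \<open>auto simp: U_def loc_rep_def c.cinv_snd c.snd_in c'.cinv_snd\<close>)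
  then show ?thesis unfolding tangent_map_def[of "H \<circ> F"] by (simp add: frechet_derivative_eqI)
qed

lemma tangent_map_id:
  assumes "smooth_manifold M" "c \<in> atlas M" "p \<in> fst c"
  shows "tangent_map id c c p v = v"
proof -
  interpret c: manifold_chart M c using assms by unfold_locales
  have "(loc_rep id c c has_derivative (\<lambda>v. v)) (at (snd c p))"
    by (rule has_derivative_transform_within_open[OF has_derivative_ident c.open_cimg])
      (use assms in \<open>auto simp: c.snd_in loc_rep_def c.snd_cinv\<close>)
  then show ?thesis unfolding tangent_map_def by (simp add: frechet_derivative_eqI)
qed

lemma smooth_map_id: "smooth_manifold M \<Longrightarrow> smooth_map M M id"
  by (auto simp: smooth_map_def smooth_manifold_def Int_def)

lemma smooth_map_const:
  assumes "smooth_manifold M" "q \<in> topspace (mtop M')"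
  shows "smooth_map M M' (\<lambda>p. q)"
  using assms by (auto simp: smooth_map_def loc_rep_def comp_def smooth_on_const)

section \<open>Lie groups\<close>

locale lie_grp = group G for G :: "('a, 'z) monoid_scheme" (structure) +
  fixes M :: "('a, 'n::finite) manifold"
  assumes lie_group: "lie_group G M"
begin

lemma man: "smooth_manifold M" and topspace: "topspace (mtop M) = carrier G"
  and continuous_mult: "continuous_map (prod_topology (mtop M) (mtop M)) (mtop M) (\<lambda>(p, q). p \<otimes> q)"
  and smooth_inv: "smooth_map M M (\<lambda>p. inv p)"
  using lie_group by (auto simp: lie_group_def)

definition mult_rep :: "('a, 'n) chart \<Rightarrow> ('a, 'n) chart \<Rightarrow> ('a, 'n) chart \<Rightarrow> (real^'n) \<times> (real^'n) \<Rightarrow> real^'n" where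
  "mult_rep c c' c'' = (\<lambda>(x, y). snd c'' (cinv c x \<otimes> cinv c' y))"

definition mult_dom :: "('a, 'n) chart \<Rightarrow> ('a, 'n) chart \<Rightarrow> ('a, 'n) chart \<Rightarrow> ((real^'n) \<times> (real^'n)) set" where
  "mult_dom c c' c'' = {(x, y). x \<in> cimg c \<and> y \<in> cimg c' \<and> cinv c x \<otimes> cinv c' y \<in> fst c''}"

lemma chart_carrier: "c \<in> atlas M \<Longrightarrow> p \<in> fst c \<Longrightarrow> p \<in> carrier G"
  using manifold_chart.dom_subset[of M c] man topspace by (auto simp: manifold_chart_def)

lemma
  assumes c: "c \<in> atlas M" "c' \<in> atlas M" "c'' \<in> atlas M"
  shows smooth_mult_rep: "smooth_on (mult_dom c c' c'') (mult_rep c c' c'')"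
    and open_mult_dom: "open (mult_dom c c' c'')"
proof -
  interpret c: manifold_chart M c using man c by unfold_locales
  interpret c': manifold_chart M c' using man c by unfold_locales
  interpret c'': manifold_chart M c'' using man c by unfold_locales
  have "map_prod (snd c) (snd c') ` {(p, q). p \<in> fst c \<and> q \<in> fst c' \<and> p \<otimes> q \<in> fst c''} = mult_dom c c' c''"
  proof (intro equalityI subsetI)
    fix z assume "z \<in> mult_dom c c' c''"
    then have "z = map_prod (snd c) (snd c') (cinv c (fst z), cinv c' (snd z))"
      "(cinv c (fst z), cinv c' (snd z)) \<in> {(p, q). p \<in> fst c \<and> q \<in> fst c' \<and> p \<otimes> q \<in> fst c''}"
      by (auto simp: mult_dom_def c.snd_cinv c'.snd_cinv c.cinv_in c'.cinv_in)
    then show "z \<in> map_prod (snd c) (snd c') ` {(p, q). p \<in> fst c \<and> q \<in> fst c' \<and> p \<otimes> q \<in> fst c''}"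
      by (rule image_eqI)
  qed (auto simp: mult_dom_def c.cinv_snd c'.cinv_snd c.snd_in c'.snd_in)
  moreover have "smooth_on (map_prod (snd c) (snd c') ` {(p, q). p \<in> fst c \<and> q \<in> fst c' \<and> p \<otimes> q \<in> fst c''})
      (mult_rep c c' c'')"
    using lie_group c unfolding lie_group_def mult_rep_def by blast
  ultimately show "smooth_on (mult_dom c c' c'') (mult_rep c c' c'')" by simp
  have 1: "continuous_map (top_of_set (cimg c \<times> cimg c')) (mtop M) (cinv c \<circ> fst)"
    by (rule continuous_map_compose[OF _ c.continuous_cinv])
      (auto simp: continuous_map_subtopology_eu intro!: continuous_intros)
  have 2: "continuous_map (top_of_set (cimg c \<times> cimg c')) (mtop M) (cinv c' \<circ> snd)"
    by (rule continuous_map_compose[OF _ c'.continuous_cinv])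
      (auto simp: continuous_map_subtopology_eu intro!: continuous_intros)
  have "continuous_map (top_of_set (cimg c \<times> cimg c')) (prod_topology (mtop M) (mtop M))
      (\<lambda>z. ((cinv c \<circ> fst) z, (cinv c' \<circ> snd) z))"
    using 1 2 by (simp only: continuous_map_paired)
  from openin_continuous_map_preimage[OF continuous_map_compose[OF this continuous_mult] c''.open_dom]
  have "openin (top_of_set (cimg c \<times> cimg c')) (mult_dom c c' c'')"
    by (rule back_subst[of "openin (top_of_set (cimg c \<times> cimg c'))"]) (auto simp: mult_dom_def)
  then show "open (mult_dom c c' c'')"
    using c.open_cimg c'.open_cimg by (simp add: openin_open_eq open_Times)
qed

lemma continuous_map_mult:
  assumes "continuous_map X (mtop M) f" "continuous_map X (mtop M) h"
  shows "continuous_map X (mtop M) (\<lambda>y. f y \<otimes> h y)"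
proof -
  have "continuous_map X (prod_topology (mtop M) (mtop M)) (\<lambda>y. (f y, h y))"
    using assms by (simp add: continuous_map_paired)
  from continuous_map_compose[OF this continuous_mult] show ?thesis by (simp add: o_def)
qed

text \<open>Both claims come from one local identity: the product is \<open>mult_rep\<close> applied
  to the pair of local representatives. The charts \<open>ca\<close> and \<open>cb\<close> at the
  two factors are independent, since \<open>f p\<close> and \<open>h p\<close> need not lie in a
  common chart domain.\<close>

lemma
  assumes f: "smooth_map M M f" and h: "smooth_map M M h"
  shows smooth_map_mult: "smooth_map M M (\<lambda>y. f y \<otimes> h y)"
    and tangent_map_mult: "\<And>c ca cb c'' p v. c \<in> atlas M \<Longrightarrow> ca \<in> atlas M \<Longrightarrow> cb \<in> atlas M \<Longrightarrow> c'' \<in> atlas M \<Longrightarrow>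
      p \<in> fst c \<Longrightarrow> f p \<in> fst ca \<Longrightarrow> h p \<in> fst cb \<Longrightarrow> f p \<otimes> h p \<in> fst c'' \<Longrightarrow>
      tangent_map (\<lambda>y. f y \<otimes> h y) c c'' p v = frechet_derivative (mult_rep ca cb c'')
        (at (snd ca (f p), snd cb (h p))) (tangent_map f c ca p v, tangent_map h c cb p v)"
proof -
  have local: "\<exists>U. open U \<and> x \<in> U \<and> smooth_on U (loc_rep (\<lambda>y. f y \<otimes> h y) c c'') \<and>
      (loc_rep (\<lambda>y. f y \<otimes> h y) c c'' has_derivative (\<lambda>v. frechet_derivative (mult_rep ca cb c'')
        (at (snd ca (f (cinv c x)), snd cb (h (cinv c x))))
        (tangent_map f c ca (cinv c x) v, tangent_map h c cb (cinv c x) v))) (at x)"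
    if c: "c \<in> atlas M" "ca \<in> atlas M" "cb \<in> atlas M" "c'' \<in> atlas M"
      and x: "x \<in> cimg c" "f (cinv c x) \<in> fst ca" "h (cinv c x) \<in> fst cb"
        "f (cinv c x) \<otimes> h (cinv c x) \<in> fst c''" for c ca cb c'' x
  proof -
    interpret c: manifold_chart M c using man c by unfold_locales
    interpret ca: manifold_chart M ca using man c by unfold_locales
    interpret cb: manifold_chart M cb using man c by unfold_locales
    note fU = smooth_map_loc_rep[OF man man f c(1,2)]
    note hU = smooth_map_loc_rep[OF man man h c(1,3)]
    define U where "U = {x \<in> cimg c. f (cinv c x) \<in> fst ca} \<inter> {x \<in> cimg c. h (cinv c x) \<in> fst cb}"
    have U: "open U" unfolding U_def using fU(2) hU(2) by (rule open_Int)
    have pair: "smooth_on U (\<lambda>x. (loc_rep f c ca x, loc_rep h c cb x))"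
      by (intro smooth_on_Pair U smooth_on_subset[OF fU(1)] smooth_on_subset[OF hU(1)])
        (auto simp: U_def)
    define V where "V = {x \<in> U. (loc_rep f c ca x, loc_rep h c cb x) \<in> mult_dom ca cb c''}"
    have V: "open V" unfolding V_def by (rule open_preimage_smooth[OF U pair open_mult_dom[OF c(2,3,4)]])
    have xV: "x \<in> V"
      using x by (auto simp: V_def U_def mult_dom_def loc_rep_def ca.cinv_snd cb.cinv_snd ca.snd_in cb.snd_in)
    have eq: "mult_rep ca cb c'' (loc_rep f c ca y, loc_rep h c cb y) = loc_rep (\<lambda>y. f y \<otimes> h y) c c'' y"
      if "y \<in> V" for y
      using that by (auto simp: V_def U_def mult_rep_def loc_rep_def ca.cinv_snd cb.cinv_snd)
    have "smooth_on V (\<lambda>x. mult_rep ca cb c'' (loc_rep f c ca x, loc_rep h c cb x))"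
      by (rule smooth_on_compose[OF V open_mult_dom[OF c(2,3,4)] smooth_on_subset[OF pair] smooth_mult_rep[OF c(2,3,4)]])
        (auto simp: V_def)
    then have sm: "smooth_on V (loc_rep (\<lambda>y. f y \<otimes> h y) c c'')"
      by (rule smooth_on_cong[OF V]) (simp add: eq)
    have p: "cinv c x \<in> fst c" "snd c (cinv c x) = x" using x by (auto simp: c.cinv_in c.snd_cinv)
    have in_dom: "(snd ca (f (cinv c x)), snd cb (h (cinv c x))) \<in> mult_dom ca cb c''"
      using x by (auto simp: mult_dom_def ca.cinv_snd cb.cinv_snd ca.snd_in cb.snd_in)
    have "((\<lambda>x. (loc_rep f c ca x, loc_rep h c cb x)) has_derivative
        (\<lambda>v. (tangent_map f c ca (cinv c x) v, tangent_map h c cb (cinv c x) v))) (at x)"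
      using tangent_map_has_derivative[OF man man f c(1,2) p(1) x(2)]
        tangent_map_has_derivative[OF man man h c(1,3) p(1) x(3)]
      by (intro has_derivative_Pair) (simp_all add: p)
    from has_derivative_compose[OF this, of "mult_rep ca cb c''"]
    have "((\<lambda>x. mult_rep ca cb c'' (loc_rep f c ca x, loc_rep h c cb x)) has_derivative
        (\<lambda>v. frechet_derivative (mult_rep ca cb c'')
        (at (snd ca (f (cinv c x)), snd cb (h (cinv c x))))
        (tangent_map f c ca (cinv c x) v, tangent_map h c cb (cinv c x) v))) (at x)"
      using smooth_on_has_derivative[OF smooth_mult_rep[OF c(2,3,4)] in_dom]
      by (simp add: loc_rep_def)
    then have "(loc_rep (\<lambda>y. f y \<otimes> h y) c c'' has_derivative
        (\<lambda>v. frechet_derivative (mult_rep ca cb c'')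
        (at (snd ca (f (cinv c x)), snd cb (h (cinv c x))))
        (tangent_map f c ca (cinv c x) v, tangent_map h c cb (cinv c x) v))) (at x)"
      by (rule has_derivative_transform_within_open[OF _ V xV]) (simp add: eq)
    then show ?thesis using V xV sm by blast
  qed
  show "smooth_map M M (\<lambda>y. f y \<otimes> h y)"
    unfolding smooth_map_def
  proof (intro conjI ballI)
    show "continuous_map (mtop M) (mtop M) (\<lambda>y. f y \<otimes> h y)"
      using f h by (intro continuous_map_mult) (auto simp: smooth_map_def)
    fix c c'' assume c: "c \<in> atlas M" "c'' \<in> atlas M"
    interpret c: manifold_chart M c using man c by unfold_locales
    show "smooth_on (snd c ` {p \<in> fst c. f p \<otimes> h p \<in> fst c''}) (loc_rep (\<lambda>y. f y \<otimes> h y) c c'')"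
      unfolding c.dom_image
    proof (rule smooth_on_local)
      fix x assume x: "x \<in> {x \<in> cimg c. f (cinv c x) \<otimes> h (cinv c x) \<in> fst c''}"
      have "f (cinv c x) \<in> topspace (mtop M)" "h (cinv c x) \<in> topspace (mtop M)"
        using x smooth_map_topspace[OF f] smooth_map_topspace[OF h] by (auto simp: c.cinv_top)
      then obtain ca cb where "ca \<in> atlas M" "f (cinv c x) \<in> fst ca" "cb \<in> atlas M" "h (cinv c x) \<in> fst cb"
        using manifold_chart_obtain[OF man] by metis
      with local[of c ca cb c'' x] c x
      show "\<exists>U. open U \<and> x \<in> U \<and> smooth_on U (loc_rep (\<lambda>y. f y \<otimes> h y) c c'')" by blast
    qed
  qed
  fix c ca cb c'' p v assume c: "c \<in> atlas M" "ca \<in> atlas M" "cb \<in> atlas M" "c'' \<in> atlas M"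
    and p: "p \<in> fst c" "f p \<in> fst ca" "h p \<in> fst cb" "f p \<otimes> h p \<in> fst c''"
  interpret c: manifold_chart M c using man c by unfold_locales
  have "(loc_rep (\<lambda>y. f y \<otimes> h y) c c'' has_derivative (\<lambda>v. frechet_derivative (mult_rep ca cb c'')
        (at (snd ca (f p), snd cb (h p))) (tangent_map f c ca p v, tangent_map h c cb p v))) (at (snd c p))"
    using local[OF c c.snd_in[OF p(1)]] p by (simp add: c.cinv_snd) blast
  then show "tangent_map (\<lambda>y. f y \<otimes> h y) c c'' p v = frechet_derivative (mult_rep ca cb c'')
        (at (snd ca (f p), snd cb (h p))) (tangent_map f c ca p v, tangent_map h c cb p v)"
    unfolding tangent_map_def[of "\<lambda>y. f y \<otimes> h y"] by (simp add: frechet_derivative_eqI)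
qed

lemma smooth_const: "a \<in> carrier G \<Longrightarrow> smooth_map M M (\<lambda>p. a)"
  by (simp add: smooth_map_const man topspace)

lemma smooth_ident: "smooth_map M M (\<lambda>p. p)"
  using smooth_map_id[OF man] by (simp add: id_def)

lemma smooth_left: "a \<in> carrier G \<Longrightarrow> smooth_map M M (\<lambda>p. a \<otimes> p)"
  and smooth_right: "a \<in> carrier G \<Longrightarrow> smooth_map M M (\<lambda>p. p \<otimes> a)"
  by (intro smooth_map_mult smooth_const smooth_ident; assumption)+

lemma tangent_const: "tangent_map (\<lambda>p. a) c c' p v = 0"
  by (simp add: tangent_map_def loc_rep_def comp_def)

lemma tangent_ident: "c \<in> atlas M \<Longrightarrow> p \<in> fst c \<Longrightarrow> tangent_map (\<lambda>p. p) c c p v = v"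
  using tangent_map_id[OF man] by (simp add: id_def)

lemma linear_tangent_map:
  assumes "smooth_manifold M'" "smooth_map M M' F" "c \<in> atlas M" "c' \<in> atlas M'" "p \<in> fst c" "F p \<in> fst c'"
  shows "linear (tangent_map F c c' p)"
  using tangent_map_has_derivative[OF man assms] by (rule has_derivative_linear)

text \<open>Translation by \<open>inv a\<close> provides a left inverse, and an injective linear
  endomorphism in finite dimension is bijective.\<close>

lemma bij_tangent_left:
  assumes a: "a \<in> carrier G" and c: "c \<in> atlas M" "c' \<in> atlas M" and p: "p \<in> fst c" "a \<otimes> p \<in> fst c'"
  shows "bij (tangent_map (\<lambda>q. a \<otimes> q) c c' p)"
proof -
  have pc: "p \<in> carrier G" using chart_carrier c p by blast
  have inv_p: "inv a \<otimes> (a \<otimes> q) = q" if "q \<in> carrier G" for q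
    using that a by (simp add: m_assoc[symmetric])
  have "tangent_map (\<lambda>q. inv a \<otimes> q) c' c (a \<otimes> p) (tangent_map (\<lambda>q. a \<otimes> q) c c' p v) = v" for v
  proof -
    have "tangent_map (\<lambda>q. inv a \<otimes> q) c' c (a \<otimes> p) (tangent_map (\<lambda>q. a \<otimes> q) c c' p v) =
        tangent_map ((\<lambda>q. inv a \<otimes> q) \<circ> (\<lambda>q. a \<otimes> q)) c c p v"
      using a c p pc
      by (subst tangent_map_compose[OF man man man smooth_left smooth_left c(1,2,1)]) (auto simp: inv_p)
    also have "\<dots> = tangent_map id c c p v"
      using c p by (subst tangent_map_cong[OF man man smooth_map_id[OF man] c(1) c(1)]) (auto simp: inv_p topspace)
    finally show ?thesis using tangent_map_id[OF man c(1) p(1)] by simp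
  qed
  then have "inj (tangent_map (\<lambda>q. a \<otimes> q) c c' p)" by (rule inj_on_inverseI)
  moreover have "linear (tangent_map (\<lambda>q. a \<otimes> q) c c' p)"
    by (rule linear_tangent_map[OF man smooth_left[OF a] c p])
  ultimately show ?thesis using linear_injective_imp_surjective by (auto simp: bij_def)
qed

end

lemma frechet_derivative_slice:
  fixes f :: "'e::euclidean_space \<times> 'h::euclidean_space \<Rightarrow> 'f::real_normed_vector"
  assumes "f differentiable at (x, y)"
  shows "((\<lambda>w. f (x, w)) has_derivative (\<lambda>v. frechet_derivative f (at (x, y)) (0, v))) (at y)"
    and "((\<lambda>w. f (w, y)) has_derivative (\<lambda>v. frechet_derivative f (at (x, y)) (v, 0))) (at x)"
proof -
  have "((\<lambda>w. (x, w)) has_derivative (\<lambda>v. (0, v))) (at y)" "((\<lambda>w. (w, y)) has_derivative (\<lambda>v. (v, 0))) (at x)"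
    by (auto intro!: derivative_eq_intros)
  from has_derivative_compose[OF this(1) has_frechet_derivative[OF assms]]
    has_derivative_compose[OF this(2) has_frechet_derivative[OF assms]]
  show "((\<lambda>w. f (x, w)) has_derivative (\<lambda>v. frechet_derivative f (at (x, y)) (0, v))) (at y)"
    and "((\<lambda>w. f (w, y)) has_derivative (\<lambda>v. frechet_derivative f (at (x, y)) (v, 0))) (at x)" .
qed

section \<open>Invariant fields and the bracket in an identity chart\<close>

locale lie_grp_chart = lie_grp G M
  for G :: "('a, 'z) monoid_scheme" (structure) and M :: "('a, 'n::finite) manifold" +
  fixes c1 :: "('a, 'n) chart"
  assumes c1: "c1 \<in> atlas M" and one_c1: "\<one> \<in> fst c1"
begin

sublocale c1: manifold_chart M c1
  using man c1 by unfold_locales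

abbreviation "z0 \<equiv> snd c1 \<one>"
abbreviation "mm \<equiv> mult_rep c1 c1 c1"
abbreviation "W \<equiv> mult_dom c1 c1 c1"

lemma z0: "z0 \<in> cimg c1" and cinv_z0: "cinv c1 z0 = \<one>"
  using one_c1 by (auto simp: c1.snd_in c1.cinv_snd)

lemma cinv_carrier: "z \<in> cimg c1 \<Longrightarrow> cinv c1 z \<in> carrier G"
  using c1.cinv_top topspace by simp

lemma W_left: "z \<in> cimg c1 \<Longrightarrow> (z, z0) \<in> W" and W_right: "z \<in> cimg c1 \<Longrightarrow> (z0, z) \<in> W"
  by (auto simp: mult_dom_def z0 cinv_z0 cinv_carrier c1.cinv_in)

lemmas smooth_mm = smooth_mult_rep[OF c1 c1 c1] and open_W = open_mult_dom[OF c1 c1 c1]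

text \<open>The left-invariant field with value \<open>v\<close> at the identity: the second factor
  of the multiplication is differentiated there in direction \<open>v\<close>.\<close>

definition E :: "real^'n \<Rightarrow> real^'n \<Rightarrow> real^'n" where
  "E v z = frechet_derivative mm (at (z, z0)) (0, v)"

text \<open>The right-invariant counterpart of \<open>E\<close>, obtained from the first
  factor.\<close>

definition R :: "real^'n \<Rightarrow> real^'n \<Rightarrow> real^'n" where
  "R v z = frechet_derivative mm (at (z0, z)) (v, 0)"

lemma smooth_E: "smooth_on (cimg c1) (E v)"
  unfolding E_def
  by (rule smooth_on_compose[OF c1.open_cimg open_W _ smooth_on_derivative[OF smooth_mm], of "\<lambda>z. (z, z0)"])
    (auto intro: smooth_on_Pair smooth_on_ident smooth_on_const c1.open_cimg W_left)

lemma smooth_R: "smooth_on (cimg c1) (R v)"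
  unfolding R_def
  by (rule smooth_on_compose[OF c1.open_cimg open_W _ smooth_on_derivative[OF smooth_mm], of "\<lambda>z. (z0, z)"])
    (auto intro: smooth_on_Pair smooth_on_ident smooth_on_const c1.open_cimg W_right)

lemma linear_E: "z \<in> cimg c1 \<Longrightarrow> linear (\<lambda>v. E v z)"
  unfolding E_def using linear_compose[of "\<lambda>v. (0, v)", OF _ smooth_on_linear_derivative[OF smooth_mm W_left]]
  by (simp add: o_def linear_iff)

lemma linear_R: "z \<in> cimg c1 \<Longrightarrow> linear (\<lambda>v. R v z)"
  unfolding R_def using linear_compose[of "\<lambda>v. (v, 0)", OF _ smooth_on_linear_derivative[OF smooth_mm W_right]]
  by (simp add: o_def linear_iff)

lemma tangent_left: "a \<in> fst c1 \<Longrightarrow> tangent_map (\<lambda>q. a \<otimes> q) c1 c1 \<one> v = E v (snd c1 a)"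
  using tangent_map_mult[OF smooth_const smooth_ident c1 c1 c1 c1, of a \<one> v] chart_carrier[OF c1] one_c1
  by (simp add: tangent_const tangent_ident[OF c1] E_def)

lemma tangent_right: "a \<in> fst c1 \<Longrightarrow> tangent_map (\<lambda>q. q \<otimes> a) c1 c1 \<one> v = R v (snd c1 a)"
  using tangent_map_mult[OF smooth_ident smooth_const c1 c1 c1 c1, of a \<one> v] chart_carrier[OF c1] one_c1
  by (simp add: tangent_const tangent_ident[OF c1] R_def)

lemma E_z0: "E v z0 = v"
proof -
  have "tangent_map (\<lambda>q. \<one> \<otimes> q) c1 c1 \<one> v = tangent_map (\<lambda>q. q) c1 c1 \<one> v"
    by (subst tangent_map_cong[OF man man smooth_ident c1 c1]) (auto simp: one_c1 topspace)
  then show ?thesis by (simp add: tangent_left one_c1 tangent_ident c1)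
qed

lemma R_z0: "R v z0 = v"
proof -
  have "tangent_map (\<lambda>q. q \<otimes> \<one>) c1 c1 \<one> v = tangent_map (\<lambda>q. q) c1 c1 \<one> v"
    by (subst tangent_map_cong[OF man man smooth_ident c1 c1]) (auto simp: one_c1 topspace)
  then show ?thesis by (simp add: tangent_right one_c1 tangent_ident c1)
qed

lemma mm_derivative_z0: "frechet_derivative mm (at (z0, z0)) (u, v) = u + v"
proof -
  have "frechet_derivative mm (at (z0, z0)) ((u, 0) + (0, v)) = R u z0 + E v z0"
    unfolding E_def R_def using smooth_on_linear_derivative[OF smooth_mm W_left[OF z0]] by (rule linear_add)
  then show ?thesis by (simp add: E_z0 R_z0)
qed

definition br :: "real^'n \<Rightarrow> real^'n \<Rightarrow> real^'n" where
  "br u v = lie_bracket (E u) (E v) z0"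

text \<open>The mixed second derivative of the multiplication at the identity, with \<open>u\<close>
  in the left and \<open>v\<close> in the right factor. Antisymmetrising it gives the
  bracket.\<close>

definition \<beta> :: "real^'n \<Rightarrow> real^'n \<Rightarrow> real^'n" where
  "\<beta> u v = frechet_derivative (E v) (at z0) u"

lemma E_differentiable: "E v differentiable at z0"
  using smooth_on_differentiable[OF smooth_E z0] .

lemma E_has_derivative: "(E v has_derivative (\<lambda>u. \<beta> u v)) (at z0)"
  unfolding \<beta>_def by (rule has_frechet_derivative[OF E_differentiable])

lemma br_eq: "br u v = \<beta> u v - \<beta> v u"
  by (simp add: br_def lie_bracket_def \<beta>_def E_z0)

lemma bilinear_\<beta>: "bilinear \<beta>"
proof -
  have "\<beta> u (v + w) = \<beta> u v + \<beta> u w" for u v w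
  proof -
    have "((\<lambda>z. E v z + E w z) has_derivative (\<lambda>u. \<beta> u v + \<beta> u w)) (at z0)"
      by (intro has_derivative_add E_has_derivative)
    then have "(E (v + w) has_derivative (\<lambda>u. \<beta> u v + \<beta> u w)) (at z0)"
      by (rule has_derivative_transform_within_open[OF _ c1.open_cimg z0]) (simp add: linear_add[OF linear_E])
    then show ?thesis by (simp add: \<beta>_def[of _ "v + w"] frechet_derivative_eqI)
  qed
  moreover have "\<beta> u (r *\<^sub>R v) = r *\<^sub>R \<beta> u v" for u v r
  proof -
    have "((\<lambda>z. r *\<^sub>R E v z) has_derivative (\<lambda>u. r *\<^sub>R \<beta> u v)) (at z0)"
      by (intro has_derivative_scaleR_right E_has_derivative)
    then have "(E (r *\<^sub>R v) has_derivative (\<lambda>u. r *\<^sub>R \<beta> u v)) (at z0)"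
      by (rule has_derivative_transform_within_open[OF _ c1.open_cimg z0]) (simp add: linear_scale[OF linear_E])
    then show ?thesis by (simp add: \<beta>_def[of _ "r *\<^sub>R v"] frechet_derivative_eqI)
  qed
  ultimately have "linear (\<beta> u)" for u by (intro linearI)
  moreover have "linear (\<lambda>u. \<beta> u v)" for v
    using has_derivative_linear[OF E_has_derivative] .
  ultimately show ?thesis by (simp add: bilinear_def)
qed

lemma bilinear_br: "bilinear br"
  using bilinear_\<beta> unfolding br_eq[abs_def] bilinear_def by (auto intro: linear_compose_sub)

lemma br_skew: "br u v = - br v u"
  by (simp add: br_eq)

section \<open>The adjoint representation and nilpotency of the bracket\<close>

definition Ad :: "'a \<Rightarrow> real^'n \<Rightarrow> real^'n" where
  "Ad x = tangent_map (\<lambda>y. x \<otimes> y \<otimes> inv x) c1 c1 \<one>"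

lemma smooth_conj: "x \<in> carrier G \<Longrightarrow> smooth_map M M (\<lambda>y. x \<otimes> y \<otimes> inv x)"
  by (rule smooth_map_mult[OF smooth_left smooth_const]) simp_all

definition comm :: "'a \<Rightarrow> 'a \<Rightarrow> 'a" where
  "comm x y = x \<otimes> y \<otimes> inv x \<otimes> inv y"

lemma comm_one: "x \<in> carrier G \<Longrightarrow> comm x \<one> = \<one>"
  by (simp add: comm_def)

lemma smooth_comm: "x \<in> carrier G \<Longrightarrow> smooth_map M M (comm x)"
  unfolding comm_def by (intro smooth_map_mult[OF smooth_conj smooth_inv])

lemma tangent_inv: "tangent_map (\<lambda>y. inv y) c1 c1 \<one> v = - v"
proof -
  have "tangent_map (\<lambda>y. y \<otimes> inv y) c1 c1 \<one> v = v + tangent_map (\<lambda>y. inv y) c1 c1 \<one> v"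
    using tangent_map_mult[OF smooth_ident smooth_inv c1 c1 c1 c1, of \<one> v] one_c1
    by (simp add: mm_derivative_z0 tangent_ident[OF c1])
  moreover have "tangent_map (\<lambda>y. y \<otimes> inv y) c1 c1 \<one> v = tangent_map (\<lambda>y. \<one>) c1 c1 \<one> v"
    by (subst tangent_map_cong[OF man man smooth_const c1 c1]) (auto simp: one_c1 topspace)
  ultimately show ?thesis by (simp add: tangent_const eq_neg_iff_add_eq_0 add.commute)
qed

lemma tangent_comm: "x \<in> carrier G \<Longrightarrow> tangent_map (comm x) c1 c1 \<one> v = Ad x v - v"
  unfolding comm_def Ad_def
  using tangent_map_mult[OF smooth_conj smooth_inv c1 c1 c1 c1, of x \<one> v] one_c1
  by (simp add: mm_derivative_z0 tangent_inv)

text \<open>The map \<open>comm x\<close> fixes the identity and has derivative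
  \<open>Ad x - 1\<close> there, so the chain rule stays at one point.\<close>

lemma comms:
  assumes "set xs \<subseteq> carrier G"
  shows "smooth_map M M (foldr comm xs)" and "foldr comm xs \<one> = \<one>"
    and "tangent_map (foldr comm xs) c1 c1 \<one> v = foldr (\<lambda>x w. Ad x w - w) xs v"
proof -
  have "smooth_map M M (foldr comm xs) \<and> foldr comm xs \<one> = \<one> \<and>
      (\<forall>v. tangent_map (foldr comm xs) c1 c1 \<one> v = foldr (\<lambda>x w. Ad x w - w) xs v)"
    using assms
  proof (induction xs)
    case Nil
    then show ?case using smooth_map_id[OF man] tangent_map_id[OF man c1 one_c1] by (simp add: id_def)
  next
    case (Cons x xs)
    then have x: "x \<in> carrier G" and IH: "smooth_map M M (foldr comm xs)" "foldr comm xs \<one> = \<one>"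
      "\<And>v. tangent_map (foldr comm xs) c1 c1 \<one> v = foldr (\<lambda>x w. Ad x w - w) xs v" by auto
    have "tangent_map (comm x \<circ> foldr comm xs) c1 c1 \<one> v = foldr (\<lambda>x w. Ad x w - w) (x # xs) v" for v
      by (subst tangent_map_compose[OF man man man IH(1) smooth_comm[OF x] c1 c1 c1])
        (simp_all add: IH one_c1 comm_one x tangent_comm)
    moreover have "smooth_map M M (comm x \<circ> foldr comm xs)"
      by (rule smooth_map_compose[OF man man man IH(1) smooth_comm[OF x]])
    ultimately show ?case
      by (simp add: o_def IH comm_one x)
  qed
  then show "smooth_map M M (foldr comm xs)" and "foldr comm xs \<one> = \<one>"
    and "tangent_map (foldr comm xs) c1 c1 \<one> v = foldr (\<lambda>x w. Ad x w - w) xs v" by auto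
qed

lemma comms_lower_central:
  "set xs \<subseteq> carrier G \<Longrightarrow> y \<in> carrier G \<Longrightarrow> foldr comm xs y \<in> lower_central G (length xs)"
  by (induction xs) (auto simp: comm_def intro!: generate.incl)

text \<open>A chain of \<open>k\<close> commutators lands in the trivial term of the lower central
  series; the map is constant and its derivative zero.\<close>

lemma Ad_nilpotent:
  assumes "lower_central G k = {\<one>}" "set xs \<subseteq> carrier G" "length xs = k"
  shows "foldr (\<lambda>x w. Ad x w - w) xs v = 0"
proof -
  have "foldr comm xs y = \<one>" if "y \<in> carrier G" for y
    using comms_lower_central[OF assms(2) that] assms by simp
  then have "tangent_map (foldr comm xs) c1 c1 \<one> v = tangent_map (\<lambda>y. \<one>) c1 c1 \<one> v"
    by (subst tangent_map_cong[OF man man smooth_const c1 c1]) (auto simp: one_c1 topspace)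
  then show ?thesis using comms(3)[OF assms(2)] by (simp add: tangent_const)
qed

text \<open>Linearity is inherited from the derivative of the iterated commutator map.\<close>

lemma linear_Ad_minus:
  assumes "set xs \<subseteq> carrier G"
  shows "linear (foldr (\<lambda>x w. Ad x w - w) xs)"
proof -
  have "linear (tangent_map (foldr comm xs) c1 c1 \<one>)"
    using linear_tangent_map[OF man comms(1)[OF assms] c1 c1 one_c1] comms(2)[OF assms] one_c1 by simp
  moreover have "tangent_map (foldr comm xs) c1 c1 \<one> = foldr (\<lambda>x w. Ad x w - w) xs"
    using comms(3)[OF assms] by blast
  ultimately show ?thesis by simp
qed

definition conj_rep :: "(real^'n) \<times> (real^'n) \<Rightarrow> real^'n" where
  "conj_rep = (\<lambda>(z, w). snd c1 (cinv c1 z \<otimes> cinv c1 w \<otimes> inv (cinv c1 z)))"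

text \<open>\<open>Ad\<close> is a partial derivative of conjugation, a smooth function of two
  variables. The chart expression makes sense only while the inverse and both products stay in the
  chart domain; \<open>W'\<close> and \<open>Q\<close> record these open conditions, hence the
  neighbourhood \<open>U\<close>.\<close>

lemma conj_rep_smooth:
  obtains U where "open U" "z0 \<in> U" "U \<subseteq> cimg c1" "\<And>v. smooth_on U (\<lambda>z. Ad (cinv c1 z) v)"
proof -
  define D where "D = {z \<in> cimg c1. inv (cinv c1 z) \<in> fst c1}"
  note iD = smooth_map_loc_rep[OF man man smooth_inv c1 c1, folded D_def]
  define W' where "W' = {q \<in> W. fst q \<in> D}"
  have fst_smooth: "smooth_on W fst"
    by (simp add: smooth_on_def Ck_on_bounded_linear bounded_linear_fst)
  have W': "open W'" unfolding W'_def by (rule open_preimage_smooth[OF open_W fst_smooth iD(2)])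
  have pair: "smooth_on W' (\<lambda>q. (mm q, loc_rep (\<lambda>y. inv y) c1 c1 (fst q)))"
    by (intro smooth_on_Pair W' smooth_on_subset[OF smooth_mm]
        smooth_on_compose[OF W' iD(2) smooth_on_subset[OF fst_smooth] iD(1)]) (auto simp: W'_def)
  define Q where "Q = {q \<in> W'. (mm q, loc_rep (\<lambda>y. inv y) c1 c1 (fst q)) \<in> W}"
  have Q: "open Q" unfolding Q_def by (rule open_preimage_smooth[OF W' pair open_W])
  have "smooth_on Q (\<lambda>q. mm (mm q, loc_rep (\<lambda>y. inv y) c1 c1 (fst q)))"
    by (rule smooth_on_compose[OF Q open_W smooth_on_subset[OF pair] smooth_mm]) (auto simp: Q_def)
  then have conj: "smooth_on Q conj_rep"
    by (rule smooth_on_cong[OF Q])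
      (auto simp: Q_def W'_def D_def mult_rep_def conj_rep_def loc_rep_def c1.cinv_snd mult_dom_def)
  define U where "U = {z \<in> cimg c1. (z, z0) \<in> Q}"
  have slice: "smooth_on (cimg c1) (\<lambda>z. (z, z0))"
    by (intro smooth_on_Pair smooth_on_ident smooth_on_const c1.open_cimg)
  have U: "open U" unfolding U_def by (rule open_preimage_smooth[OF c1.open_cimg slice Q])
  have "z0 \<in> U"
    by (simp add: U_def z0 Q_def W'_def D_def W_left cinv_z0 one_c1 mult_rep_def loc_rep_def)
  moreover have "smooth_on U (\<lambda>z. Ad (cinv c1 z) v)" for v
  proof (rule smooth_on_cong[OF U])
    show "smooth_on U (\<lambda>z. frechet_derivative conj_rep (at (z, z0)) (0, v))"
      by (rule smooth_on_compose[OF U Q smooth_on_subset[OF slice] smooth_on_derivative[OF conj]])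
        (auto simp: U_def)
    fix z assume z: "z \<in> U"
    have "loc_rep (\<lambda>y. cinv c1 z \<otimes> y \<otimes> inv (cinv c1 z)) c1 c1 = (\<lambda>w. conj_rep (z, w))"
      by (auto simp: loc_rep_def conj_rep_def)
    then show "frechet_derivative conj_rep (at (z, z0)) (0, v) = Ad (cinv c1 z) v"
      using z frechet_derivative_slice(1)[OF smooth_on_differentiable[OF conj], of z z0]
      by (simp add: Ad_def tangent_map_def U_def frechet_derivative_eqI)
  qed
  ultimately show ?thesis using U that[of U] by (auto simp: U_def)
qed

text \<open>Differentiate the identity (a y a^-1) a = a y at y = 1.\<close>

lemma R_Ad: "z \<in> cimg c1 \<Longrightarrow> R (Ad (cinv c1 z) v) z = E v z"
proof -
  assume z: "z \<in> cimg c1"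
  let ?a = "cinv c1 z"
  have a: "?a \<in> carrier G" "?a \<in> fst c1" using z by (auto simp: cinv_carrier c1.cinv_in)
  have "tangent_map ((\<lambda>q. q \<otimes> ?a) \<circ> (\<lambda>y. ?a \<otimes> y \<otimes> inv ?a)) c1 c1 \<one> v = R (Ad ?a v) z"
    using a by (subst tangent_map_compose[OF man man man smooth_conj smooth_right c1 c1 c1])
      (auto simp: one_c1 tangent_right Ad_def c1.snd_cinv z)
  moreover have "?a \<otimes> y \<otimes> inv ?a \<otimes> ?a = ?a \<otimes> y" if "y \<in> carrier G" for y
    using that a by (simp add: m_assoc)
  then have "tangent_map ((\<lambda>q. q \<otimes> ?a) \<circ> (\<lambda>y. ?a \<otimes> y \<otimes> inv ?a)) c1 c1 \<one> v = tangent_map (\<lambda>q. ?a \<otimes> q) c1 c1 \<one> v"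
    using a by (subst tangent_map_cong[OF man man smooth_left c1 c1]) (auto simp: one_c1 topspace)
  ultimately show ?thesis using a z by (simp add: tangent_left c1.snd_cinv)
qed

lemma Ad_one: "Ad \<one> v = v"
  using R_Ad[OF z0] by (simp add: cinv_z0 R_z0 E_z0)

text \<open>Differentiating \<open>R\<close> and \<open>E\<close> takes the two partial derivatives
  of the multiplication in opposite orders, so symmetry gives \<open>\<beta>\<close> with exchanged
  arguments.\<close>

lemma R_derivative: "frechet_derivative (R v) (at z0) u = \<beta> v u"
proof -
  let ?D = "\<lambda>w q. frechet_derivative mm (at q) w"
  have d: "(\<lambda>q. ?D w q) differentiable at (z0, z0)" for w
    by (rule smooth_on_differentiable[OF smooth_on_derivative[OF smooth_mm] W_left[OF z0]])
  have "frechet_derivative (R v) (at z0) u = frechet_derivative (?D (v, 0)) (at (z0, z0)) (0, u)"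
    unfolding R_def[abs_def] by (simp add: frechet_derivative_eqI[OF frechet_derivative_slice(1)[OF d]])
  also have "\<dots> = frechet_derivative (?D (0, u)) (at (z0, z0)) (v, 0)"
    by (rule smooth_on_symmetric_derivative[OF open_W W_left[OF z0] smooth_mm])
  also have "\<dots> = \<beta> v u"
    unfolding \<beta>_def E_def[abs_def] by (simp add: frechet_derivative_eqI[OF frechet_derivative_slice(2)[OF d]])
  finally show ?thesis .
qed

text \<open>The derivative of \<open>R_Ad\<close> at the identity reads
  \<open>\<beta> u v = \<beta> v u + D\<close>, with \<open>D\<close> the derivative of
  \<open>Ad\<close> along \<open>u\<close>; hence \<open>D\<close> is the bracket.\<close>

lemma Ad_has_derivative: "((\<lambda>z. Ad (cinv c1 z) v) has_derivative (\<lambda>u. br u v)) (at z0)"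
proof -
  obtain U where U: "open U" "z0 \<in> U" "U \<subseteq> cimg c1" "\<And>v. smooth_on U (\<lambda>z. Ad (cinv c1 z) v)"
    using conj_rep_smooth by blast
  let ?A = "\<lambda>z. Ad (cinv c1 z) v"
  have A: "(?A has_derivative frechet_derivative ?A (at z0)) (at z0)"
    by (rule smooth_on_has_derivative[OF U(4,2)])
  have "((\<lambda>z. R (?A z) z) has_derivative
      (\<lambda>h. frechet_derivative (R (?A z0)) (at z0) h + R (frechet_derivative ?A (at z0) h) z0)) (at z0)"
    by (rule has_derivative_linear_family[where B = "\<lambda>z w. R w z" and f = ?A, OF c1.open_cimg z0 linear_R _ A])
      (auto intro: smooth_on_differentiable[OF smooth_R z0])
  then have "(E v has_derivative
      (\<lambda>h. frechet_derivative (R (?A z0)) (at z0) h + R (frechet_derivative ?A (at z0) h) z0)) (at z0)"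
    by (rule has_derivative_transform_within_open[OF _ c1.open_cimg z0]) (simp add: R_Ad)
  from has_derivative_unique[OF this E_has_derivative]
  have "\<beta> h v = \<beta> v h + frechet_derivative ?A (at z0) h" for h
    by (simp add: cinv_z0 Ad_one R_z0 R_derivative fun_eq_iff)
  then have "frechet_derivative ?A (at z0) = (\<lambda>h. br h v)"
    by (auto simp: br_eq)
  with A show ?thesis by simp
qed

text \<open>Replacing the factors \<open>Ad x - 1\<close> one after the other, from the right, by their derivatives
  \<open>ad u\<close> at the identity.\<close>

lemma br_nilpotent:
  assumes "lower_central G k = {\<one>}" "length us = k"
  shows "foldr br us v = 0"
proof -
  have "foldr (\<lambda>x w. Ad x w - w) xs (foldr br us v) = 0"
    if "set xs \<subseteq> carrier G" "length xs + length us = k" for xs us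
    using that
  proof (induction us arbitrary: xs)
    case Nil
    then show ?case using Ad_nilpotent[OF assms(1)] by simp
  next
    case (Cons u us)
    define w where "w = foldr br us v"
    define T where "T = foldr (\<lambda>x w. Ad x w - w) xs"
    have T: "bounded_linear T"
      using linear_Ad_minus[OF Cons.prems(1)] by (simp add: T_def linear_conv_bounded_linear)
    \<comment> \<open>The induction hypothesis for \<open>xs\<close> lengthened by a variable group
      element. It holds on all of the open set \<open>cimg c1\<close>, so it can be differentiated
      at \<open>z0\<close>, and the fixed linear map \<open>T\<close> commutes with that.\<close>
    have zero: "T (Ad (cinv c1 z) w - w) = 0" if "z \<in> cimg c1" for z
      using Cons.IH[of "xs @ [cinv c1 z]"] Cons.prems that by (simp add: T_def w_def cinv_carrier)
    have "((\<lambda>z. Ad (cinv c1 z) w - w) has_derivative (\<lambda>u. br u w)) (at z0)"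
      using has_derivative_diff[OF Ad_has_derivative has_derivative_const] by simp
    from bounded_linear.has_derivative[OF T this]
    have "((\<lambda>z. T (Ad (cinv c1 z) w - w)) has_derivative (\<lambda>u. T (br u w))) (at z0)" .
    then have "((\<lambda>z. 0) has_derivative (\<lambda>u. T (br u w))) (at z0)"
      by (rule has_derivative_transform_within_open[OF _ c1.open_cimg z0]) (simp add: zero)
    then have "(\<lambda>u. T (br u w)) = (\<lambda>u. 0)"
      using has_derivative_unique[OF _ has_derivative_const] by blast
    then show ?case by (simp add: T_def w_def fun_eq_iff)
  qed
  from this[of "[]" us] show ?thesis using assms(2) by simp
qed

end

section \<open>Left-invariant HKT structures\<close>

lemma lie_bracket_cong:
  assumes "open S" "x \<in> S" "\<And>y. y \<in> S \<Longrightarrow> X y = X' y" "\<And>y. y \<in> S \<Longrightarrow> Y y = Y' y"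
    "X' differentiable at x" "Y' differentiable at x"
  shows "lie_bracket X Y x = lie_bracket X' Y' x"
  using frechet_derivative_transform_within_open[OF assms(5,1,2), of X]
    frechet_derivative_transform_within_open[OF assms(6,1,2), of Y] assms(2-4)
  by (simp add: lie_bracket_def)

locale hkt_group = lie_grp_chart G M c1
  for G :: "('a, 'z) monoid_scheme" (structure) and M :: "('a, 'n::finite) manifold"
    and c1 :: "('a, 'n) chart" +
  fixes I J K :: "('a, 'n) endo" and g :: "('a, 'n) cov2" and k :: nat
  assumes hypercomplex: "hypercomplex M I J K" and HKT: "HKT_metric M I J K g"
    and left_invariant: "left_invariant_endo G M I" "left_invariant_endo G M J" "left_invariant_endo G M K"
      "left_invariant_metric G M g"
    and nilpotent: "lower_central G k = {\<one>}"
begin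

text \<open>Translation from the identity to \<open>cinv c1 z\<close> carries \<open>v\<close> to
  \<open>E v z\<close>, so invariant tensors have constant components in the frame
  \<open>E\<close>.\<close>

lemma endo_E:
  assumes "left_invariant_endo G M L" "z \<in> cimg c1"
  shows "L c1 z (E v z) = E (L c1 z0 v) z"
proof -
  let ?a = "cinv c1 z"
  have a: "?a \<in> carrier G" "?a \<in> fst c1" using assms(2) by (auto simp: cinv_carrier c1.cinv_in)
  have "related_endo M M (\<lambda>x. ?a \<otimes> x) L L"
    using assms(1) a by (simp add: left_invariant_endo_def)
  from this[unfolded related_endo_def, rule_format, OF c1 c1 one_c1, of v] a
  show ?thesis by (simp add: tangent_left c1.snd_cinv assms(2))
qed

lemma metric_E:
  assumes "z \<in> cimg c1"
  shows "g c1 z (E u z) (E v z) = g c1 z0 u v"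
proof -
  let ?a = "cinv c1 z"
  have a: "?a \<in> carrier G" "?a \<in> fst c1" using assms by (auto simp: cinv_carrier c1.cinv_in)
  have "related_cov2 M M (\<lambda>x. ?a \<otimes> x) g g"
    using left_invariant(4) a by (simp add: left_invariant_metric_def)
  from this[unfolded related_cov2_def, rule_format, OF c1 c1 one_c1, of u v] a
  show ?thesis by (simp add: tangent_left c1.snd_cinv assms)
qed

lemma complex: "complex_structure M I" "complex_structure M J" "complex_structure M K"
  using hypercomplex by (auto simp: hypercomplex_def)

lemma metric: "riemannian_metric M g"
  using HKT by (auto simp: HKT_metric_def quaternionic_hermitian_def hermitian_def)

lemma bilinear_g: "z \<in> cimg c1 \<Longrightarrow> bilinear (g c1 z)"
  and smooth_g: "smooth_on (cimg c1) (\<lambda>z. g c1 z u v)"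
  using metric c1 by (auto simp: riemannian_metric_def)

lemma linear_endo: "complex_structure M L \<Longrightarrow> z \<in> cimg c1 \<Longrightarrow> linear (L c1 z)"
  and smooth_endo: "complex_structure M L \<Longrightarrow> smooth_on (cimg c1) (\<lambda>z. L c1 z v)"
  using c1 by (auto simp: complex_structure_def endo_field_def)

text \<open>The Nijenhuis tensor is evaluated on left-invariant fields, which \<open>L\<close> maps
  to left-invariant fields by \<open>endo_E\<close>.\<close>

lemma br_integrable:
  assumes "complex_structure M L" "left_invariant_endo G M L"
  shows "br (L c1 z0 u) (L c1 z0 v) = br u v + L c1 z0 (br (L c1 z0 u) v) + L c1 z0 (br u (L c1 z0 v))"
proof -
  have "lie_bracket (\<lambda>y. L c1 y (E u y)) (\<lambda>y. L c1 y (E v y)) z0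
           - L c1 z0 (lie_bracket (\<lambda>y. L c1 y (E u y)) (E v) z0)
           - L c1 z0 (lie_bracket (E u) (\<lambda>y. L c1 y (E v y)) z0)
           - lie_bracket (E u) (E v) z0 = 0"
    using assms(1) c1 z0 smooth_E unfolding complex_structure_def by blast
  moreover have "lie_bracket (\<lambda>y. L c1 y (E u y)) (\<lambda>y. L c1 y (E v y)) z0 = br (L c1 z0 u) (L c1 z0 v)"
    "lie_bracket (\<lambda>y. L c1 y (E u y)) (E v) z0 = br (L c1 z0 u) v"
    "lie_bracket (E u) (\<lambda>y. L c1 y (E v y)) z0 = br u (L c1 z0 v)"
    unfolding br_def
    by (rule lie_bracket_cong[OF c1.open_cimg z0]; simp add: endo_E assms E_differentiable)+
  ultimately show ?thesis by (simp add: br_def algebra_simps)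
qed

text \<open>The form evaluated on \<open>E v\<close> and \<open>E w\<close> is constant on the
  chart. Thus the derivative of its coordinate components is minus the contribution of the moving
  fields, which \<open>\<beta>\<close> describes.\<close>

lemma form_derivative:
  assumes L: "complex_structure M L" "left_invariant_endo G M L"
  shows "((\<lambda>y. fundamental_form g L c1 y v w) has_derivative
    (\<lambda>u. - g c1 z0 (\<beta> u v) (L c1 z0 w) - g c1 z0 v (L c1 z0 (\<beta> u w)))) (at z0)"
proof -
  let ?w = "fundamental_form g L c1"
  have lin_g: "linear (g c1 y a)" "linear (\<lambda>a. g c1 y a b)" if "y \<in> cimg c1" for y a b
    using bilinear_g[OF that] by (auto simp: bilinear_def)
  have lin_right: "linear (?w y a)" if "y \<in> cimg c1" for y a
    using linear_compose[OF linear_endo[OF L(1) that] lin_g(1)[OF that, of a]]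
    by (simp add: fundamental_form_def[abs_def] o_def)
  have lin_left: "linear (\<lambda>a. ?w y a b)" if "y \<in> cimg c1" for y b
    using lin_g(2)[OF that] by (simp add: fundamental_form_def)
  have d: "(\<lambda>y. ?w y a b) differentiable at z0" for a b
    unfolding fundamental_form_def differentiable_def
    using has_derivative_linear_family[OF c1.open_cimg z0 lin_g(1)
        smooth_on_differentiable[OF smooth_g z0] smooth_on_has_derivative[OF smooth_endo[OF L(1)] z0]]
    by blast
  have 1: "((\<lambda>y. ?w y a (E w y)) has_derivative
      (\<lambda>h. frechet_derivative (\<lambda>y. ?w y a w) (at z0) h + ?w z0 a (\<beta> h w))) (at z0)" for a
    using has_derivative_linear_family[where B = "\<lambda>y. ?w y a", OF c1.open_cimg z0 lin_right d E_has_derivative]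
    by (simp add: E_z0)
  then have "(\<lambda>y. ?w y a (E w y)) differentiable at z0" for a
    unfolding differentiable_def by blast
  from has_derivative_linear_family[where B = "\<lambda>y a. ?w y a (E w y)", OF c1.open_cimg z0 lin_left this E_has_derivative]
  have "((\<lambda>y. ?w y (E v y) (E w y)) has_derivative
      (\<lambda>h. frechet_derivative (\<lambda>y. ?w y v w) (at z0) h + ?w z0 v (\<beta> h w) + ?w z0 (\<beta> h v) w)) (at z0)"
    by (simp add: E_z0 frechet_derivative_eqI[OF 1])
  moreover have "((\<lambda>y. ?w y (E v y) (E w y)) has_derivative (\<lambda>h. 0)) (at z0)"
    by (rule has_derivative_transform_within_open[OF has_derivative_const[of "g c1 z0 v (L c1 z0 w)"] c1.open_cimg z0])
      (simp add: fundamental_form_def endo_E[OF L(2)] metric_E)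
  ultimately have "(\<lambda>h. frechet_derivative (\<lambda>y. ?w y v w) (at z0) h + ?w z0 v (\<beta> h w) + ?w z0 (\<beta> h v) w) = (\<lambda>h. 0)"
    by (rule has_derivative_unique)
  then have "frechet_derivative (\<lambda>y. ?w y v w) (at z0) =
      (\<lambda>u. - g c1 z0 (\<beta> u v) (L c1 z0 w) - g c1 z0 v (L c1 z0 (\<beta> u w)))"
    by (auto simp: fun_eq_iff fundamental_form_def algebra_simps) (smt (verit))
  then show ?thesis using has_frechet_derivative[OF d[of v w]] by simp
qed

sublocale alg: lie_hkt "g c1 z0" br "I c1 z0" "J c1 z0" "K c1 z0" k
proof (intro lie_hkt.intro inner_form.intro lie_hkt_axioms.intro)
  show "bilinear (g c1 z0)" "bilinear br" by (rule bilinear_g[OF z0] bilinear_br)+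
  show "g c1 z0 u v = g c1 z0 v u" for u v
    using metric c1 z0 by (auto simp: riemannian_metric_def)
  show "0 < g c1 z0 v v" if "v \<noteq> 0" for v
    using metric c1 z0 that by (auto simp: riemannian_metric_def)
  show "br u v = - br v u" for u v by (rule br_skew)
  show "foldr br us v = 0" if "length us = k" for us v
    by (rule br_nilpotent[OF nilpotent that])
  show "linear (I c1 z0)" "linear (J c1 z0)" "linear (K c1 z0)"
    using complex linear_endo z0 by auto
  show "I c1 z0 (I c1 z0 v) = - v" "J c1 z0 (J c1 z0 v) = - v" "K c1 z0 (K c1 z0 v) = - v" for v
    using complex c1 z0 by (auto simp: complex_structure_def)
  show "I c1 z0 (J c1 z0 v) = K c1 z0 v" for v
    using hypercomplex c1 z0 by (auto simp: hypercomplex_def)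
  have "- J c1 z0 (I c1 z0 v) = K c1 z0 v" for v
    using hypercomplex c1 z0 by (auto simp: hypercomplex_def)
  then show "J c1 z0 (I c1 z0 v) = - K c1 z0 v" for v by (metis minus_minus)
  show "g c1 z0 (I c1 z0 u) (I c1 z0 v) = g c1 z0 u v" "g c1 z0 (J c1 z0 u) (J c1 z0 v) = g c1 z0 u v"
    "g c1 z0 (K c1 z0 u) (K c1 z0 v) = g c1 z0 u v" for u v
    using HKT c1 z0 by (auto simp: HKT_metric_def quaternionic_hermitian_def hermitian_def)
  show "br (I c1 z0 u) (I c1 z0 v) = br u v + I c1 z0 (br (I c1 z0 u) v) + I c1 z0 (br u (I c1 z0 v))"
    "br (J c1 z0 u) (J c1 z0 v) = br u v + J c1 z0 (br (J c1 z0 u) v) + J c1 z0 (br u (J c1 z0 v))" for u v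
    using br_integrable complex left_invariant by blast+
qed

text \<open>The alternating sum antisymmetrises \<open>\<beta>\<close> into the bracket, leaving the
  Chevalley-Eilenberg differential of each fundamental form.\<close>

lemma ext_d2_Omega: "ext_d2 (Omega g J K c1) z0 u v w = alg.dOmega u v w"
proof -
  let ?d = "\<lambda>L u v w. - g c1 z0 (\<beta> u v) (L c1 z0 w) - g c1 z0 v (L c1 z0 (\<beta> u w))"
  have "((\<lambda>y. Omega g J K c1 y v w) has_derivative
      (\<lambda>u. of_real (?d J u v w) + \<i> * of_real (?d K u v w))) (at z0)" for v w
    unfolding Omega_def
    by (intro has_derivative_add has_derivative_mult_right has_derivative_of_real
        form_derivative complex left_invariant)
  note der = frechet_derivative_eqI[OF this]
  have skew: "g c1 z0 a (L b) = - g c1 z0 b (L a)"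
    if "\<And>u v. g c1 z0 (L u) (L v) = g c1 z0 u v" "\<And>v. L (L v) = - v" for L a b
    using alg.g_skew[of L a b, OF that] alg.sym[of "L a" b] by simp
  have real: "?d L u v w - ?d L v u w + ?d L w u v = alg.dform (L c1 z0) u v w"
    if "linear (L c1 z0)" "\<And>u v. g c1 z0 (L c1 z0 u) (L c1 z0 v) = g c1 z0 u v" "\<And>v. L c1 z0 (L c1 z0 v) = - v"
    for L :: "('a, 'n) endo"
    using skew[of "L c1 z0" v "\<beta> u w", OF that(2,3)] skew[of "L c1 z0" u "\<beta> v w", OF that(2,3)]
      skew[of "L c1 z0" u "\<beta> w v", OF that(2,3)]
    by (simp add: alg.dform_def br_eq alg.g_diff_left)
  show ?thesis
    using real[of J] real[of K]
    by (simp add: ext_d2_def der alg.dOmega_def alg.lin alg.gL alg.quat)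
      (simp add: algebra_simps complex_eq_iff)
qed

lemma Z_zero: "alg.Z (I c1 z0) = 0" "alg.Z (J c1 z0) = 0" "alg.Z (K c1 z0) = 0"
proof -
  have "ext_d2 (Omega g J K c1) z0 = alg.dOmega"
    by (intro ext) (rule ext_d2_Omega)
  moreover have "part30 (I c1 z0) (ext_d2 (Omega g J K c1) z0) x u v = 0" for x u v
    using HKT c1 z0 unfolding HKT_metric_def dolbeault20_def by blast
  ultimately have "part30 (I c1 z0) alg.dOmega x u v = 0" for x u v
    by simp
  then show "alg.Z (I c1 z0) = 0" "alg.Z (J c1 z0) = 0" "alg.Z (K c1 z0) = 0"
    by (rule alg.Z_zero)+
qed

end

section \<open>The nilmanifold\<close>

locale hkt_nil = hkt_group G M c1 I J K g k
  for G :: "('a, 'z) monoid_scheme" (structure) and M :: "('a, 'n::finite) manifold"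
    and c1 :: "('a, 'n) chart" and I J K :: "('a, 'n) endo" and g :: "('a, 'n) cov2" and k :: nat +
  fixes \<Gamma> :: "'a set" and N :: "('a set, 'n) manifold" and h :: "('a set, 'n) cov2"
  assumes \<Gamma>: "subgroup \<Gamma> G" and manN: "smooth_manifold N" and topN: "topspace (mtop N) = rcosets \<Gamma>"
    and proj: "local_diffeo M N (\<lambda>x. \<Gamma> #> x)" and related_h: "related_cov2 M N (\<lambda>x. \<Gamma> #> x) g h"
begin

lemma smooth_proj: "smooth_map M N (\<lambda>x. \<Gamma> #> x)"
  using proj by (simp add: local_diffeo_def)

text \<open>The orbit map of the coset of \<open>x\<close> under the right action of the group on
  the quotient.\<close>

definition orbit :: "'a \<Rightarrow> 'a \<Rightarrow> 'a set" where
  "orbit x = (\<lambda>y. \<Gamma> #> y) \<circ> (\<lambda>y. x \<otimes> y)"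

lemma orbit_one: "x \<in> carrier G \<Longrightarrow> orbit x \<one> = \<Gamma> #> x"
  by (simp add: orbit_def)

lemma smooth_orbit: "x \<in> carrier G \<Longrightarrow> smooth_map M N (orbit x)"
  unfolding orbit_def by (rule smooth_map_compose[OF man man manN smooth_left smooth_proj])

lemma rcos_act: "x \<in> carrier G \<Longrightarrow> y \<in> carrier G \<Longrightarrow> (\<Gamma> #> x) #> y = orbit x y"
  using coset_mult_assoc[OF subgroup.subset[OF \<Gamma>]] by (simp add: orbit_def)

text \<open>The group acts on \<open>N\<close> from the right, and \<open>X c v\<close> is the vector field, in the chart \<open>c\<close>,
  generated by the tangent vector \<open>v\<close> at the identity: the image of the left-invariant field \<open>E v\<close>.\<close>

definition X :: "('a set, 'n) chart \<Rightarrow> real^'n \<Rightarrow> real^'n \<Rightarrow> real^'n" where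
  "X c v y = frechet_derivative (\<lambda>z. snd c (cinv c y #> cinv c1 z)) (at z0) v"

text \<open>The definition of \<open>X\<close> refers only to the coset, so every representative
  \<open>x\<close> may be used to compute it.\<close>

lemma X_eq_tangent:
  assumes c: "c \<in> atlas N" and x: "x \<in> carrier G" "\<Gamma> #> x \<in> fst c"
  shows "X c v (snd c (\<Gamma> #> x)) = tangent_map (orbit x) c1 c \<one> v"
proof -
  interpret c: manifold_chart N c using manN c by unfold_locales
  have "(loc_rep (orbit x) c1 c has_derivative tangent_map (orbit x) c1 c \<one>) (at z0)"
    by (rule tangent_map_has_derivative[OF man manN smooth_orbit[OF x(1)] c1 c one_c1])
      (simp add: orbit_one x)
  then have "((\<lambda>z. snd c (cinv c (snd c (\<Gamma> #> x)) #> cinv c1 z)) has_derivative tangent_map (orbit x) c1 c \<one>) (at z0)"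
    by (rule has_derivative_transform_within_open[OF _ c1.open_cimg z0])
      (simp add: loc_rep_def c.cinv_snd x rcos_act cinv_carrier)
  then show ?thesis by (simp add: X_def frechet_derivative_eqI)
qed

text \<open>Because \<open>orbit (x \<otimes> a)\<close> is \<open>orbit x\<close> after left
  translation by \<open>a\<close>, the fields \<open>E v\<close> and \<open>X c v\<close> are
  related by the orbit map at every point where the charts apply, not only at the identity.\<close>

lemma X_orbit:
  assumes c: "c \<in> atlas N" and x: "x \<in> carrier G" and a: "a \<in> fst c1" "orbit x a \<in> fst c"
  shows "X c v (snd c (orbit x a)) = tangent_map (orbit x) c1 c a (E v (snd c1 a))"
proof -
  have ac: "a \<in> carrier G" using chart_carrier[OF c1 a(1)] .
  have "orbit x a = \<Gamma> #> (x \<otimes> a)" by (simp add: orbit_def)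
  then have "X c v (snd c (orbit x a)) = tangent_map (orbit (x \<otimes> a)) c1 c \<one> v"
    using X_eq_tangent[OF c, of "x \<otimes> a"] x ac a by simp
  also have "\<dots> = tangent_map (orbit x \<circ> (\<lambda>q. a \<otimes> q)) c1 c \<one> v"
    by (rule fun_cong[OF tangent_map_cong[OF man manN smooth_map_compose[OF man man manN smooth_left smooth_orbit] c1 c one_c1]])
      (use x ac a in \<open>auto simp: topspace orbit_def m_assoc\<close>)
  also have "\<dots> = tangent_map (orbit x) c1 c a (E v (snd c1 a))"
    using tangent_map_compose[OF man man manN smooth_left smooth_orbit c1 c1 c one_c1, of a x v] x ac a
    by (simp add: tangent_left)
  finally show ?thesis .
qed

lemma tangent_orbit:
  assumes c: "c \<in> atlas N" "cx \<in> atlas M" and x: "x \<in> carrier G" "a \<in> fst c1" "x \<otimes> a \<in> fst cx" "orbit x a \<in> fst c"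
  shows "tangent_map (orbit x) c1 c a v =
    tangent_map (\<lambda>x. \<Gamma> #> x) cx c (x \<otimes> a) (tangent_map (\<lambda>y. x \<otimes> y) c1 cx a v)"
  unfolding orbit_def using tangent_map_compose[OF man man manN smooth_left[OF x(1)] smooth_proj c1 c(2,1) x(2,3)] x
  by (simp add: orbit_def)

lemma bij_tangent_orbit:
  assumes c: "c \<in> atlas N" and x: "x \<in> carrier G" "a \<in> fst c1" "orbit x a \<in> fst c"
  shows "bij (tangent_map (orbit x) c1 c a)"
proof -
  have "x \<otimes> a \<in> topspace (mtop M)" using x chart_carrier[OF c1] by (simp add: topspace)
  then obtain cx where cx: "cx \<in> atlas M" "x \<otimes> a \<in> fst cx" using manifold_chart_obtain[OF man] by blast
  have "tangent_map (orbit x) c1 c a =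
      tangent_map (\<lambda>x. \<Gamma> #> x) cx c (x \<otimes> a) \<circ> tangent_map (\<lambda>y. x \<otimes> y) c1 cx a"
    using tangent_orbit[OF c cx(1) x(1,2) cx(2) x(3)] by auto
  moreover have "bij (tangent_map (\<lambda>x. \<Gamma> #> x) cx c (x \<otimes> a))"
    using proj c cx x by (simp add: local_diffeo_def orbit_def)
  ultimately show ?thesis
    using bij_comp[OF bij_tangent_left[OF x(1) c1 cx(1) x(2) cx(2)]] by simp
qed

lemma carrier_obtain:
  assumes "c \<in> atlas N" "y \<in> cimg c"
  obtains x where "x \<in> carrier G" "\<Gamma> #> x \<in> fst c" "y = snd c (\<Gamma> #> x)"
proof -
  interpret c: manifold_chart N c using manN assms by unfold_locales
  have "cinv c y \<in> rcosets \<Gamma>" using c.cinv_top[OF assms(2)] topN by simp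
  then obtain x where "x \<in> carrier G" "cinv c y = \<Gamma> #> x" by (auto simp: RCOSETS_def)
  then show ?thesis using that c.cinv_in[OF assms(2)] c.snd_cinv[OF assms(2)] by metis
qed

text \<open>The orbit map factors into left translation by \<open>x\<close>, which preserves
  \<open>g\<close>, and the projection, which pulls \<open>h\<close> back to
  \<open>g\<close>.\<close>

lemma metric_X:
  assumes c: "c \<in> atlas N" "y \<in> cimg c"
  shows "h c y (X c u y) (X c v y) = g c1 z0 u v"
proof -
  obtain x where x: "x \<in> carrier G" "\<Gamma> #> x \<in> fst c" "y = snd c (\<Gamma> #> x)"
    using carrier_obtain[OF c] .
  obtain cx where cx: "cx \<in> atlas M" "x \<otimes> \<one> \<in> fst cx"
    using manifold_chart_obtain[OF man, of x] x by (auto simp: topspace)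
  let ?T = "tangent_map (\<lambda>y. x \<otimes> y) c1 cx \<one>"
  have X: "X c w y = tangent_map (\<lambda>x. \<Gamma> #> x) cx c (x \<otimes> \<one>) (?T w)" for w
    using tangent_orbit[OF c(1) cx(1) x(1) one_c1 cx(2)] x X_eq_tangent[OF c(1) x(1,2)] by (simp add: orbit_one)
  have "related_cov2 M M (\<lambda>y. x \<otimes> y) g g"
    using left_invariant(4) x by (simp add: left_invariant_metric_def)
  then have "g c1 z0 u v = g cx (snd cx (x \<otimes> \<one>)) (?T u) (?T v)"
    using c1 cx one_c1 unfolding related_cov2_def by blast
  also have "\<dots> = h c y (X c u y) (X c v y)"
    using related_h cx c(1) x unfolding related_cov2_def X by auto
  finally show ?thesis by simp
qed

lemma endo_X:
  assumes L: "left_invariant_endo G M L" "related_endo M N (\<lambda>x. \<Gamma> #> x) L L'"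
    and c: "c \<in> atlas N" "y \<in> cimg c"
  shows "L' c y (X c v y) = X c (L c1 z0 v) y"
proof -
  obtain x where x: "x \<in> carrier G" "\<Gamma> #> x \<in> fst c" "y = snd c (\<Gamma> #> x)"
    using carrier_obtain[OF c] .
  obtain cx where cx: "cx \<in> atlas M" "x \<otimes> \<one> \<in> fst cx"
    using manifold_chart_obtain[OF man, of x] x by (auto simp: topspace)
  let ?T = "tangent_map (\<lambda>y. x \<otimes> y) c1 cx \<one>" and ?S = "tangent_map (\<lambda>x. \<Gamma> #> x) cx c (x \<otimes> \<one>)"
  have X: "X c w y = ?S (?T w)" for w
    using tangent_orbit[OF c(1) cx(1) x(1) one_c1 cx(2)] x X_eq_tangent[OF c(1) x(1,2)] by (simp add: orbit_one)
  have "related_endo M M (\<lambda>y. x \<otimes> y) L L"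
    using L(1) x by (simp add: left_invariant_endo_def)
  then have "?T (L c1 z0 v) = L cx (snd cx (x \<otimes> \<one>)) (?T v)"
    using c1 cx one_c1 unfolding related_endo_def by blast
  moreover have "?S (L cx (snd cx (x \<otimes> \<one>)) (?T v)) = L' c y (?S (?T v))"
    using L(2) cx c(1) x unfolding related_endo_def by auto
  ultimately show ?thesis by (simp add: X)
qed

text \<open>In charts the orbit map of any representative is a local diffeomorphism that carries the
  frame \<open>E\<close> to \<open>X\<close>; all local facts about \<open>X\<close> are transported
  through it.\<close>

lemma local_frame:
  assumes c: "c \<in> atlas N" "y \<in> cimg c"
  obtains \<phi> U where "open U" "z0 \<in> U" "U \<subseteq> cimg c1" "smooth_on U \<phi>" "\<phi> z0 = y"
    "\<And>z v. z \<in> U \<Longrightarrow> X c v (\<phi> z) = frechet_derivative \<phi> (at z) (E v z)"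
    "\<And>z. z \<in> U \<Longrightarrow> bij (frechet_derivative \<phi> (at z))"
proof -
  obtain x where x: "x \<in> carrier G" "\<Gamma> #> x \<in> fst c" "y = snd c (\<Gamma> #> x)"
    using carrier_obtain[OF c] .
  define U where "U = {z \<in> cimg c1. orbit x (cinv c1 z) \<in> fst c}"
  note U = smooth_map_loc_rep[OF man manN smooth_orbit[OF x(1)] c1 c(1), folded U_def]
  let ?p = "loc_rep (orbit x) c1 c"
  have T: "tangent_map (orbit x) c1 c (cinv c1 z) = frechet_derivative ?p (at z)" if "z \<in> U" for z
    using that by (simp add: tangent_map_def c1.snd_cinv U_def)
  show ?thesis
  proof (rule that[OF U(2) _ _ U(1)])
    show "z0 \<in> U" "?p z0 = y" using x by (simp_all add: U_def z0 cinv_z0 orbit_one loc_rep_def)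
    show "U \<subseteq> cimg c1" by (auto simp: U_def)
    fix z assume z: "z \<in> U"
    then have a: "cinv c1 z \<in> fst c1" "orbit x (cinv c1 z) \<in> fst c" "z \<in> cimg c1" by (auto simp: U_def c1.cinv_in)
    show "X c v (?p z) = frechet_derivative ?p (at z) (E v z)" for v
      using X_orbit[OF c(1) x(1) a(1,2), of v] z a by (simp add: T c1.snd_cinv) (simp add: loc_rep_def)
    show "bij (frechet_derivative ?p (at z))"
      using bij_tangent_orbit[OF c(1) x(1) a(1,2)] by (simp add: T z)
  qed
qed

lemma Ck_on_X:
  assumes c: "c \<in> atlas N"
  shows "Ck_on 1 (cimg c) (X c v)"
proof (rule Ck_on_local)
  fix y assume y: "y \<in> cimg c"
  obtain \<phi> U where U: "open U" "z0 \<in> U" "U \<subseteq> cimg c1" "smooth_on U \<phi>" "\<phi> z0 = y"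
    "\<And>z v. z \<in> U \<Longrightarrow> X c v (\<phi> z) = frechet_derivative \<phi> (at z) (E v z)"
    "\<And>z. z \<in> U \<Longrightarrow> bij (frechet_derivative \<phi> (at z))" using local_frame[OF c y] by blast
  obtain V \<psi> where V: "open V" "\<phi> z0 \<in> V" "Ck_on 1 V \<psi>" "\<And>y. y \<in> V \<Longrightarrow> \<psi> y \<in> U" "\<And>y. y \<in> V \<Longrightarrow> \<phi> (\<psi> y) = y"
    using local_inverse_C1[OF U(1,2,4,7)] by blast
  have 1: "Ck_on 1 U (E v)"
    using Ck_on_subset[OF _ U(3)] smooth_E unfolding smooth_on_def by blast
  have 2: "Ck_on 1 U (\<lambda>z. frechet_derivative \<phi> (at z) b)" for b
    using smooth_on_derivative[OF U(4)] unfolding smooth_on_def by blast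
  \<comment> \<open>\<open>X\<close> is this function composed with the local inverse
    \<open>\<psi>\<close>, whose regularity is what limits the conclusion to C^1.\<close>
  have "Ck_on 1 U (\<lambda>z. frechet_derivative \<phi> (at z) (E v z))"
    by (rule Ck_on_linear_family[where B = "\<lambda>z. frechet_derivative \<phi> (at z)",
          OF U(1) smooth_on_linear_derivative[OF U(4)] 2 1])
  then have "Ck_on 1 V (\<lambda>y. frechet_derivative \<phi> (at (\<psi> y)) (E v (\<psi> y)))"
    by (rule Ck_on_compose[OF V(1) U(1) V(3)]) (use V(4) in auto)
  then have "Ck_on 1 V (X c v)"
    by (rule Ck_on_cong[OF V(1)]) (metis U(6) V(4,5))
  then show "\<exists>U. open U \<and> y \<in> U \<and> Ck_on 1 U (X c v)" using V U(5) by blast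
qed

lemma X_differentiable: "c \<in> atlas N \<Longrightarrow> y \<in> cimg c \<Longrightarrow> X c v differentiable at y"
  using Ck_on_X by (simp add: One_nat_def)

lemma
  assumes c: "c \<in> atlas N" "y \<in> cimg c"
  shows linear_X: "linear (\<lambda>v. X c v y)" and bij_X: "bij (\<lambda>v. X c v y)"
    and lie_bracket_X: "lie_bracket (X c u) (X c v) y = X c (br u v) y"
proof -
  obtain \<phi> U where U: "open U" "z0 \<in> U" "U \<subseteq> cimg c1" "smooth_on U \<phi>" "\<phi> z0 = y"
    "\<And>z v. z \<in> U \<Longrightarrow> X c v (\<phi> z) = frechet_derivative \<phi> (at z) (E v z)"
    "\<And>z. z \<in> U \<Longrightarrow> bij (frechet_derivative \<phi> (at z))" using local_frame[OF c] by blast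
  have X: "(\<lambda>v. X c v y) = frechet_derivative \<phi> (at z0)"
    using U(6)[OF U(2)] by (auto simp: U(5) E_z0)
  show "linear (\<lambda>v. X c v y)" "bij (\<lambda>v. X c v y)"
    unfolding X by (rule smooth_on_linear_derivative[OF U(4,2)], rule U(7)[OF U(2)])
  show "lie_bracket (X c u) (X c v) y = X c (br u v) y"
    using lie_bracket_related[OF U(1,2,4) E_differentiable E_differentiable _ _ U(6) U(6)] U(5)
      X_differentiable[OF c] fun_cong[OF X, of "br u v"] by (simp add: br_def)
qed

end

section \<open>The invariant frame and its density\<close>

context hkt_nil
begin

definition frame :: "('a set, 'n) chart \<Rightarrow> real^'n \<Rightarrow> real^'n^'n" where
  "frame c y = matrix (\<lambda>v. X c v y)"

text \<open>The density for which the frame has volume one. By \<open>metric_X\<close> it agrees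
  with the Riemannian density up to a constant factor.\<close>

definition \<rho> :: "('a set, 'n) chart \<Rightarrow> real^'n \<Rightarrow> real" where
  "\<rho> c y = inverse \<bar>det (frame c y)\<bar>"

context
  fixes c assumes c: "c \<in> atlas N"
begin

interpretation c: manifold_chart N c
  using manN c by unfold_locales

lemma frame_mult: "y \<in> cimg c \<Longrightarrow> frame c y *v v = X c v y"
  using linear_X[OF c] by (simp add: frame_def)

lemma frame_inverse:
  assumes "y \<in> cimg c"
  obtains R where "frame c y ** R = mat 1" "R ** frame c y = mat 1"
proof -
  have "(*v) (frame c y) = (\<lambda>v. X c v y)" using frame_mult[OF assms] by auto
  then have "invertible (frame c y)" using bij_X[OF c assms] by (simp add: invertible_eq_bij)
  then show ?thesis using that by (auto simp: invertible_def)
qed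

lemma det_frame: "y \<in> cimg c \<Longrightarrow> det (frame c y) \<noteq> 0"
  by (metis frame_inverse invertible_def invertible_det_nz)

lemma Ck_on_component: "Ck_on 1 (cimg c) (\<lambda>y. X c v y $ i)"
  by (rule Ck_on_bounded_linear_compose[OF c.open_cimg bounded_linear_vec_nth Ck_on_X[OF c]])

lemma Ck_on_det_frame: "Ck_on 1 (cimg c) (\<lambda>y. det (frame c y))"
  by (rule Ck_on_det[OF c.open_cimg])
    (simp only: frame_def matrix_def vec_lambda_beta Ck_on_component)

lemma Ck_on_\<rho>: "Ck_on 1 (cimg c) (\<rho> c)"
  unfolding \<rho>_def[abs_def]
  by (intro Ck_on_inverse Ck_on_abs c.open_cimg Ck_on_det_frame) (auto simp: det_frame)

text \<open>The fields \<open>X c u\<close> are divergence free for the density \<open>\<rho>\<close> since \<open>ad u\<close> has trace zero.\<close>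

lemma det_frame_derivative:
  assumes y: "y \<in> cimg c"
  shows "frechet_derivative (\<lambda>y. det (frame c y)) (at y) (X c u y) =
    det (frame c y) * trace (matrix (frechet_derivative (X c u) (at y)))"
proof -
  obtain R where R: "frame c y ** R = mat 1" "R ** frame c y = mat 1" using frame_inverse[OF y] .
  let ?D = "\<lambda>v. frechet_derivative (X c v) (at y)"
  define DP :: "real^'n \<Rightarrow> real^'n^'n" where "DP = (\<lambda>w. \<chi> i j. ?D (axis j 1) w $ i)"
  have dX: "(X c v has_derivative ?D v) (at y)" for v
    using X_differentiable[OF c y] by (rule has_frechet_derivative)
  have "((\<lambda>y. frame c y $ i $ j) has_derivative (\<lambda>w. DP w $ i $ j)) (at y)" for i j
    unfolding frame_def matrix_def DP_def vec_lambda_beta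
    by (rule bounded_linear.has_derivative[OF bounded_linear_vec_nth dX])
  from frechet_derivative_eqI[OF det_has_derivative[OF this R(1)]]
  have 1: "frechet_derivative (\<lambda>y. det (frame c y)) (at y) (X c u y) = det (frame c y) * trace (DP (X c u y) ** R)"
    by simp
  let ?A = "matrix (?D u)" and ?B = "matrix (br u)"
  have A: "?A *v w = ?D u w" for w
    using has_derivative_linear[OF dX] by simp
  have B: "?B *v w = br u w" for w
    using bilinear_br by (simp add: bilinear_def)
  \<comment> \<open>The relation between brackets of frame fields and \<open>br u\<close>, column by
    column: the derivative of the frame along \<open>X c u\<close> is
    \<open>?A ** frame c y + frame c y ** ?B\<close>. Multiplication by \<open>R\<close> and the
    trace separate the divergence from the trace of \<open>br u\<close>.\<close>
  have "DP (X c u y) *v axis j 1 = (?A ** frame c y + frame c y ** ?B) *v axis j 1" for j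
  proof -
    have "DP (X c u y) *v axis j 1 = ?D (axis j 1) (X c u y)"
      by (simp add: matrix_vector_mult_basis column_def DP_def)
    also have "\<dots> = ?D u (X c (axis j 1) y) + X c (br u (axis j 1)) y"
      using lie_bracket_X[OF c y, of u "axis j 1"] by (simp add: lie_bracket_def algebra_simps)
    also have "\<dots> = (?A ** frame c y + frame c y ** ?B) *v axis j 1"
      by (simp only: matrix_vector_mult_add_rdistrib matrix_vector_mul_assoc[symmetric] A B frame_mult[OF y])
    finally show ?thesis .
  qed
  then have "DP (X c u y) = ?A ** frame c y + frame c y ** ?B"
    by (simp add: vec_eq_iff matrix_vector_mult_basis column_def)
  then have "trace (DP (X c u y) ** R) = trace (?A ** frame c y ** R) + trace (frame c y ** ?B ** R)"
    by (simp add: matrix_matrix_mult_def trace_def distrib_right sum.distrib)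
  also have "trace (?A ** frame c y ** R) = trace ?A"
    by (simp only: matrix_mul_assoc[symmetric] R(1) matrix_mul_rid)
  also have "trace (frame c y ** ?B ** R) = trace (R ** (frame c y ** ?B))" by (rule trace_mul_sym)
  also have "\<dots> = trace ?B" by (simp only: matrix_mul_assoc R(2) matrix_mul_lid)
  finally show ?thesis using 1 alg.trace_ad by simp
qed

lemma \<rho>_derivative:
  assumes y: "y \<in> cimg c"
  shows "frechet_derivative (\<rho> c) (at y) (X c u y) = - \<rho> c y * trace (matrix (frechet_derivative (X c u) (at y)))"
proof -
  let ?d = "\<lambda>y. det (frame c y)" and ?s = "sgn (det (frame c y))"
  have d: "(?d has_derivative frechet_derivative ?d (at y)) (at y)"
    using Ck_on_det_frame y by (simp add: has_frechet_derivative)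
  \<comment> \<open>The sign of the determinant is constant near \<open>y\<close>, so the absolute
    value in \<open>\<rho>\<close> is there multiplication by the constant
    \<open>?s\<close>.\<close>
  have "?s * ?d y > 0" using det_frame[OF y] by (auto simp: sgn_real_def)
  moreover have "isCont (\<lambda>z. ?s * ?d z) y"
    using has_derivative_continuous[OF d] by (intro continuous_intros)
  ultimately have "eventually (\<lambda>z. ?s * ?d z > 0) (nhds y)"
    by (simp add: isCont_def tendsto_def eventually_nhds_conv_at order_tendstoD)
  then obtain S where S: "open S" "y \<in> S" "\<And>z. z \<in> S \<Longrightarrow> ?s * ?d z > 0"
    by (auto simp: eventually_nhds)
  have "((\<lambda>z. inverse (?s * ?d z)) has_derivative
      (\<lambda>h. - (inverse (?s * ?d y) * (?s * frechet_derivative ?d (at y) h) * inverse (?s * ?d y)))) (at y)"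
    using \<open>?s * ?d y > 0\<close> by (intro Deriv.has_derivative_inverse has_derivative_mult_right d) auto
  then have "(\<rho> c has_derivative
      (\<lambda>h. - (inverse (?s * ?d y) * (?s * frechet_derivative ?d (at y) h) * inverse (?s * ?d y)))) (at y)"
  proof (rule has_derivative_transform_within_open[OF _ S(1,2)])
    fix z assume "z \<in> S"
    then show "inverse (?s * ?d z) = \<rho> c z"
      using S(3)[of z] by (auto simp: \<rho>_def sgn_real_def split: if_splits)
  qed
  then show ?thesis
    using det_frame[OF y] by (simp add: frechet_derivative_eqI det_frame_derivative[OF y] \<rho>_def abs_sgn field_simps)
qed

text \<open>Since \<open>\<rho> c\<close> times \<open>X c u\<close> is divergence free, the
  integrand is the divergence of \<open>f\<close> times this field, whose components are C^1 with
  support in \<open>T\<close>.\<close>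

lemma X_integral_zero:
  assumes f: "Ck_on 1 (cimg c) f" and T: "compact T" "T \<subseteq> cimg c" "\<And>y. y \<in> cimg c - T \<Longrightarrow> f y = 0"
  shows "null_integral (cimg c) (\<lambda>y. frechet_derivative f (at y) (X c u y) * \<rho> c y)"
proof (rule null_integral_cong)
  let ?V = "\<lambda>i y. f y * (\<rho> c y * X c u y $ i)"
  show "null_integral (cimg c) (\<lambda>y. \<Sum>i\<in>UNIV. frechet_derivative (?V i) (at y) (axis i 1))"
    by (intro null_integral_sum null_integral_derivative[OF c.open_cimg _ T(1,2)] Ck_on_mult c.open_cimg
        f Ck_on_\<rho> Ck_on_component) (simp add: T(3))
  fix y assume y: "y \<in> cimg c"
  let ?D = "frechet_derivative (X c u) (at y)"
  have df: "(f has_derivative frechet_derivative f (at y)) (at y)"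
    using f y by (simp add: has_frechet_derivative)
  have dr: "(\<rho> c has_derivative frechet_derivative (\<rho> c) (at y)) (at y)"
    using Ck_on_\<rho> y by (simp add: has_frechet_derivative)
  have dX: "((\<lambda>y. X c u y $ i) has_derivative (\<lambda>h. ?D h $ i)) (at y)" for i
    by (rule bounded_linear.has_derivative[OF bounded_linear_vec_nth has_frechet_derivative[OF X_differentiable[OF c y]]])
  have V: "frechet_derivative (?V i) (at y) h = f y * (\<rho> c y * ?D h $ i + frechet_derivative (\<rho> c) (at y) h * X c u y $ i)
      + frechet_derivative f (at y) h * (\<rho> c y * X c u y $ i)" for i h
    by (subst frechet_derivative_eqI[OF has_derivative_mult[OF df has_derivative_mult[OF dr dX]]]) simp
  have coord: "(\<Sum>i\<in>UNIV. l (axis i 1) * X c u y $ i) = l (X c u y)" if "linear l" for l :: "real^'n \<Rightarrow> real"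
  proof -
    have "X c u y = (\<Sum>i\<in>UNIV. X c u y $ i *\<^sub>R axis i 1)"
      by (simp add: vec_eq_iff axis_def if_distrib sum.If_cases cong: if_cong)
    then have "l (X c u y) = l (\<Sum>i\<in>UNIV. X c u y $ i *\<^sub>R axis i 1)" by simp
    then show ?thesis using that by (simp add: linear_sum linear_scale mult.commute)
  qed
  have "(\<Sum>i\<in>UNIV. frechet_derivative (?V i) (at y) (axis i 1)) =
      f y * (\<rho> c y * trace (matrix ?D)) + f y * (\<Sum>i\<in>UNIV. frechet_derivative (\<rho> c) (at y) (axis i 1) * X c u y $ i)
      + \<rho> c y * (\<Sum>i\<in>UNIV. frechet_derivative f (at y) (axis i 1) * X c u y $ i)"
    by (simp add: V trace_def matrix_def sum.distrib sum_distrib_left algebra_simps)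
  also have "\<dots> = frechet_derivative f (at y) (X c u y) * \<rho> c y"
    by (simp add: coord has_derivative_linear[OF df] has_derivative_linear[OF dr] \<rho>_derivative[OF y])
  finally show "(\<Sum>i\<in>UNIV. frechet_derivative (?V i) (at y) (axis i 1)) = frechet_derivative f (at y) (X c u y) * \<rho> c y" .
qed

end

end

section \<open>Integrating the exterior derivative of a test form\<close>

context hkt_nil
begin

definition dir_deriv :: "('a set, 'n) cov1 \<Rightarrow> ('a set, 'n) chart \<Rightarrow> real^'n \<Rightarrow> real^'n \<Rightarrow> real^'n \<Rightarrow> real" where
  "dir_deriv \<alpha> c u v y = frechet_derivative (\<lambda>y. \<alpha> c y (X c v y)) (at y) (X c u y)"

context
  fixes c and \<alpha> :: "('a set, 'n) cov1"
  assumes c: "c \<in> atlas N" and \<alpha>: "one_form N \<alpha>"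
begin

interpretation c: manifold_chart N c
  using manN c by unfold_locales

lemma linear_form: "y \<in> cimg c \<Longrightarrow> linear (\<alpha> c y)"
  and smooth_form: "smooth_on (cimg c) (\<lambda>y. \<alpha> c y v)"
  using \<alpha> c by (auto simp: one_form_def)

lemma form_differentiable: "y \<in> cimg c \<Longrightarrow> (\<lambda>y. \<alpha> c y v) differentiable at y"
  by (rule smooth_on_differentiable[OF smooth_form])

lemma Ck_on_form_X: "Ck_on 1 (cimg c) (\<lambda>y. \<alpha> c y (X c v y))"
  by (rule Ck_on_linear_family[where B = "\<alpha> c", OF c.open_cimg linear_form _ Ck_on_X[OF c]])
    (use smooth_form in \<open>auto simp: smooth_on_def simp del: Ck_on.simps\<close>)

lemma bilinear_ext_d1: "y \<in> cimg c \<Longrightarrow> bilinear (ext_d1 (\<alpha> c) y)"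
  unfolding bilinear_def ext_d1_def
  by (auto intro!: linear_compose_sub linear_frechet_derivative form_differentiable
      linear_frechet_derivative_param[where B = "\<alpha> c", OF c.open_cimg _ linear_form])

text \<open>The invariant formula for the exterior derivative; the bracket of frame fields is again
  a frame field.\<close>

lemma ext_d1_X:
  assumes y: "y \<in> cimg c"
  shows "ext_d1 (\<alpha> c) y (X c u y) (X c v y) =
    dir_deriv \<alpha> c u v y - dir_deriv \<alpha> c v u y - \<alpha> c y (X c (br u v) y)"
proof -
  have d: "dir_deriv \<alpha> c u v y = frechet_derivative (\<lambda>z. \<alpha> c z (X c v y)) (at y) (X c u y)
      + \<alpha> c y (frechet_derivative (X c v) (at y) (X c u y))" for u v
    unfolding dir_deriv_def
    by (subst frechet_derivative_eqI[OF has_derivative_linear_family[where B = "\<alpha> c", OF c.open_cimg y linear_form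
            form_differentiable[OF y] has_frechet_derivative[OF X_differentiable[OF c y]]]]) auto
  show ?thesis
    unfolding lie_bracket_X[OF c y, symmetric]
    by (simp add: ext_d1_def d lie_bracket_def linear_diff[OF linear_form[OF y]])
qed

lemma dir_deriv_integral_zero:
  assumes "supported_in N \<alpha> (fst c)"
  shows "null_integral (cimg c) (\<lambda>y. dir_deriv \<alpha> c u v y * \<rho> c y)"
proof -
  obtain C where C: "compactin (mtop N) C" "C \<subseteq> fst c" "\<And>p v. p \<in> fst c - C \<Longrightarrow> \<alpha> c (snd c p) v = 0"
    using assms c unfolding supported_in_def by blast
  have "compactin (subtopology (mtop N) (fst c)) C"
    using C by (simp add: compactin_subtopology)
  then have "compactin euclidean (snd c ` C)"
    by (rule image_compactin[OF _ c.continuous_snd])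
  then have K: "compact (snd c ` C)" by simp
  show ?thesis
    unfolding dir_deriv_def
  proof (rule X_integral_zero[OF c Ck_on_form_X K])
    show "snd c ` C \<subseteq> cimg c" using C(2) by (auto simp: cimg_def)
    fix y assume y: "y \<in> cimg c - snd c ` C"
    then have "cinv c y \<in> fst c - C"
      using c.snd_cinv[of y] c.cinv_in[of y] by (metis Diff_iff imageI)
    from C(3)[OF this] show "\<alpha> c y (X c v y) = 0" using y c.snd_cinv[of y] by simp
  qed
qed

text \<open>In the invariant frame the metric and the fundamental form have constant components. Up
  to constants, the pairing is therefore a fixed contraction of the exterior derivative on frame
  fields, and the bracket terms add up to \<open>\<alpha>\<close> on the field of
  \<open>- alg.Z L\<close>, which is zero.\<close>

lemma integrand:
  assumes h: "riemannian_metric N h" and y: "y \<in> cimg c"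
    and L': "linear (L' c y)" and L: "linear L" "\<And>v. L' c y (X c v y) = X c (L v) y" and Z: "alg.Z L = 0"
  shows "inner2 (gram h c y) (ext_d1 (\<alpha> c) y) (fundamental_form h L' c y) * vol_density h c y =
    sqrt (det alg.G) / 2 * contract (alg.C ** (\<chi> i j. g c1 z0 (axis i 1) (L (axis j 1))) ** alg.C)
      (\<lambda>u v. (dir_deriv \<alpha> c u v y - dir_deriv \<alpha> c v u y) * \<rho> c y)"
proof -
  interpret hy: inner_form "h c y"
    using h c y by unfold_locales (auto simp: riemannian_metric_def)
  have gram: "gram h c y = hy.G" by (simp add: gram_def hy.G_def)
  let ?P = "frame c y" and ?V = "(\<chi> i j. g c1 z0 (axis i 1) (L (axis j 1))) :: real^'n^'n"
    and ?W = "(\<chi> i j. fundamental_form h L' c y (axis i 1) (axis j 1)) :: real^'n^'n"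
  note P = frame_mult[OF c y]
  obtain R where R: "?P ** R = mat 1" "R ** ?P = mat 1" using frame_inverse[OF c y] .
  have PGP: "transpose ?P ** hy.G ** ?P = alg.G"
    by (rule matrix_eq_inner)
      (simp only: matrix_vector_mul_assoc[symmetric] inner_transpose P hy.g_eq_inner[symmetric]
        alg.g_eq_inner[symmetric] metric_X[OF c y])
  have bil_W: "bilinear (fundamental_form h L' c y)"
    unfolding fundamental_form_def using bilinear_compose_linear[OF hy.bilinear linear_id L'] by simp
  have bil_W0: "bilinear (\<lambda>u v. g c1 z0 u (L v))"
    using bilinear_compose_linear[OF alg.bilinear linear_id L(1)] by simp
  have W: "X c u y \<bullet> (?W *v X c v y) = g c1 z0 u (L v)" for u v
    unfolding bilinear_eq_inner[OF bil_W, symmetric] by (simp add: fundamental_form_def L(2) metric_X[OF c y])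
  have PWP: "transpose ?P ** ?W ** ?P = ?V"
  proof (rule matrix_eq_inner)
    fix u v
    have "u \<bullet> ((transpose ?P ** ?W ** ?P) *v v) = g c1 z0 u (L v)"
      by (simp only: matrix_vector_mul_assoc[symmetric] inner_transpose P W)
    also have "\<dots> = u \<bullet> (?V *v v)" by (rule bilinear_eq_inner[OF bil_W0])
    finally show "u \<bullet> ((transpose ?P ** ?W ** ?P) *v v) = u \<bullet> (?V *v v)" .
  qed
  have "?P ** alg.C ** transpose ?P ** hy.G = ?P ** alg.C ** (transpose ?P ** hy.G ** ?P) ** R"
    by (simp only: matrix_mul_assoc[symmetric] R(1) matrix_mul_rid)
  also have "\<dots> = ?P ** (alg.C ** alg.G) ** R" unfolding PGP by (simp only: matrix_mul_assoc)
  also have "\<dots> = mat 1" by (simp only: alg.CG matrix_mul_rid R(1))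
  \<comment> \<open>The dual metric in coordinates is the constant dual metric pushed forward by the
    frame.\<close>
  finally have C: "matrix_inv (gram h c y) = ?P ** alg.C ** transpose ?P"
    using hy.C_unique by (simp add: gram hy.C_def)
  have "matrix_inv (gram h c y) ** ?W ** transpose (matrix_inv (gram h c y)) =
      ?P ** (alg.C ** (transpose ?P ** ?W ** ?P) ** alg.C) ** transpose ?P"
    unfolding C by (simp only: matrix_transpose_mul transpose_transpose alg.transpose_C matrix_mul_assoc)
  also have "\<dots> = ?P ** (alg.C ** ?V ** alg.C) ** transpose ?P" unfolding PWP ..
  finally have "inner2 (gram h c y) (ext_d1 (\<alpha> c) y) (fundamental_form h L' c y) =
      contract (?P ** (alg.C ** ?V ** alg.C) ** transpose ?P) (ext_d1 (\<alpha> c) y) / 2"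
    by (simp only: inner2_eq_contract)
  also have "contract (?P ** (alg.C ** ?V ** alg.C) ** transpose ?P) (ext_d1 (\<alpha> c) y) =
      contract (alg.C ** ?V ** alg.C) (\<lambda>u v. ext_d1 (\<alpha> c) y (X c u y) (X c v y))"
    by (simp only: contract_linear_image[OF bilinear_ext_d1[OF y], symmetric] P)
  also have "\<dots> = contract (alg.C ** ?V ** alg.C) (\<lambda>u v. dir_deriv \<alpha> c u v y - dir_deriv \<alpha> c v u y)
      - contract (alg.C ** ?V ** alg.C) (\<lambda>u v. \<alpha> c y (X c (br u v) y))"
    by (simp only: ext_d1_X[OF y] contract_diff)
  also have "contract (alg.C ** ?V ** alg.C) (\<lambda>u v. \<alpha> c y (X c (br u v) y)) =
      \<alpha> c y (X c (contract (alg.C ** ?V ** alg.C) br) y)"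
    by (rule linear_contract[OF linear_compose[OF linear_X[OF c y] linear_form[OF y]], unfolded o_def, symmetric])
  also have "\<dots> = 0"
    using linear_0[OF linear_compose[OF linear_X[OF c y] linear_form[OF y]]]
    by (simp add: alg.contract_bivector[OF L(1)] Z)
  finally have inner2: "inner2 (gram h c y) (ext_d1 (\<alpha> c) y) (fundamental_form h L' c y) =
      contract (alg.C ** ?V ** alg.C) (\<lambda>u v. dir_deriv \<alpha> c u v y - dir_deriv \<alpha> c v u y) / 2" by simp
  \<comment> \<open>Determinants of \<open>PGP\<close>: the Riemannian density is the constant
    \<open>sqrt (det alg.G)\<close> times \<open>\<rho> c y\<close>.\<close>
  have "det alg.G = det (gram h c y) * (det ?P)\<^sup>2"
    unfolding PGP[symmetric] gram by (simp add: det_mul power2_eq_square)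
  then have "sqrt (det alg.G) = vol_density h c y * \<bar>det ?P\<bar>"
    by (simp add: vol_density_def real_sqrt_mult)
  then have vol: "vol_density h c y = sqrt (det alg.G) * \<rho> c y"
    using det_frame[OF c y] by (simp add: \<rho>_def)
  show ?thesis
    unfolding inner2 vol contract_def by (simp add: sum_distrib_left sum_distrib_right sum_divide_distrib diff_divide_distrib algebra_simps)
qed

lemma codiff_integral_zero:
  assumes h: "riemannian_metric N h" and supp: "supported_in N \<alpha> (fst c)"
    and L': "\<And>y. y \<in> cimg c \<Longrightarrow> linear (L' c y)" and L: "linear L"
      "\<And>y v. y \<in> cimg c \<Longrightarrow> L' c y (X c v y) = X c (L v) y" and Z: "alg.Z L = 0"
  shows "(LINT y:cimg c|lborel. inner2 (gram h c y) (ext_d1 (\<alpha> c) y) (fundamental_form h L' c y) * vol_density h c y) = 0"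
proof -
  have "null_integral (cimg c) (\<lambda>y. sqrt (det alg.G) / 2 *
      contract (alg.C ** (\<chi> i j. g c1 z0 (axis i 1) (L (axis j 1))) ** alg.C)
      (\<lambda>u v. (dir_deriv \<alpha> c u v y - dir_deriv \<alpha> c v u y) * \<rho> c y))"
    unfolding contract_def real_scaleR_def left_diff_distrib
    by (intro null_integral_mult null_integral_sum null_integral_diff dir_deriv_integral_zero supp)
  then have "null_integral (cimg c) (\<lambda>y. inner2 (gram h c y) (ext_d1 (\<alpha> c) y) (fundamental_form h L' c y) * vol_density h c y)"
    by (rule null_integral_cong) (simp only: integrand[where L' = L' and L = L, OF h _ L' L(1) L(2) Z])
  then show ?thesis
    unfolding null_integral_def set_lebesgue_integral_def by (rule has_bochner_integral_integral_eq)
qed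

end

text \<open>The zero form is the codifferential: its pairing with any test form vanishes, and so
  does the integral on the other side. Composed with \<open>L'\<close> it is the zero Lee
  form.\<close>

lemma balanced:
  assumes h: "riemannian_metric N h"
    and L': "\<And>c y. c \<in> atlas N \<Longrightarrow> y \<in> cimg c \<Longrightarrow> linear (L' c y)" and L: "linear L"
      "\<And>c y v. c \<in> atlas N \<Longrightarrow> y \<in> cimg c \<Longrightarrow> L' c y (X c v y) = X c (L v) y" and Z: "alg.Z L = 0"
  shows "balanced N L' h"
proof -
  have "one_form N (\<lambda>c x v. 0)"
    by (auto simp: one_form_def related_cov1_def smooth_on_const linear_zero)
  moreover have "(LINT y:cimg c|lborel. inner2 (gram h c y) (ext_d1 (\<alpha> c) y) (fundamental_form h L' c y) * vol_density h c y)
      = (LINT y:cimg c|lborel. inner1 (gram h c y) (\<alpha> c y) (\<lambda>v. 0) * vol_density h c y)"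
    if "c \<in> atlas N" "one_form N \<alpha>" "supported_in N \<alpha> (fst c)" for c \<alpha>
    using codiff_integral_zero[where L' = L' and L = L, OF that(1,2) h that(3) L'[OF that(1)] L(1) L(2)[OF that(1)] Z]
    by (simp add: inner1_def)
  ultimately show ?thesis
    unfolding balanced_def is_lee_form_def is_codiff_def by (intro exI[of _ "\<lambda>c x v. 0"]) auto
qed

end

theorem corollary4p12:
  fixes G :: "('a, 'z) monoid_scheme" and M :: "('a, 'n::finite) manifold" and \<Gamma> :: "'a set"
    and N :: "('a set, 'n) manifold"
    and I J K :: "('a set, 'n) endo" and g :: "('a set, 'n) cov2"
  assumes "HKT_nilmanifold G M \<Gamma> N I J K g"
  shows "quaternionic_balanced N I J K g"
proof -
  have nil: "nilmanifold G M \<Gamma> N" and endo: "endo_field N I" "endo_field N J" "endo_field N K"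
    and g: "riemannian_metric N g"
    using assms by (auto simp: HKT_nilmanifold_def)
  obtain I0 J0 K0 g0 where hc: "hypercomplex M I0 J0 K0" and HKT: "HKT_metric M I0 J0 K0 g0"
    and inv: "left_invariant_endo G M I0" "left_invariant_endo G M J0" "left_invariant_endo G M K0"
      "left_invariant_metric G M g0"
    and rel: "related_endo M N (\<lambda>x. \<Gamma> #>\<^bsub>G\<^esub> x) I0 I" "related_endo M N (\<lambda>x. \<Gamma> #>\<^bsub>G\<^esub> x) J0 J"
      "related_endo M N (\<lambda>x. \<Gamma> #>\<^bsub>G\<^esub> x) K0 K" "related_cov2 M N (\<lambda>x. \<Gamma> #>\<^bsub>G\<^esub> x) g0 g"
    using assms unfolding HKT_nilmanifold_def by blast
  have lg: "lie_group G M" and sg: "subgroup \<Gamma> G" and "nilpotent_group G" using nil by (auto simp: nilmanifold_def)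
  from this(3) obtain k where k: "lower_central G k = {\<one>\<^bsub>G\<^esub>}" by (auto simp: nilpotent_group_def)
  have grp: "group G" and M: "smooth_manifold M" "topspace (mtop M) = carrier G"
    using lg by (auto simp: lie_group_def)
  have "\<one>\<^bsub>G\<^esub> \<in> topspace (mtop M)" using M(2) monoid.one_closed[OF group.is_monoid[OF grp]] by simp
  then obtain c1 where c1: "c1 \<in> atlas M" "\<one>\<^bsub>G\<^esub> \<in> fst c1" using manifold_chart_obtain[OF M(1)] by blast
  interpret group G by (rule grp)
  interpret hkt_nil G M c1 I0 J0 K0 g0 k \<Gamma> N g
    using lg c1 hc HKT inv k rel nil subgroup.mem_carrier[OF sg] subgroup.m_closed[OF sg]
      subgroup.one_closed[OF sg] subgroup.m_inv_closed[OF sg]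
    by unfold_locales (auto simp: nilmanifold_def)
  show ?thesis
    unfolding quaternionic_balanced_def
  proof (intro allI impI)
    fix a b c' :: real
    define z where "z = snd c1 \<one>\<^bsub>G\<^esub>"
    let ?L = "\<lambda>v. a *\<^sub>R I0 c1 z v + b *\<^sub>R J0 c1 z v + c' *\<^sub>R K0 c1 z v"
    show "balanced N (\<lambda>c x v. a *\<^sub>R I c x v + b *\<^sub>R J c x v + c' *\<^sub>R K c x v) g"
    proof (rule balanced[OF g, where L = ?L])
      show "linear (\<lambda>v. a *\<^sub>R I c y v + b *\<^sub>R J c y v + c' *\<^sub>R K c y v)" if "c \<in> atlas N" "y \<in> cimg c" for c y
        using endo that by (intro linear_compose_add linear_compose_scale_right) (auto simp: endo_field_def)
      show "linear ?L"
        using alg.lin by (intro linear_compose_add linear_compose_scale_right) (auto simp: z_def)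
      fix c y v assume c: "c \<in> atlas N" "y \<in> cimg c"
      show "a *\<^sub>R I c y (X c v y) + b *\<^sub>R J c y (X c v y) + c' *\<^sub>R K c y (X c v y) = X c (?L v) y"
        using endo_X[OF inv(1) rel(1) c] endo_X[OF inv(2) rel(2) c] endo_X[OF inv(3) rel(3) c]
        by (simp add: z_def linear_add[OF linear_X[OF c]] linear_scale[OF linear_X[OF c]])
    next
      \<comment> \<open>Linearity in the complex structure settles the whole sphere of structures at
        once.\<close>
      have "alg.Z ?L = a *\<^sub>R alg.Z (I0 c1 z) + b *\<^sub>R alg.Z (J0 c1 z) + c' *\<^sub>R alg.Z (K0 c1 z)"
        unfolding alg.Z_def
        by (simp add: contract_def bilinear_radd[OF bilinear_br] bilinear_rmul[OF bilinear_br]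
            scaleR_add_right sum.distrib scaleR_sum_right mult.commute)
      then show "alg.Z ?L = 0" by (simp add: Z_zero z_def)
    qed
  qed
qed

end
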